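(* Let $m\ge2$, $\vec\alpha\in U_m$, $1\le i\le m$, and $1<p_1,\dots,p_m,r<\infty$ with $\sum_{j=1}^m\frac1{p_j}=\frac1r$. Suppose $b\in L^p(\mathbb{R})$ for some $p\in(1,\infty)$. Then the following are equivalent: (a) $b\in BMO^d$; (b) $[b,T_\epsilon^{\vec\alpha}]_i$ is bounded from $L^{p_1}\times\cdots\times L^{p_m}$ to $L^r$ for every bounded sequence $\epsilon=\{\epsilon_I\}_{I\in\mathcal{D}}$. In particular, $b\in BMO^d$ if and only if $[b,P^{\vec\alpha}]_i$ is bounded from $L^{p_1}\times\cdots\times L^{p_m}$ to $L^r$.
   Context: $\mathcal{D}=\{[k2^{-n},(k+1)2^{-n}):k,n\in\mathbb{Z}\}$ is the standard dyadic grid on $\mathbb{R}$. For $I\in\mathcal{D}$ with left and right halves $I_-,I_+$, the Haar function is $h_I=|I|^{-1/2}(\mathbf{1}_{I_+}-\mathbf{1}_{I_-})$, and $h_I^k$ denotes its pointwise $k$-th power. $\langle f,g\rangle=\int_{\mathbb{R}}fg$ and $\langle f\rangle_I=\frac{1}{|I|}\int_I f$. For a function $f$ and $I\in\mathcal{D}$: $f(I,0)=\langle f,h_I\rangle$ and $f(I,1)=\langle f\rangle_I$. For $\vec\alpha\in\{0,1\}^m$, $\sigma(\vec\alpha)=\#\{j:\alpha_j=0\}$, and $U_m=\{0,1\}^m\setminus\{(1,\dots,1)\}$. $T_\epsilon^{\vec\alpha}(f_1,\dots,f_m)=\sum_{I\in\mathcal{D}}\epsilon_I\Big(\prod_{j=1}^m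 f_j(I,\alpha_j)\Big)h_I^{\sigma(\vec\alpha)}$; $P^{\vec\alpha}$ is $T_\epsilon^{\vec\alpha}$ with $\epsilon_I=1$ for all $I$. For an $m$-linear operator $T$, the $i$-th commutator with $b$ is $[b,T]_i(f_1,\dots,f_m)=T(f_1,\dots,f_{i-1},bf_i,f_{i+1},\dots,f_m)-b\,T(f_1,\dots,f_m)$. $BMO^d$ consists of locally integrable $b$ with $\|b\|_{BMO^d}=\sup_{I\in\mathcal{D}}\frac1{|I|}\int_I|b-\langle b\rangle_I|<\infty$. An $m$-linear operator $S$ is bounded from $L^{p_1}\times\cdots\times L^{p_m}$ to $L^r$ if $\|S(f_1,\dots,f_m)\|_{L^r}\le C\prod_j\|f_j\|_{L^{p_j}}$ for all $f_j\in L^{p_j}$. *)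

theory Defs
  imports "HOL-Analysis.Analysis"
begin

definition dint :: "int \<Rightarrow> int \<Rightarrow> real set" where
  "dint n k = {real_of_int k * 2 powr (- real_of_int n) ..< real_of_int (k + 1) * 2 powr (- real_of_int n)}"

text \<open>Haar function h_I = |I|^(-1/2) (1_{I+} - 1_{I-}); I- = dint (n+1) (2k), I+ = dint (n+1) (2k+1).\<close>
definition haar :: "int \<Rightarrow> int \<Rightarrow> real \<Rightarrow> real" where
  "haar n k x = 2 powr (real_of_int n / 2) *
     (indicator (dint (n + 1) (2 * k + 1)) x - indicator (dint (n + 1) (2 * k)) x)"

definition davg :: "(real \<Rightarrow> real) \<Rightarrow> int \<Rightarrow> int \<Rightarrow> real" where
  "davg f n k = 2 powr (real_of_int n) * (LINT x:dint n k|lborel. f x)"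

definition dcoef :: "(real \<Rightarrow> real) \<Rightarrow> int \<Rightarrow> int \<Rightarrow> nat \<Rightarrow> real" where
  "dcoef f n k a = (if a = 0 then (LINT x|lborel. f x * haar n k x) else davg f n k)"

definition sigma_alpha :: "nat \<Rightarrow> (nat \<Rightarrow> nat) \<Rightarrow> nat" where
  "sigma_alpha m \<alpha> = card {j \<in> {1..m}. \<alpha> j = 0}"

definition U_set :: "nat \<Rightarrow> (nat \<Rightarrow> nat) \<Rightarrow> bool" where
  "U_set m \<alpha> \<longleftrightarrow> (\<forall>j\<in>{1..m}. \<alpha> j \<in> {0, 1}) \<and> (\<exists>j\<in>{1..m}. \<alpha> j = 0)"

text \<open>Truncation of T_eps^alpha to scales |I| = 2^-n with -N \<le> n \<le> N.
  The inner sum over k has at most finitely many nonzero terms.\<close>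
definition T_trunc :: "(int \<Rightarrow> int \<Rightarrow> real) \<Rightarrow> nat \<Rightarrow> (nat \<Rightarrow> nat) \<Rightarrow> nat
     \<Rightarrow> (nat \<Rightarrow> real \<Rightarrow> real) \<Rightarrow> real \<Rightarrow> real" where
  "T_trunc \<epsilon> m \<alpha> N fs x =
     (\<Sum>n\<in>{- int N..int N}. infsum (\<lambda>k. \<epsilon> n k * (\<Prod>j=1..m. dcoef (fs j) n k (\<alpha> j))
          * (haar n k x) ^ sigma_alpha m \<alpha>) UNIV)"

definition comm_trunc :: "(real \<Rightarrow> real) \<Rightarrow> nat \<Rightarrow> (int \<Rightarrow> int \<Rightarrow> real) \<Rightarrow> nat \<Rightarrow> (nat \<Rightarrow> nat)
     \<Rightarrow> nat \<Rightarrow> (nat \<Rightarrow> real \<Rightarrow> real) \<Rightarrow> real \<Rightarrow> real" where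
  "comm_trunc b i \<epsilon> m \<alpha> N fs x =
     T_trunc \<epsilon> m \<alpha> N (fs(i := (\<lambda>y. b y * fs i y))) x - b x * T_trunc \<epsilon> m \<alpha> N fs x"

definition Lp_mem :: "real \<Rightarrow> (real \<Rightarrow> real) \<Rightarrow> bool" where
  "Lp_mem p f \<longleftrightarrow> f \<in> borel_measurable lborel \<and> integrable lborel (\<lambda>x. \<bar>f x\<bar> powr p)"

definition Lp_norm :: "real \<Rightarrow> (real \<Rightarrow> real) \<Rightarrow> real" where
  "Lp_norm p f = (LINT x|lborel. \<bar>f x\<bar> powr p) powr (1 / p)"

definition op_limit :: "(nat \<Rightarrow> (nat \<Rightarrow> real \<Rightarrow> real) \<Rightarrow> real \<Rightarrow> real)
     \<Rightarrow> (nat \<Rightarrow> real \<Rightarrow> real) \<Rightarrow> real \<Rightarrow> real" where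
  "op_limit S fs x = (if convergent (\<lambda>N. S N fs x) then lim (\<lambda>N. S N fs x) else 0)"

definition bounded_multi :: "nat \<Rightarrow> (nat \<Rightarrow> real) \<Rightarrow> real
     \<Rightarrow> (nat \<Rightarrow> (nat \<Rightarrow> real \<Rightarrow> real) \<Rightarrow> real \<Rightarrow> real) \<Rightarrow> bool" where
  "bounded_multi m p r S \<longleftrightarrow> (\<exists>C. \<forall>fs. (\<forall>j\<in>{1..m}. Lp_mem (p j) (fs j)) \<longrightarrow>
      (AE x in lborel. convergent (\<lambda>N. S N fs x)) \<and>
      Lp_mem r (op_limit S fs) \<and>
      Lp_norm r (op_limit S fs) \<le> C * (\<Prod>j=1..m. Lp_norm (p j) (fs j)))"

definition BMO_d :: "(real \<Rightarrow> real) \<Rightarrow> bool" where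
  "BMO_d b \<longleftrightarrow> b \<in> borel_measurable lborel \<and> (\<forall>K. compact K \<longrightarrow> set_integrable lborel K b) \<and>
     (\<exists>C. \<forall>n k. 2 powr (real_of_int n) * (LINT x:dint n k|lborel. \<bar>b x - davg b n k\<bar>) \<le> C)"

definition bounded_seq :: "(int \<Rightarrow> int \<Rightarrow> real) \<Rightarrow> bool" where
  "bounded_seq \<epsilon> \<longleftrightarrow> (\<exists>M. \<forall>n k. \<bar>\<epsilon> n k\<bar> \<le> M)"

end

theory Submission
  imports Defs
begin

text \<open>
Write \<open>E\<^sub>u f\<close> for the average of \<open>f\<close> over the dyadic interval of length \<open>2\<^bsup>-u\<^esup>\<close> around the point. A summand
of \<open>T\<close> is \<open>\<epsilon>\<close> times a product of factors \<open>E\<^bsub>u+1\<^esub> f\<^sub>j - E\<^sub>u f\<^sub>j\<close> (if \<open>\<alpha>\<^sub>j = 0\<close>) and \<open>E\<^sub>u f\<^sub>j\<close> (otherwise).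

If \<open>b\<close> is in dyadic BMO: a potential-function argument on the dyadic tree gives the endpoint weak-type bound for the
maximal truncations of \<open>T\<close>. Since \<open>[b, T] = [b - c, T]\<close> for constants \<open>c\<close>, on an interval \<open>Q\<close> one takes \<open>c = \<langle>b\<rangle>\<^sub>Q\<close>
and stops as soon as a partial sum of \<open>T f\<close> or of \<open>T (\<dots>, (b - c) f\<^sub>i, \<dots>)\<close>, or one of the averages involved,
is large compared with its expected size on \<open>Q\<close>. The stopping intervals fill at most half of \<open>Q\<close>, and recursion into them
bounds the pairing of the commutator with \<open>g\<close> by the integral of a product of maximal functions; the maximal inequality
and Hoelder's inequality finish the proof for the truncations. Fatou's lemma passes to the limit, which exists almost everywhere
by the weak-type bound (small scales) and by geometric decay (large scales).

Conversely, if some \<open>\<alpha>\<^sub>j\<close> with \<open>j \<noteq> i\<close> vanishes, then testing on \<open>h\<^sub>I\<close> and \<open>1\<^sub>I\<close> turns the commutator into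
\<open>(\<langle>b\<rangle>\<^sub>I - b) h\<^sub>I\<^sup>\<sigma>\<close>. Otherwise one takes \<open>f\<^sub>i = 1\<^sub>J\<close> and one other function equal to the Haar function of the parent of \<open>J\<close>:
all intervals not contained in \<open>J\<close> drop out and the commutator telescopes to \<open>\<plusminus>|I|\<^bsup>-1/2\<^esup> (b - \<langle>b\<rangle>\<^sub>J)\<close> with \<open>I\<close> the parent of \<open>J\<close>.
\<close>

section \<open>Dyadic intervals and averages\<close>

text \<open>Multiplication by \<open>b\<close> is what resists a direct treatment: \<open>b\<close>
  is unbounded, stopping at large averages does not bound \<open>b - c\<close> pointwise, and
  \<open>b f_i\<close> may leave the space of \<open>f_i\<close>. So \<open>b - c\<close> is kept as
  a weight, next to \<open>f_i\<close> inside the operator and next to the dual function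
  \<open>g\<close> outside, and is removed only on average, by the John--Nirenberg inequality in
  dual form. This costs an exponent \<open>s > 1\<close> on the function paired with it. The
  exponents \<open>p j\<close> and the conjugate of \<open>r\<close> all exceed 1, so there is room
  for an \<open>s\<close> below all of them, and the maximal functions of \<open>|f_j|^s\<close> and
  \<open>g^s\<close> remain bounded on the spaces left over. \<open>T\<close> itself enters only
  through a weak-type bound for locally integrable functions, which covers \<open>b f_i\<close> and
  needs no Lp theory of \<open>T\<close>. Estimates are made on one dyadic interval and for finitely
  many scales, where all sums are finite, with constants that see neither the interval nor the
  number of scales. Almost everywhere convergence, which the definition of boundedness demands, does
  not follow from norm estimates; the weak-type bound supplies it.\<close>

definition didx :: "int \<Rightarrow> real \<Rightarrow> int" where
  "didx n x = \<lfloor>x * 2 powr real_of_int n\<rfloor>"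

text \<open>Integrability on every dyadic interval is the standing assumption on functions: the
  Bochner integral of a non-integrable function is 0 by convention, so the calculus of averages
  would fail without it.\<close>

definition dloc :: "(real \<Rightarrow> real) \<Rightarrow> bool" where
  "dloc f \<longleftrightarrow> f \<in> borel_measurable borel \<and> (\<forall>n k. set_integrable lborel (dint n k) f)"

text \<open>Used next to \<open>davg\<close> because it is additive over the two halves of an
  interval, while \<open>davg\<close> is their mean; potential functions on the tree are built from
  additive quantities.\<close>

definition dI :: "(real \<Rightarrow> real) \<Rightarrow> int \<Rightarrow> int \<Rightarrow> real" where
  "dI f n k = (LINT x:dint n k|lborel. f x)"

definition dE :: "(real \<Rightarrow> real) \<Rightarrow> int \<Rightarrow> real \<Rightarrow> real" where
  "dE f u x = davg f u (didx u x)"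

lemma mem_dint: "x \<in> dint n k \<longleftrightarrow> didx n x = k"
proof -
  have p: "2 powr (- real_of_int n) = 1 / 2 powr real_of_int n"
    by (simp add: powr_minus_divide)
  have "didx n x = k \<longleftrightarrow> real_of_int k \<le> x * 2 powr n \<and> x * 2 powr n < real_of_int k + 1"
    unfolding didx_def by (simp add: floor_eq_iff)
  then show ?thesis
    unfolding dint_def p by (auto simp: field_simps)
qed

lemma didx_parent: "didx n x = didx (n + 1) x div 2"
proof -
  have "\<lfloor>(x * 2 powr real_of_int (n+1)) / real_of_int 2\<rfloor> = \<lfloor>x * 2 powr real_of_int (n+1)\<rfloor> div 2"
    by (rule floor_divide_real_eq_div) simp
  moreover have "(x * 2 powr real_of_int (n+1)) / real_of_int 2 = x * 2 powr real_of_int n"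
    by (simp add: powr_add)
  ultimately show ?thesis unfolding didx_def by metis
qed

lemma didx_coarse:
  assumes "didx l x = didx l y" "n \<le> l" shows "didx n x = didx n y"
  using assms(2,1)
proof (induction n rule: int_le_induct)
  case base then show ?case .
next
  case (step i)
  then show ?case using didx_parent[of "i - 1" x] didx_parent[of "i - 1" y] by simp
qed

lemma dint_split: "dint n k = dint (n + 1) (2 * k) \<union> dint (n + 1) (2 * k + 1)"
  using didx_parent[of n] by (auto simp: mem_dint)

lemma dint_split_disj: "dint (n + 1) (2 * k) \<inter> dint (n + 1) (2 * k + 1) = {}"
  by (auto simp: mem_dint)

lemma dint_child_cases:
  assumes "x \<in> dint n k"
  shows "x \<in> dint (n + 1) (2 * k) \<or> x \<in> dint (n + 1) (2 * k + 1)"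
  using assms dint_split by blast

lemma dint_sets [measurable]: "dint n k \<in> sets borel"
  unfolding dint_def by simp

lemma left_end_mem: "real_of_int k * 2 powr (- real_of_int n) \<in> dint n k"
  unfolding dint_def by (simp add: mult_strict_right_mono)

lemma dint_nonempty: "\<exists>x. x \<in> dint n k"
  using left_end_mem by blast

lemma emeasure_dint: "emeasure lborel (dint n k) = ennreal (2 powr (- real_of_int n))"
  unfolding dint_def by (simp add: algebra_simps)

lemma measure_dint: "measure lborel (dint n k) = 2 powr (- real_of_int n)"
  unfolding measure_def emeasure_dint by simp

lemma didx_measurable [measurable]: "didx n \<in> measurable borel (count_space UNIV)"
  unfolding didx_def by measurable

lemma didx_comp_measurable [measurable]: "(\<lambda>x. \<phi> (didx n x) :: real) \<in> borel_measurable borel"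
  by (rule measurable_compose[OF didx_measurable]) simp

lemma dE_measurable [measurable]: "dE f u \<in> borel_measurable borel"
proof -
  have "dE f u = (\<lambda>x. davg f u (didx u x))" by (auto simp: dE_def)
  then show ?thesis by simp
qed

lemma dloc_measurable: "dloc f \<Longrightarrow> f \<in> borel_measurable borel"
  by (simp add: dloc_def)

lemma dloc_integrable: "dloc f \<Longrightarrow> set_integrable lborel (dint n k) f"
  by (simp add: dloc_def)

lemma dloc_bound:
  assumes "dloc g" "f \<in> borel_measurable borel" "\<And>x. \<bar>f x\<bar> \<le> \<bar>g x\<bar>"
  shows "dloc f"
  unfolding dloc_def
proof (intro conjI allI)
  show "f \<in> borel_measurable borel" by fact
  fix n k
  show "set_integrable lborel (dint n k) f"
  proof (rule set_integrable_bound[OF dloc_integrable[OF assms(1)]])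
    show "set_borel_measurable lborel (dint n k) f"
      unfolding set_borel_measurable_def using assms(2) by measurable
    show "AE x in lborel. x \<in> dint n k \<longrightarrow> norm (f x) \<le> norm (g x)"
      using assms(3) by simp
  qed
qed

lemma dloc_const [simp]: "dloc (\<lambda>_. c)"
  unfolding dloc_def set_integrable_def
  by (auto simp: integrable_indicator_iff emeasure_dint)

lemma dloc_add: "dloc f \<Longrightarrow> dloc g \<Longrightarrow> dloc (\<lambda>x. f x + g x)"
  unfolding dloc_def by auto

lemma dloc_diff: "dloc f \<Longrightarrow> dloc g \<Longrightarrow> dloc (\<lambda>x. f x - g x)"
  unfolding dloc_def by auto

lemma dloc_cmult: "dloc f \<Longrightarrow> dloc (\<lambda>x. c * f x)"
  unfolding dloc_def
  by (intro conjI allI borel_measurable_times borel_measurable_const set_integrable_mult_right) blast+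

lemma dloc_abs: "dloc f \<Longrightarrow> dloc (\<lambda>x. \<bar>f x\<bar>)"
  unfolding dloc_def by (auto intro: set_integrable_abs)

lemma dloc_sum: "(\<And>i. i \<in> A \<Longrightarrow> dloc (f i)) \<Longrightarrow> dloc (\<lambda>x. \<Sum>i\<in>A. f i x)"
  by (induction A rule: infinite_finite_induct) (auto intro: dloc_add)

lemma set_integrable_split:
  fixes f :: "real \<Rightarrow> real"
  assumes "set_integrable lborel (dint (n+1) (2*k)) f" "set_integrable lborel (dint (n+1) (2*k+1)) f"
  shows "set_integrable lborel (dint n k) f"
  unfolding dint_split[of n k] using assms by (rule set_integrable_Un) auto

text \<open>A coarse interval is a finite union of intervals of level \<open>l\<close>, so only fine
  levels have to be inspected. In this way functions of \<open>didx l\<close> alone, possibly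
  unbounded on the line, become locally integrable.\<close>

lemma dloc_levelwise:
  assumes "f \<in> borel_measurable borel" "\<And>k n. l \<le> n \<Longrightarrow> set_integrable lborel (dint n k) f"
  shows "dloc f"
proof -
  have "set_integrable lborel (dint n k) f" if "n \<le> l" for n k
    using that
  proof (induction n arbitrary: k rule: int_le_induct)
    case base then show ?case using assms by simp
  next
    case (step i)
    then show ?case using set_integrable_split[of "i - 1" k f] by simp
  qed
  then show ?thesis unfolding dloc_def using assms by (metis linear)
qed

lemma dloc_mult_didx:
  assumes "dloc f" shows "dloc (\<lambda>x. \<phi> (didx u x) * f x)"
proof (rule dloc_levelwise[where l = u])
  show "(\<lambda>x. \<phi> (didx u x) * f x) \<in> borel_measurable borel"
    using dloc_measurable[OF assms] by measurable
  fix k n :: int assume "u \<le> n"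
  obtain y where y: "y \<in> dint n k" using dint_nonempty by blast
  have "set_integrable lborel (dint n k) (\<lambda>x. \<phi> (didx u y) * f x)"
    using dloc_integrable[OF assms] by simp
  moreover have "didx u x = didx u y" if "x \<in> dint n k" for x
    using that y didx_coarse[of n x y u] \<open>u \<le> n\<close> by (simp add: mem_dint)
  ultimately show "set_integrable lborel (dint n k) (\<lambda>x. \<phi> (didx u x) * f x)"
    by (subst set_integrable_cong[OF refl refl, where f' = "\<lambda>x. \<phi> (didx u y) * f x"]) auto
qed

lemma dloc_didx: "dloc (\<lambda>x. \<phi> (didx u x))"
  using dloc_mult_didx[OF dloc_const[of 1], of \<phi> u] by simp

lemma dloc_dE [simp]: "dloc (dE f u)"
proof -
  have "dE f u = (\<lambda>x. davg f u (didx u x))" by (auto simp: dE_def)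
  then show ?thesis using dloc_didx by simp
qed

lemma dI_add: "dloc f \<Longrightarrow> dloc g \<Longrightarrow> dI (\<lambda>x. f x + g x) n k = dI f n k + dI g n k"
  unfolding dI_def by (simp add: dloc_integrable)

lemma dI_diff: "dloc f \<Longrightarrow> dloc g \<Longrightarrow> dI (\<lambda>x. f x - g x) n k = dI f n k - dI g n k"
  unfolding dI_def by (simp add: dloc_integrable)

lemma dI_cmult: "dI (\<lambda>x. c * f x) n k = c * dI f n k"
  unfolding dI_def by simp

lemma dI_cong: "(\<And>x. x \<in> dint n k \<Longrightarrow> f x = g x) \<Longrightarrow> dI f n k = dI g n k"
  unfolding dI_def by (intro set_lebesgue_integral_cong) auto

lemma dI_mono: "dloc f \<Longrightarrow> dloc g \<Longrightarrow> (\<And>x. x \<in> dint n k \<Longrightarrow> f x \<le> g x) \<Longrightarrow> dI f n k \<le> dI g n k"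
  unfolding dI_def by (intro set_integral_mono dloc_integrable)

lemma dI_const: "dI (\<lambda>_. c) n k = c * 2 powr (- real_of_int n)"
  unfolding dI_def set_lebesgue_integral_def by (simp add: measure_dint)

lemma dI_nonneg: "(\<And>x. x \<in> dint n k \<Longrightarrow> 0 \<le> f x) \<Longrightarrow> 0 \<le> dI f n k"
  unfolding dI_def set_lebesgue_integral_def
  by (intro Bochner_Integration.integral_nonneg) (auto simp: indicator_def)

lemma dI_abs: "dloc f \<Longrightarrow> \<bar>dI f n k\<bar> \<le> dI (\<lambda>x. \<bar>f x\<bar>) n k"
  unfolding dI_def using set_integral_norm_bound[OF dloc_integrable] by auto

lemma dI_sum: "finite A \<Longrightarrow> (\<And>i. i \<in> A \<Longrightarrow> dloc (f i)) \<Longrightarrow> dI (\<lambda>x. \<Sum>i\<in>A. f i x) n k = (\<Sum>i\<in>A. dI (f i) n k)"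
proof (induction A rule: finite_induct)
  case empty then show ?case using dI_const[of 0] by simp
next
  case (insert x F) then show ?case by (simp add: dI_add dloc_sum)
qed

lemma dI_split:
  "dloc f \<Longrightarrow> dI f n k = dI f (n + 1) (2 * k) + dI f (n + 1) (2 * k + 1)"
  unfolding dI_def
  by (subst dint_split, rule set_integral_Un) (auto simp: dint_split_disj dloc_integrable)

lemma davg_dI: "davg f n k = 2 powr real_of_int n * dI f n k"
  unfolding davg_def dI_def ..

lemma dI_davg: "dI f n k = 2 powr (- real_of_int n) * davg f n k"
  unfolding davg_dI by (simp add: powr_minus)

lemma davg_split:
  "dloc f \<Longrightarrow> davg f n k = (davg f (n + 1) (2 * k) + davg f (n + 1) (2 * k + 1)) / 2"
  unfolding davg_dI by (subst dI_split) (auto simp: powr_add algebra_simps)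

lemma davg_add: "dloc f \<Longrightarrow> dloc g \<Longrightarrow> davg (\<lambda>x. f x + g x) n k = davg f n k + davg g n k"
  unfolding davg_dI by (simp add: dI_add algebra_simps)

lemma davg_diff: "dloc f \<Longrightarrow> dloc g \<Longrightarrow> davg (\<lambda>x. f x - g x) n k = davg f n k - davg g n k"
  unfolding davg_dI by (simp add: dI_diff algebra_simps)

lemma davg_cmult: "davg (\<lambda>x. c * f x) n k = c * davg f n k"
  unfolding davg_dI by (simp add: dI_cmult)

lemma davg_const [simp]: "davg (\<lambda>_. c) n k = c"
  unfolding davg_dI by (simp add: dI_const powr_minus)

lemma davg_cong: "(\<And>x. x \<in> dint n k \<Longrightarrow> f x = g x) \<Longrightarrow> davg f n k = davg g n k"
  unfolding davg_dI using dI_cong[of n k f g] by simp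

lemma davg_mono:
  "dloc f \<Longrightarrow> dloc g \<Longrightarrow> (\<And>x. x \<in> dint n k \<Longrightarrow> f x \<le> g x) \<Longrightarrow> davg f n k \<le> davg g n k"
  unfolding davg_dI by (simp add: dI_mono)

lemma davg_nonneg: "(\<And>x. x \<in> dint n k \<Longrightarrow> 0 \<le> f x) \<Longrightarrow> 0 \<le> davg f n k"
  unfolding davg_dI by (simp add: dI_nonneg)

lemma davg_abs: "dloc f \<Longrightarrow> \<bar>davg f n k\<bar> \<le> davg (\<lambda>x. \<bar>f x\<bar>) n k"
  unfolding davg_dI by (simp add: abs_mult dI_abs)

lemma davg_child_le:
  assumes "dloc f" "\<And>x. 0 \<le> f x"
  shows "davg f (n + 1) (2 * k) \<le> 2 * davg f n k" "davg f (n + 1) (2 * k + 1) \<le> 2 * davg f n k"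
  using davg_split[OF assms(1), of n k] davg_nonneg[of "n+1" "2*k" f] davg_nonneg[of "n+1" "2*k+1" f] assms(2)
  by (auto simp: field_simps)

text \<open>A half carries at most the whole integral on half the length. Stopping arguments rely on
  this doubling: at the first bad scale an average is at most twice its bound at the scale
  before.\<close>

lemma dE_child_le:
  assumes "dloc f" "\<And>x. 0 \<le> f x"
  shows "dE f (u + 1) x \<le> 2 * dE f u x"
proof -
  have "x \<in> dint u (didx u x)" by (simp add: mem_dint)
  then have "didx (u+1) x = 2 * didx u x \<or> didx (u+1) x = 2 * didx u x + 1"
    using dint_child_cases by (metis mem_dint)
  then show ?thesis unfolding dE_def using davg_child_le[OF assms, of u "didx u x"] by auto
qed

lemma dE_eq: "x \<in> dint n k \<Longrightarrow> dE f n x = davg f n k"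
  by (simp add: dE_def mem_dint)

text \<open>Additivity over halves, iterated down to level \<open>l\<close>, turns estimates on
  small intervals into one on a large interval; the sparse recursion is assembled this way.\<close>

lemma dI_mono_levels:
  assumes "dloc h" "dloc w" "n \<le> l" "\<And>j. dint l j \<subseteq> dint n k \<Longrightarrow> dI h l j \<le> dI w l j"
  shows "dI h n k \<le> dI w n k"
  using assms(3,4)
proof (induction n arbitrary: k rule: int_le_induct)
  case base then show ?case by simp
next
  case (step i)
  have *: "dint i (2*k) \<subseteq> dint (i - 1) k" "dint i (2*k+1) \<subseteq> dint (i - 1) k"
    using dint_split[of "i - 1" k] by auto
  show ?case
    using step.IH[of "2*k"] step.IH[of "2*k+1"] step.prems * 
    by (subst (1 2) dI_split) (auto intro!: add_mono simp: assms)
qed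

lemma dI_eq_levels:
  assumes "dloc h" "dloc w" "n \<le> l" "\<And>j. dint l j \<subseteq> dint n k \<Longrightarrow> dI h l j = dI w l j"
  shows "dI h n k = dI w n k"
  using dI_mono_levels[of h w n l k] dI_mono_levels[of w h n l k] assms by (simp add: order_antisym)

lemma dI_dE_self: "dI (dE f l) l j = dI f l j"
proof -
  have "dI (dE f l) l j = dI (\<lambda>_. davg f l j) l j"
    by (rule dI_cong) (simp add: dE_eq)
  then show ?thesis by (simp add: dI_const dI_davg)
qed

lemma dI_dE: "dloc f \<Longrightarrow> n \<le> l \<Longrightarrow> dI (dE f l) n k = dI f n k"
  by (rule dI_eq_levels[of _ _ n l]) (auto simp: dI_dE_self)

lemma davg_dE: "dloc f \<Longrightarrow> n \<le> l \<Longrightarrow> davg (dE f l) n k = davg f n k"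
  by (simp add: davg_dI dI_dE)

lemma davg_dE_fine:
  assumes "l \<le> n" "x \<in> dint n k" shows "davg (dE f l) n k = dE f l x"
proof -
  have "davg (dE f l) n k = davg (\<lambda>_. dE f l x) n k"
    using assms by (intro davg_cong) (auto simp: dE_def mem_dint dest!: didx_coarse[of n _ x l])
  then show ?thesis by simp
qed

lemma dE_diff: "dloc f \<Longrightarrow> dloc g \<Longrightarrow> dE (\<lambda>x. f x - g x) n x = dE f n x - dE g n x"
  by (simp add: dE_def davg_diff)

lemma dE_abs: "dloc f \<Longrightarrow> \<bar>dE f n x\<bar> \<le> dE (\<lambda>x. \<bar>f x\<bar>) n x"
  by (simp add: dE_def davg_abs)

lemma dE_nonneg: "(\<And>x. 0 \<le> f x) \<Longrightarrow> 0 \<le> dE f n x"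
  by (simp add: dE_def davg_nonneg)

text \<open>The difference is, up to sign, half the difference of the averages over the two halves;
  estimating its two terms separately would give the constant 3 instead of 1.\<close>

lemma dE_split:
  assumes "dloc f"
  shows "\<bar>dE f (u + 1) x - dE f u x\<bar> \<le> dE (\<lambda>x. \<bar>f x\<bar>) u x"
proof -
  let ?k = "didx u x"
  have "x \<in> dint u ?k" by (simp add: mem_dint)
  then have c: "didx (u+1) x = 2 * ?k \<or> didx (u+1) x = 2 * ?k + 1"
    using dint_child_cases by (metis mem_dint)
  have "\<bar>dE f (u + 1) x - dE f u x\<bar> = \<bar>davg f (u + 1) (2 * ?k) - davg f (u + 1) (2 * ?k + 1)\<bar> / 2"
    using c unfolding dE_def davg_split[OF assms, of u ?k] by (auto simp: field_simps)
  also have "\<dots> \<le> (davg (\<lambda>x. \<bar>f x\<bar>) (u + 1) (2 * ?k) + davg (\<lambda>x. \<bar>f x\<bar>) (u + 1) (2 * ?k + 1)) / 2"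
    using davg_abs[OF assms, of "u+1" "2*?k"] davg_abs[OF assms, of "u+1" "2*?k+1"] by (auto simp: abs_if split: if_splits)
  also have "\<dots> = dE (\<lambda>x. \<bar>f x\<bar>) u x"
    unfolding dE_def davg_split[OF dloc_abs[OF assms], of u ?k] ..
  finally show ?thesis .
qed

section \<open>The weak-type estimate\<close>

definition dfac :: "nat \<Rightarrow> (real \<Rightarrow> real) \<Rightarrow> int \<Rightarrow> real \<Rightarrow> real" where
  "dfac a f u x = (if a = 0 then dE f (u + 1) x - dE f u x else dE f u x)"

definition dtm :: "(int \<Rightarrow> int \<Rightarrow> real) \<Rightarrow> nat \<Rightarrow> (nat \<Rightarrow> nat) \<Rightarrow> (nat \<Rightarrow> real \<Rightarrow> real) \<Rightarrow> int \<Rightarrow> real \<Rightarrow> real" where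
  "dtm \<epsilon> m \<alpha> fs u x = \<epsilon> u (didx u x) * (\<Prod>j=1..m. dfac (\<alpha> j) (fs j) u x)"

lemma dfac_cong: "didx (u + 1) x = didx (u + 1) y \<Longrightarrow> dfac a f u x = dfac a f u y"
  using didx_parent[of u x] didx_parent[of u y] by (simp add: dfac_def dE_def)

lemma dtm_cong: "didx (u + 1) x = didx (u + 1) y \<Longrightarrow> dtm \<epsilon> m \<alpha> fs u x = dtm \<epsilon> m \<alpha> fs u y"
  using didx_parent[of u x] didx_parent[of u y] dfac_cong[of u x y] by (simp add: dtm_def)

lemma dfac_abs: "dloc f \<Longrightarrow> \<bar>dfac a f u x\<bar> \<le> dE (\<lambda>x. \<bar>f x\<bar>) u x"
  using dE_split[of f u x] dE_abs[of f u x] by (simp add: dfac_def)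

lemma dtm_abs:
  assumes "\<forall>j\<in>{1..m}. dloc (fs j)" "\<And>n k. \<bar>\<epsilon> n k\<bar> \<le> M"
  shows "\<bar>dtm \<epsilon> m \<alpha> fs u x\<bar> \<le> M * (\<Prod>j=1..m. dE (\<lambda>x. \<bar>fs j x\<bar>) u x)"
  unfolding dtm_def abs_mult abs_prod
proof (rule mult_mono)
  show "\<bar>\<epsilon> u (didx u x)\<bar> \<le> M" by fact
  show "0 \<le> M" using assms(2)[of 0 0] by linarith
  show "(\<Prod>j = 1..m. \<bar>dfac (\<alpha> j) (fs j) u x\<bar>) \<le> (\<Prod>j = 1..m. dE (\<lambda>x. \<bar>fs j x\<bar>) u x)"
    using assms(1) by (intro prod_mono) (auto intro: dfac_abs)
qed (auto intro: prod_nonneg)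

lemma dtm_measurable [measurable]: "dtm \<epsilon> m \<alpha> fs u \<in> borel_measurable borel"
  unfolding dtm_def dfac_def by measurable

lemma haar_eq:
  assumes "x \<in> dint n k"
  shows "haar n k x = (if didx (n + 1) x = 2 * k + 1 then 2 powr (real_of_int n / 2) else - (2 powr (real_of_int n / 2)))"
  using dint_child_cases[OF assms] by (auto simp: haar_def mem_dint indicator_def)

lemma haar_eq_0: "x \<notin> dint n k \<Longrightarrow> haar n k x = 0"
  by (auto simp: haar_def indicator_def dint_split[of n k])

lemma dcoef_0:
  assumes "dloc f"
  shows "dcoef f n k 0 = 2 powr (real_of_int n / 2) * (dI f (n + 1) (2 * k + 1) - dI f (n + 1) (2 * k))"
proof -
  have "dcoef f n k 0 = (LINT x|lborel. 2 powr (real_of_int n / 2) *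
      (indicator (dint (n + 1) (2 * k + 1)) x *\<^sub>R f x - indicator (dint (n + 1) (2 * k)) x *\<^sub>R f x))"
    unfolding dcoef_def haar_def by (simp add: algebra_simps)
  also have "\<dots> = 2 powr (real_of_int n / 2) * (dI f (n + 1) (2 * k + 1) - dI f (n + 1) (2 * k))"
    unfolding dI_def set_lebesgue_integral_def integral_mult_right_zero
    using dloc_integrable[OF assms, unfolded set_integrable_def]
    by (subst Bochner_Integration.integral_diff) auto
  finally show ?thesis .
qed

text \<open>The two normalisations \<open>|I|^(-1/2)\<close> multiply to \<open>1/|I|\<close>, which
  turns the integrals over the halves into half the difference of their averages, with the sign of
  the half containing \<open>x\<close>.\<close>

lemma dcoef_0_haar:
  assumes "dloc f" "x \<in> dint n k"
  shows "dcoef f n k 0 * haar n k x = dE f (n + 1) x - dE f n x"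
proof -
  have p: "2 powr (real_of_int n / 2) * 2 powr (real_of_int n / 2) = 2 powr real_of_int n"
    by (simp flip: powr_add)
  have q: "2 powr real_of_int (n + 1) = 2 * 2 powr real_of_int n" by (simp add: powr_add)
  define s :: real where "s = (if didx (n + 1) x = 2 * k + 1 then 1 else -1)"
  have "dcoef f n k 0 * haar n k x = (2 powr (real_of_int n / 2) * 2 powr (real_of_int n / 2)) * s * (dI f (n + 1) (2 * k + 1) - dI f (n + 1) (2 * k))"
    unfolding dcoef_0[OF assms(1)] haar_eq[OF assms(2)] s_def by simp
  also have "\<dots> = s * (davg f (n + 1) (2 * k + 1) - davg f (n + 1) (2 * k)) / 2"
    unfolding p davg_dI q by (simp add: algebra_simps)
  also have "\<dots> = dE f (n + 1) x - dE f n x"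
    using dint_child_cases[OF assms(2)] assms(2)
    unfolding dE_def davg_split[OF assms(1), of n k] s_def mem_dint
    by (auto simp: davg_split[OF assms(1), of n k] field_simps)
  finally show ?thesis .
qed

lemma haar_pow_sigma: "(haar n k x) ^ sigma_alpha m \<alpha> = (\<Prod>j=1..m. if \<alpha> j = 0 then haar n k x else 1)"
  unfolding sigma_alpha_def by (simp add: prod.If_cases Int_def)

lemma sigma_pos: "U_set m \<alpha> \<Longrightarrow> 0 < sigma_alpha m \<alpha>"
  unfolding U_set_def sigma_alpha_def by (auto simp: card_gt_0_iff)

text \<open>Since \<open>\<alpha>\<close> has a zero, the Haar function occurs to a positive power,
  so only the interval around \<open>x\<close> contributes (a zeroth power would be 1 everywhere).
  Distributing its factors over the slots with \<open>\<alpha> j = 0\<close> completes each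
  coefficient to a martingale difference.\<close>

lemma T_trunc_eq:
  assumes "U_set m \<alpha>" "\<forall>j\<in>{1..m}. dloc (fs j)"
  shows "T_trunc \<epsilon> m \<alpha> N fs x = (\<Sum>u\<in>{- int N..int N}. dtm \<epsilon> m \<alpha> fs u x)"
  unfolding T_trunc_def
proof (rule sum.cong[OF refl])
  fix u
  let ?F = "\<lambda>k. \<epsilon> u k * (\<Prod>j = 1..m. dcoef (fs j) u k (\<alpha> j)) * haar u k x ^ sigma_alpha m \<alpha>"
  have x: "x \<in> dint u (didx u x)" by (simp add: mem_dint)
  have "infsum ?F UNIV = infsum ?F {didx u x}"
  proof (rule infsum_cong_neutral)
    fix k assume "k \<in> UNIV - {didx u x}"
    then show "?F k = 0" using haar_eq_0[of x u k] sigma_pos[OF assms(1)] by (auto simp: mem_dint)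
  qed auto
  also have "\<dots> = ?F (didx u x)" by simp
  also have "\<dots> = \<epsilon> u (didx u x) * (\<Prod>j = 1..m. dcoef (fs j) u (didx u x) (\<alpha> j) * (if \<alpha> j = 0 then haar u (didx u x) x else 1))"
    unfolding haar_pow_sigma prod.distrib by (simp add: algebra_simps)
  also have "\<dots> = dtm \<epsilon> m \<alpha> fs u x"
    unfolding dtm_def
  proof (intro arg_cong2[where f="(*)"] refl prod.cong)
    fix j assume "j \<in> {1..m}"
    then have "dloc (fs j)" using assms by auto
    then show "dcoef (fs j) u (didx u x) (\<alpha> j) * (if \<alpha> j = 0 then haar u (didx u x) x else 1) = dfac (\<alpha> j) (fs j) u x"
      using dcoef_0_haar[OF _ x] by (auto simp: dfac_def dcoef_def dE_def)
  qed
  finally show "infsum ?F UNIV = dtm \<epsilon> m \<alpha> fs u x" .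
qed

text \<open>A union of intervals of level \<open>L\<close> is the preimage under
  \<open>didx L\<close> of a set of integers, and all of these are measurable. Stopping sets defined
  by arbitrary predicates are measurable for this reason.\<close>

lemma didx_invariant_sets:
  assumes "\<And>x y. didx L x = didx L y \<Longrightarrow> x \<in> S \<Longrightarrow> y \<in> S"
  shows "S \<in> sets borel"
proof -
  have "S = didx L -` (didx L ` S) \<inter> space borel"
  proof (intro equalityI subsetI)
    fix x assume "x \<in> didx L -` (didx L ` S) \<inter> space borel"
    then obtain y where "y \<in> S" "didx L x = didx L y" by blast
    then show "x \<in> S" using assms[of y x] by simp
  qed simp
  also have "\<dots> \<in> sets borel" by (rule measurable_sets[OF didx_measurable]) simp
  finally show ?thesis .
qed

lemma dint_sub_fmeasurable: "S \<in> sets borel \<Longrightarrow> S \<subseteq> dint n k \<Longrightarrow> S \<in> fmeasurable lborel"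
  by (rule fmeasurableI2[of "dint n k"]) (auto simp: fmeasurable_def emeasure_dint)

lemma measure_dint_sub_le: "S \<in> sets borel \<Longrightarrow> S \<subseteq> dint n k \<Longrightarrow> measure lborel S \<le> 2 powr (- real_of_int n)"
  using measure_mono_fmeasurable[of S "dint n k" lborel] dint_sub_fmeasurable[of "dint n k" n k]
  by (simp add: measure_dint)

lemma tree_hit_sets:
  "{x \<in> dint n k. \<exists>t\<in>{n..n + int d}.
     hit t (didx t x) (s + (\<Sum>u\<in>{n..<t}. a (u + 1) (didx (u + 1) x)))} \<in> sets borel" (is "?A \<in> _")
proof (rule didx_invariant_sets[of "n + int d"])
  fix x y assume xy: "didx (n + int d) x = didx (n + int d) y" and x: "x \<in> ?A"
  have e: "didx u y = didx u x" if "u \<le> n + int d" for u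
    using didx_coarse[OF xy that] by simp
  obtain t where t: "t \<in> {n..n + int d}" "hit t (didx t x) (s + (\<Sum>u\<in>{n..<t}. a (u + 1) (didx (u + 1) x)))"
    using x by auto
  have "hit t (didx t y) (s + (\<Sum>u\<in>{n..<t}. a (u + 1) (didx (u + 1) y)))"
    using t by (subst sum.cong[OF refl, of _ _ "\<lambda>u. a (u + 1) (didx (u + 1) x)"]) (auto simp: e)
  then show "y \<in> ?A" using t x by (auto simp: mem_dint e)
qed

text \<open>The maximal inequality for supermartingales on a binary tree: \<open>Xi\<close> bounds
  the measure of the hit set below a node when the partial sum on arrival is \<open>s\<close>.
  \<open>R\<close> collects nodes where \<open>Xi\<close> is known to be nonnegative; an unhit node
  passes it on to both halves, a hit one need not.\<close>

lemma tree_hit_measure: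
  fixes a :: "int \<Rightarrow> int \<Rightarrow> real" and hit :: "int \<Rightarrow> int \<Rightarrow> real \<Rightarrow> bool"
    and Xi :: "int \<Rightarrow> int \<Rightarrow> real \<Rightarrow> real" and R :: "int \<Rightarrow> int \<Rightarrow> bool"
  assumes nonneg: "\<And>n k s. R n k \<Longrightarrow> 0 \<le> Xi n k s"
    and hit: "\<And>n k s. R n k \<Longrightarrow> hit n k s \<Longrightarrow> 2 powr (- real_of_int n) \<le> Xi n k s"
    and R: "\<And>n k s. R n k \<Longrightarrow> \<not> hit n k s \<Longrightarrow> R (n + 1) (2 * k) \<and> R (n + 1) (2 * k + 1)"
    and step: "\<And>n k s. R n k \<Longrightarrow> \<not> hit n k s \<Longrightarrow>
      Xi (n + 1) (2 * k) (s + a (n + 1) (2 * k)) + Xi (n + 1) (2 * k + 1) (s + a (n + 1) (2 * k + 1)) \<le> Xi n k s"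
    and "R n k"
  shows "measure lborel {x \<in> dint n k. \<exists>t\<in>{n..n + int d}.
           hit t (didx t x) (s + (\<Sum>u\<in>{n..<t}. a (u + 1) (didx (u + 1) x)))} \<le> Xi n k s"
  using \<open>R n k\<close>
proof (induction d arbitrary: n k s)
  case 0
  show ?case
  proof (cases "hit n k s")
    case True
    have "measure lborel {x \<in> dint n k. \<exists>t\<in>{n..n + int 0}.
           hit t (didx t x) (s + (\<Sum>u\<in>{n..<t}. a (u + 1) (didx (u + 1) x)))} = measure lborel (dint n k)"
      using True by (intro arg_cong[where f = "measure lborel"]) (auto simp: mem_dint)
    then show ?thesis using hit[OF 0 True] by (simp add: measure_dint)
  next
    case False
    then have "{x \<in> dint n k. \<exists>t\<in>{n..n + int 0}.
           hit t (didx t x) (s + (\<Sum>u\<in>{n..<t}. a (u + 1) (didx (u + 1) x)))} = {}"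
      by (auto simp: mem_dint)
    then show ?thesis using nonneg[OF 0] by (simp only: measure_empty)
  qed
next
  case (Suc d)
  let ?A = "\<lambda>n k s d. {x \<in> dint n k. \<exists>t\<in>{n..n + int d}.
           hit t (didx t x) (s + (\<Sum>u\<in>{n..<t}. a (u + 1) (didx (u + 1) x)))}"
  have meas: "?A n k s d \<in> sets borel" for n k s d
    by (rule tree_hit_sets)
  have fm: "?A n k s d \<in> fmeasurable lborel" for n k s d
    by (rule dint_sub_fmeasurable[where n = n and k = k, OF meas]) blast
  show ?case
  proof (cases "hit n k s")
    case True
    have "measure lborel (?A n k s (Suc d)) \<le> 2 powr (- real_of_int n)"
      by (rule measure_dint_sub_le[OF meas]) auto
    then show ?thesis using hit[OF Suc.prems True] by simp
  next
    case False
    let ?B = "?A (n+1) (2*k) (s + a (n+1) (2*k)) d" and ?C = "?A (n+1) (2*k+1) (s + a (n+1) (2*k+1)) d"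
    have "?A n k s (Suc d) \<subseteq> ?B \<union> ?C"
    proof
      fix x assume x: "x \<in> ?A n k s (Suc d)"
      then obtain t where t: "t \<in> {n..n + int (Suc d)}"
        "hit t (didx t x) (s + (\<Sum>u\<in>{n..<t}. a (u + 1) (didx (u + 1) x)))" by auto
      \<comment> \<open>As the top node is not hit, the increment of its level can be moved into the
        starting value, which puts \<open>x\<close> into the hit set of the half that contains
        it.\<close>
      have "t \<noteq> n" using t(2) False x by (auto simp: mem_dint)
      then have "{n..<t} = insert n {n+1..<t}" and t': "t \<in> {n+1..n+1 + int d}" using t(1) by auto
      then have e: "(\<Sum>u\<in>{n..<t}. a (u + 1) (didx (u + 1) x))
        = a (n+1) (didx (n+1) x) + (\<Sum>u\<in>{n+1..<t}. a (u + 1) (didx (u + 1) x))" by simp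
      have "x \<in> dint n k" using x by auto
      from dint_child_cases[OF this] show "x \<in> ?B \<union> ?C"
      proof
        assume c: "x \<in> dint (n+1) (2*k)"
        then have "hit t (didx t x) (s + a (n+1) (2*k) + (\<Sum>u\<in>{n+1..<t}. a (u + 1) (didx (u + 1) x)))"
          using t(2) unfolding e by (simp add: mem_dint add.assoc)
        then show ?thesis using c t' by blast
      next
        assume c: "x \<in> dint (n+1) (2*k+1)"
        then have "hit t (didx t x) (s + a (n+1) (2*k+1) + (\<Sum>u\<in>{n+1..<t}. a (u + 1) (didx (u + 1) x)))"
          using t(2) unfolding e by (simp add: mem_dint add.assoc)
        then show ?thesis using c t' by blast
      qed
    qed
    then have "measure lborel (?A n k s (Suc d)) \<le> measure lborel (?B \<union> ?C)"
      by (rule measure_mono_fmeasurable[OF _ fmeasurableD[OF fm] fmeasurable.Un[OF fm fm]])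
    also have "\<dots> \<le> measure lborel ?B + measure lborel ?C"
      by (rule measure_Un_le[OF fmeasurableD[OF fm] fmeasurableD[OF fm]])
    also have "\<dots> \<le> Xi (n+1) (2*k) (s + a (n+1) (2*k)) + Xi (n+1) (2*k+1) (s + a (n+1) (2*k+1))"
      using R[OF Suc.prems False] by (intro add_mono Suc.IH) auto
    also have "\<dots> \<le> Xi n k s" by (rule step[OF Suc.prems False])
    finally show ?thesis .
  qed
qed

text \<open>The factor 2 admits the last interval reached: it is a half of one with averages at most
  \<open>\<kappa>\<close>, so its own average may have doubled.\<close>

lemma sq_avg_defect_nonneg:
  assumes "dloc f" "davg (\<lambda>x. \<bar>f x\<bar>) n k \<le> 2 * \<kappa>"
  shows "0 \<le> 2 * \<kappa> * dI (\<lambda>x. \<bar>f x\<bar>) n k - (davg f n k)\<^sup>2 * 2 powr (- real_of_int n)"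
proof -
  have "(davg f n k)\<^sup>2 = \<bar>davg f n k\<bar> * \<bar>davg f n k\<bar>" by (simp add: power2_eq_square)
  also have "\<dots> \<le> (2 * \<kappa>) * davg (\<lambda>x. \<bar>f x\<bar>) n k"
    using assms davg_abs[OF assms(1), of n k] by (intro mult_mono) auto
  finally show ?thesis unfolding dI_davg by (simp add: algebra_simps)
qed

text \<open>Parseval's identity for a single Haar function: the mean of the squares exceeds the
  square of the mean by the square of the half difference.\<close>

lemma sq_avg_split:
  assumes "dloc f"
  shows "(davg f (n+1) (2*k))\<^sup>2 * 2 powr (- real_of_int (n+1)) + (davg f (n+1) (2*k+1))\<^sup>2 * 2 powr (- real_of_int (n+1))
    = (davg f n k)\<^sup>2 * 2 powr (- real_of_int n)
      + ((davg f (n+1) (2*k+1) - davg f (n+1) (2*k)) / 2)\<^sup>2 * 2 powr (- real_of_int n)"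
proof -
  have q: "2 powr (- real_of_int (n + 1)) = 2 powr (- real_of_int n) / 2"
    by (simp add: powr_diff)
  show ?thesis unfolding q davg_split[OF assms, of n k] by (simp add: power2_eq_square field_simps)
qed

text \<open>\<open>Z\<close> watches the partial sum; the additive quantity \<open>S\<close>, the
  sum of the integrals divided by the thresholds, watches the averages; their sum is the potential
  for the tree. The constant 3 is 2 from the initial value of \<open>Z\<close> plus 1 from
  \<open>S\<close>.\<close>

lemma weak_type_from_potential:
  fixes Z :: "int \<Rightarrow> int \<Rightarrow> real \<Rightarrow> real"
  assumes loc: "\<forall>j\<in>{1..m}. dloc (fs j)" and \<kappa>: "\<forall>j\<in>{1..m}. \<kappa> j > 0"
    and nonneg: "\<And>n k s. (\<forall>j\<in>{1..m}. davg (\<lambda>x. \<bar>fs j x\<bar>) n k \<le> 2 * \<kappa> j) \<Longrightarrow> 0 \<le> Z n k s"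
    and large: "\<And>n k s. (\<forall>j\<in>{1..m}. davg (\<lambda>x. \<bar>fs j x\<bar>) n k \<le> 2 * \<kappa> j) \<Longrightarrow> lam < \<bar>s\<bar> \<Longrightarrow> 2 powr (- real_of_int n) \<le> Z n k s"
    and step: "\<And>n k s x y. (\<forall>j\<in>{1..m}. davg (\<lambda>x. \<bar>fs j x\<bar>) n k \<le> \<kappa> j) \<Longrightarrow>
       x \<in> dint (n+1) (2*k) \<Longrightarrow> y \<in> dint (n+1) (2*k+1) \<Longrightarrow>
       Z (n+1) (2*k) (s + dtm \<epsilon> m \<alpha> fs n x) + Z (n+1) (2*k+1) (s + dtm \<epsilon> m \<alpha> fs n y) \<le> Z n k s"
    and init: "Z n k 0 \<le> 2 * (\<Sum>j=1..m. dI (\<lambda>x. \<bar>fs j x\<bar>) n k / \<kappa> j)"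
  shows "measure lborel {x \<in> dint n k. \<exists>t\<in>{n..n + int d}. lam < \<bar>\<Sum>u\<in>{n..<t}. dtm \<epsilon> m \<alpha> fs u x\<bar>
            \<or> (\<exists>j\<in>{1..m}. \<kappa> j < dE (\<lambda>x. \<bar>fs j x\<bar>) t x)}
         \<le> 3 * (\<Sum>j=1..m. dI (\<lambda>x. \<bar>fs j x\<bar>) n k / \<kappa> j)"
proof -
  define S where "S n k = (\<Sum>j=1..m. dI (\<lambda>x. \<bar>fs j x\<bar>) n k / \<kappa> j)" for n k
  define R where "R n k \<longleftrightarrow> (\<forall>j\<in>{1..m}. davg (\<lambda>x. \<bar>fs j x\<bar>) n k \<le> 2 * \<kappa> j)" for n k
  define hit where "hit n k s \<longleftrightarrow> lam < \<bar>s\<bar> \<or> (\<exists>j\<in>{1..m}. \<kappa> j < davg (\<lambda>x. \<bar>fs j x\<bar>) n k)" for n k and s :: real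
  \<comment> \<open>\<open>tree_hit_measure\<close> attaches increments to nodes. A summand of level
    \<open>n - 1\<close> is constant on intervals of level \<open>n\<close>, so its value at the
    left end point serves.\<close>
  define a where "a n k = dtm \<epsilon> m \<alpha> fs (n - 1) (real_of_int k * 2 powr (- real_of_int n))" for n k
  have a: "a (n + 1) (didx (n + 1) x) = dtm \<epsilon> m \<alpha> fs n x" for n x
    using left_end_mem[of "didx (n+1) x" "n+1"] unfolding a_def
    by (simp, intro dtm_cong) (simp add: mem_dint)
  have terms_nonneg: "0 \<le> dI (\<lambda>x. \<bar>fs j x\<bar>) n k / \<kappa> j" if "j \<in> {1..m}" for j n k
  proof -
    have "\<kappa> j > 0" using \<kappa> that by auto
    then show ?thesis by (simp add: dI_nonneg)
  qed
  have S_nonneg: "0 \<le> S n k" for n k unfolding S_def by (intro sum_nonneg terms_nonneg)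
  have S_large: "2 powr (- real_of_int n) \<le> S n k" if "j \<in> {1..m}" "\<kappa> j < davg (\<lambda>x. \<bar>fs j x\<bar>) n k" for n k j
  proof -
    have "\<kappa> j > 0" using \<kappa> that by auto
    then have "2 powr (- real_of_int n) \<le> dI (\<lambda>x. \<bar>fs j x\<bar>) n k / \<kappa> j"
      unfolding dI_davg using that by (simp add: pos_le_divide_eq)
    also have "\<dots> \<le> S n k"
      unfolding S_def by (rule member_le_sum) (use that terms_nonneg in auto)
    finally show ?thesis .
  qed
  have S_split: "S n k = S (n+1) (2*k) + S (n+1) (2*k+1)" for n k
    unfolding S_def sum.distrib[symmetric] add_divide_distrib[symmetric]
    by (intro sum.cong refl arg_cong2[where f="(/)"] dI_split dloc_abs) (use loc in auto)
  have eq: "{x \<in> dint n k. \<exists>t\<in>{n..n + int d}. lam < \<bar>\<Sum>u\<in>{n..<t}. dtm \<epsilon> m \<alpha> fs u x\<bar>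
            \<or> (\<exists>j\<in>{1..m}. \<kappa> j < dE (\<lambda>x. \<bar>fs j x\<bar>) t x)}
    = {x \<in> dint n k. \<exists>t\<in>{n..n + int d}. hit t (didx t x) (0 + (\<Sum>u\<in>{n..<t}. a (u + 1) (didx (u + 1) x)))}"
    unfolding a hit_def dE_def by simp
  show ?thesis
  proof (cases "R n k")
    case True
    have "measure lborel {x \<in> dint n k. \<exists>t\<in>{n..n + int d}. hit t (didx t x) (0 + (\<Sum>u\<in>{n..<t}. a (u + 1) (didx (u + 1) x)))}
      \<le> (\<lambda>n k s. Z n k s + S n k) n k 0"
    proof (rule tree_hit_measure[where R = R])
      fix n k s assume R: "R n k"
      show "0 \<le> Z n k s + S n k" using nonneg[of n k s] R S_nonneg unfolding R_def by simp
      show "2 powr - real_of_int n \<le> Z n k s + S n k" if h: "hit n k s"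
      proof (cases "lam < \<bar>s\<bar>")
        case True
        then show ?thesis using large[of n k s] R S_nonneg[of n k] unfolding R_def by simp
      next
        case False
        then obtain j where "j \<in> {1..m}" "\<kappa> j < davg (\<lambda>x. \<bar>fs j x\<bar>) n k"
          using h unfolding hit_def by blast
        then show ?thesis using S_large[of j n k] nonneg[of n k s] R unfolding R_def by simp
      qed
      assume h: "\<not> hit n k s"
      then have k1: "\<forall>j\<in>{1..m}. davg (\<lambda>x. \<bar>fs j x\<bar>) n k \<le> \<kappa> j" unfolding hit_def by force
      show "R (n + 1) (2 * k) \<and> R (n + 1) (2 * k + 1)"
        unfolding R_def
      proof (intro conjI ballI)
        fix j assume j: "j \<in> {1..m}"
        then have "dloc (\<lambda>x. \<bar>fs j x\<bar>)" using loc by (auto intro: dloc_abs)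
        from davg_child_le[OF this, of n k] k1 j
        show "davg (\<lambda>x. \<bar>fs j x\<bar>) (n + 1) (2 * k) \<le> 2 * \<kappa> j" "davg (\<lambda>x. \<bar>fs j x\<bar>) (n + 1) (2 * k + 1) \<le> 2 * \<kappa> j"
          by force+
      qed
      obtain x y where xy: "x \<in> dint (n+1) (2*k)" "y \<in> dint (n+1) (2*k+1)" using dint_nonempty by metis
      have "a (n+1) (2*k) = dtm \<epsilon> m \<alpha> fs n x" "a (n+1) (2*k+1) = dtm \<epsilon> m \<alpha> fs n y"
        using xy a[of n x] a[of n y] by (auto simp: mem_dint)
      then show "Z (n + 1) (2 * k) (s + a (n + 1) (2 * k)) + S (n + 1) (2 * k) +
           (Z (n + 1) (2 * k + 1) (s + a (n + 1) (2 * k + 1)) + S (n + 1) (2 * k + 1)) \<le> Z n k s + S n k"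
        using step[OF k1 xy, of s] S_split[of n k] by simp
    qed (rule True)
    then show ?thesis using init unfolding eq S_def by simp
  next
    case False
    \<comment> \<open>Outside \<open>R\<close> some average on the top interval is already above its
      threshold; then \<open>S\<close> alone exceeds the length and the trivial bound is
      enough.\<close>
    then obtain j where j: "j \<in> {1..m}" "2 * \<kappa> j < davg (\<lambda>x. \<bar>fs j x\<bar>) n k" unfolding R_def by force
    moreover have "\<kappa> j > 0" using j \<kappa> by auto
    ultimately have "2 powr (- real_of_int n) \<le> S n k" using S_large[of j n k] by simp
    moreover have "measure lborel {x \<in> dint n k. \<exists>t\<in>{n..n + int d}. hit t (didx t x) (0 + (\<Sum>u\<in>{n..<t}. a (u + 1) (didx (u + 1) x)))} \<le> 2 powr (- real_of_int n)"
      by (rule measure_dint_sub_le[OF tree_hit_sets]) auto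
    ultimately show ?thesis unfolding eq S_def[symmetric] using S_nonneg[of n k] by linarith
  qed
qed

lemma abs_prod_le:
  fixes g \<kappa> :: "nat \<Rightarrow> real"
  assumes "\<And>j. j \<in> A \<Longrightarrow> \<bar>g j\<bar> \<le> \<kappa> j"
  shows "\<bar>\<Prod>j\<in>A. g j\<bar> \<le> (\<Prod>j\<in>A. \<kappa> j)"
  unfolding abs_prod using assms by (intro prod_mono) auto

text \<open>In the next two proofs \<open>Y\<close> decreases by exactly the square of the Haar coefficient when an interval is split.
  With a single cancellative slot the increments of the partial sums have mean zero, so the potential is quadratic
  in the current value; with two such slots the increments are summable by Cauchy--Schwarz and it is linear.\<close>

lemma weak_type_single:
  assumes loc: "\<forall>j\<in>{1..m}. dloc (fs j)" and \<kappa>: "\<forall>j\<in>{1..m}. \<kappa> j > 0"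
    and eps: "\<And>n k. \<bar>\<epsilon> n k\<bar> \<le> M" and "M > 0"
    and j0: "j0 \<in> {1..m}" "\<alpha> j0 = 0" and others: "\<And>j. j \<in> {1..m} - {j0} \<Longrightarrow> \<alpha> j \<noteq> 0"
  shows "measure lborel {x \<in> dint n k. \<exists>t\<in>{n..n + int d}. M * (\<Prod>j=1..m. \<kappa> j) < \<bar>\<Sum>u\<in>{n..<t}. dtm \<epsilon> m \<alpha> fs u x\<bar>
            \<or> (\<exists>j\<in>{1..m}. \<kappa> j < dE (\<lambda>x. \<bar>fs j x\<bar>) t x)}
         \<le> 3 * (\<Sum>j=1..m. dI (\<lambda>x. \<bar>fs j x\<bar>) n k / \<kappa> j)"
proof -
  define D where "D = (\<Prod>j\<in>{1..m} - {j0}. \<kappa> j)"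
  define lam where "lam = M * (\<Prod>j=1..m. \<kappa> j)"
  define Y where "Y n k = 2 * \<kappa> j0 * dI (\<lambda>x. \<bar>fs j0 x\<bar>) n k - (davg (fs j0) n k)\<^sup>2 * 2 powr (- real_of_int n)" for n k
  \<comment> \<open>One split raises the mean of the squared value by at most
    \<open>M^2 D^2 G^2\<close>, while \<open>Y\<close> loses \<open>G^2\<close> times the length;
    hence the weight of \<open>Y\<close>. Division by \<open>lam^2\<close> makes the potential at
    least the length once the value exceeds \<open>lam\<close>.\<close>
  define Z where "Z n k s = (s\<^sup>2 * 2 powr (- real_of_int n) + M\<^sup>2 * D\<^sup>2 * Y n k) / lam\<^sup>2" for n k and s :: real
  have k0: "\<kappa> j0 > 0" using \<kappa> j0 by auto
  have l0: "dloc (fs j0)" using loc j0 by auto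
  have D: "D > 0" unfolding D_def using \<kappa> by (intro prod_pos) auto
  have lam: "lam = M * D * \<kappa> j0" unfolding lam_def D_def
    using prod.remove[of "{1..m}" j0 \<kappa>] j0 by simp
  then have lam_pos: "lam > 0" using D k0 \<open>M > 0\<close> by simp
  have Y_nonneg: "0 \<le> Y n k" if "\<forall>j\<in>{1..m}. davg (\<lambda>x. \<bar>fs j x\<bar>) n k \<le> 2 * \<kappa> j" for n k
    unfolding Y_def using that j0 l0 by (intro sq_avg_defect_nonneg) auto
  show ?thesis unfolding lam_def[symmetric]
  proof (rule weak_type_from_potential[OF loc \<kappa>, where Z = Z])
    fix n k s assume R: "\<forall>j\<in>{1..m}. davg (\<lambda>x. \<bar>fs j x\<bar>) n k \<le> 2 * \<kappa> j"
    show "0 \<le> Z n k s" unfolding Z_def using Y_nonneg[OF R] by simp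
    assume s: "lam < \<bar>s\<bar>"
    then have "lam\<^sup>2 \<le> s\<^sup>2" using lam_pos by (intro abs_le_square_iff[THEN iffD1]) auto
    then have "lam\<^sup>2 * 2 powr (- real_of_int n) \<le> s\<^sup>2 * 2 powr (- real_of_int n) + M\<^sup>2 * D\<^sup>2 * Y n k"
      using Y_nonneg[OF R] by (intro add_increasing2 mult_right_mono) auto
    then show "2 powr (- real_of_int n) \<le> Z n k s"
      unfolding Z_def using lam_pos by (simp add: pos_le_divide_eq mult.commute)
  next
    fix n k s x y
    assume k1: "\<forall>j\<in>{1..m}. davg (\<lambda>x. \<bar>fs j x\<bar>) n k \<le> \<kappa> j"
      and x: "x \<in> dint (n+1) (2*k)" and y: "y \<in> dint (n+1) (2*k+1)"
    have xy: "x \<in> dint n k" "y \<in> dint n k" using x y dint_split by blast+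
    define G where "G = (davg (fs j0) (n+1) (2*k+1) - davg (fs j0) (n+1) (2*k)) / 2"
    define P where "P = (\<Prod>j\<in>{1..m} - {j0}. davg (fs j) n k)"
    have P: "\<bar>P\<bar> \<le> D" unfolding P_def D_def
    proof (rule abs_prod_le)
      fix j assume "j \<in> {1..m} - {j0}"
      then show "\<bar>davg (fs j) n k\<bar> \<le> \<kappa> j" using davg_abs[of "fs j" n k] loc k1 by force
    qed
    have pr: "(\<Prod>j\<in>{1..m} - {j0}. dfac (\<alpha> j) (fs j) n z) = P" if "z \<in> dint n k" for z
      unfolding P_def
    proof (rule prod.cong[OF refl])
      fix j assume "j \<in> {1..m} - {j0}"
      from others[OF this] show "dfac (\<alpha> j) (fs j) n z = davg (fs j) n k"
        using that by (simp add: dfac_def dE_eq)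
    qed
    have fx: "dfac (\<alpha> j0) (fs j0) n x = - G" and fy: "dfac (\<alpha> j0) (fs j0) n y = G"
      using x y xy davg_split[OF l0, of n k] j0 by (simp_all add: dfac_def dE_eq G_def field_simps)
    define a where "a = \<epsilon> n k * P * G"
    have ax: "dtm \<epsilon> m \<alpha> fs n x = - a" and ay: "dtm \<epsilon> m \<alpha> fs n y = a"
      using prod.remove[of "{1..m}" j0 "\<lambda>j. dfac (\<alpha> j) (fs j) n x"] prod.remove[of "{1..m}" j0 "\<lambda>j. dfac (\<alpha> j) (fs j) n y"]
        j0 pr xy fx fy unfolding dtm_def a_def by (simp_all add: mem_dint)
    have "\<bar>\<epsilon> n k\<bar> * \<bar>P\<bar> \<le> M * D" using eps P \<open>M > 0\<close> by (intro mult_mono) auto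
    then have "\<bar>a\<bar> \<le> \<bar>M * D * G\<bar>" unfolding a_def abs_mult using D \<open>M > 0\<close> by (simp add: mult_right_mono)
    then have a2: "a\<^sup>2 \<le> M\<^sup>2 * D\<^sup>2 * G\<^sup>2" by (simp add: abs_le_square_iff power_mult_distrib)
    have Ysp: "Y (n+1) (2*k) + Y (n+1) (2*k+1) = Y n k - G\<^sup>2 * 2 powr (- real_of_int n)"
      unfolding Y_def G_def using sq_avg_split[OF l0, of n k] dI_split[OF dloc_abs[OF l0], of n k]
      by (simp add: algebra_simps)
    have q: "2 powr (- real_of_int (n + 1)) = 2 powr (- real_of_int n) / 2" by (simp add: powr_diff)
    \<comment> \<open>The increments on the halves are opposite, so the terms linear in
      \<open>s\<close> cancel.\<close>
    have "Z (n+1) (2*k) (s - a) + Z (n+1) (2*k+1) (s + a)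
      = ((s\<^sup>2 + a\<^sup>2) * 2 powr (- real_of_int n) + M\<^sup>2 * D\<^sup>2 * (Y (n+1) (2*k) + Y (n+1) (2*k+1))) / lam\<^sup>2"
      unfolding Z_def q add_divide_distrib[symmetric]
      by (intro arg_cong2[where f = "(/)"] refl) (simp add: power2_eq_square field_simps)
    also have "\<dots> \<le> Z n k s"
      unfolding Z_def Ysp
      using mult_right_mono[OF a2, of "2 powr (- real_of_int n)"]
      by (intro divide_right_mono) (auto simp: algebra_simps)
    finally show "Z (n+1) (2*k) (s + dtm \<epsilon> m \<alpha> fs n x) + Z (n+1) (2*k+1) (s + dtm \<epsilon> m \<alpha> fs n y) \<le> Z n k s"
      unfolding ax ay by simp
  next
    have "Z n k 0 \<le> M\<^sup>2 * D\<^sup>2 * (2 * \<kappa> j0 * dI (\<lambda>x. \<bar>fs j0 x\<bar>) n k) / lam\<^sup>2"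
      unfolding Z_def Y_def by (intro divide_right_mono) (auto intro!: mult_left_mono)
    also have "\<dots> = 2 * (dI (\<lambda>x. \<bar>fs j0 x\<bar>) n k / \<kappa> j0)"
      unfolding lam using D k0 \<open>M > 0\<close> by (simp add: power2_eq_square field_simps)
    also have "dI (\<lambda>x. \<bar>fs j0 x\<bar>) n k / \<kappa> j0 \<le> (\<Sum>j=1..m. dI (\<lambda>x. \<bar>fs j x\<bar>) n k / \<kappa> j)"
      by (rule member_le_sum[of j0 "{1..m}" "\<lambda>j. dI (\<lambda>x. \<bar>fs j x\<bar>) n k / \<kappa> j"])
        (use j0 \<kappa> in \<open>auto intro!: divide_nonneg_pos dI_nonneg\<close>)
    finally show "Z n k 0 \<le> 2 * (\<Sum>j=1..m. dI (\<lambda>x. \<bar>fs j x\<bar>) n k / \<kappa> j)" by simp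
  qed
qed

lemma weak_type_double:
  assumes loc: "\<forall>j\<in>{1..m}. dloc (fs j)" and \<kappa>: "\<forall>j\<in>{1..m}. \<kappa> j > 0"
    and eps: "\<And>n k. \<bar>\<epsilon> n k\<bar> \<le> M" and "M > 0"
    and j0: "j0 \<in> {1..m}" "\<alpha> j0 = 0" and j1: "j1 \<in> {1..m}" "\<alpha> j1 = 0" "j0 \<noteq> j1"
  shows "measure lborel {x \<in> dint n k. \<exists>t\<in>{n..n + int d}. M * (\<Prod>j=1..m. \<kappa> j) < \<bar>\<Sum>u\<in>{n..<t}. dtm \<epsilon> m \<alpha> fs u x\<bar>
            \<or> (\<exists>j\<in>{1..m}. \<kappa> j < dE (\<lambda>x. \<bar>fs j x\<bar>) t x)}
         \<le> 3 * (\<Sum>j=1..m. dI (\<lambda>x. \<bar>fs j x\<bar>) n k / \<kappa> j)"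
proof -
  define D where "D = (\<Prod>j\<in>{1..m} - {j0} - {j1}. \<kappa> j)"
  define lam where "lam = M * (\<Prod>j=1..m. \<kappa> j)"
  define Y where "Y j n k = 2 * \<kappa> j * dI (\<lambda>x. \<bar>fs j x\<bar>) n k - (davg (fs j) n k)\<^sup>2 * 2 powr (- real_of_int n)" for j n k
  \<comment> \<open>The ratios of the thresholds are the weights of the arithmetic-geometric mean
    inequality in \<open>amgm\<close>. With them, each of the two slots contributes at most its
    integral divided by its own threshold after division by \<open>lam\<close>.\<close>
  define V where "V n k = M * D / 2 * (\<kappa> j1 / \<kappa> j0 * Y j0 n k + \<kappa> j0 / \<kappa> j1 * Y j1 n k)" for n k
  define Z where "Z n k s = (\<bar>s\<bar> * 2 powr (- real_of_int n) + V n k) / lam" for n k and s :: real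
  have k0: "\<kappa> j0 > 0" "\<kappa> j1 > 0" using \<kappa> j0 j1 by auto
  have l0: "dloc (fs j0)" "dloc (fs j1)" using loc j0 j1 by auto
  have D: "D > 0" unfolding D_def using \<kappa> by (intro prod_pos) auto
  have rem: "prod h {1..m} = h j0 * (h j1 * prod h ({1..m} - {j0} - {j1}))" for h :: "nat \<Rightarrow> real"
    using prod.remove[of "{1..m}" j0 h] prod.remove[of "{1..m} - {j0}" j1 h] j0 j1 by simp
  have lam: "lam = M * D * \<kappa> j0 * \<kappa> j1" unfolding lam_def D_def rem by simp
  then have lam_pos: "lam > 0" using D k0 \<open>M > 0\<close> by simp
  have V_nonneg: "0 \<le> V n k" if "\<forall>j\<in>{1..m}. davg (\<lambda>x. \<bar>fs j x\<bar>) n k \<le> 2 * \<kappa> j" for n k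
  proof -
    have "0 \<le> Y j0 n k" "0 \<le> Y j1 n k"
      unfolding Y_def using that j0 j1 l0 by (intro sq_avg_defect_nonneg; auto)+
    then show ?thesis unfolding V_def using D k0 \<open>M > 0\<close> by (intro mult_nonneg_nonneg add_nonneg_nonneg) auto
  qed
  show ?thesis unfolding lam_def[symmetric]
  proof (rule weak_type_from_potential[OF loc \<kappa>, where Z = Z])
    fix n k s assume R: "\<forall>j\<in>{1..m}. davg (\<lambda>x. \<bar>fs j x\<bar>) n k \<le> 2 * \<kappa> j"
    show "0 \<le> Z n k s" unfolding Z_def using V_nonneg[OF R] lam_pos by simp
    assume s: "lam < \<bar>s\<bar>"
    then have "lam * 2 powr (- real_of_int n) \<le> \<bar>s\<bar> * 2 powr (- real_of_int n) + V n k"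
      using V_nonneg[OF R] by (intro add_increasing2 mult_right_mono) auto
    then show "2 powr (- real_of_int n) \<le> Z n k s"
      unfolding Z_def using lam_pos by (simp add: pos_le_divide_eq mult.commute)
  next
    fix n k s x y
    assume k1: "\<forall>j\<in>{1..m}. davg (\<lambda>x. \<bar>fs j x\<bar>) n k \<le> \<kappa> j"
      and x: "x \<in> dint (n+1) (2*k)" and y: "y \<in> dint (n+1) (2*k+1)"
    have xy: "x \<in> dint n k" "y \<in> dint n k" using x y dint_split by blast+
    define G where "G j = (davg (fs j) (n+1) (2*k+1) - davg (fs j) (n+1) (2*k)) / 2" for j
    have G: "\<bar>dfac 0 (fs j) n z\<bar> = \<bar>G j\<bar>" if "dloc (fs j)" "z \<in> {x, y}" for j z
    proof -
      have "dfac 0 (fs j) n x = - G j" "dfac 0 (fs j) n y = G j"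
        using x y xy davg_split[OF that(1), of n k] by (simp_all add: dfac_def dE_eq G_def field_simps)
      then show ?thesis using that(2) by auto
    qed
    have tm: "\<bar>dtm \<epsilon> m \<alpha> fs n z\<bar> \<le> M * D * (\<bar>G j0\<bar> * \<bar>G j1\<bar>)" if "z \<in> {x, y}" for z
    proof -
      have z: "z \<in> dint n k" using that xy by auto
      have "\<bar>\<Prod>j\<in>{1..m} - {j0} - {j1}. dfac (\<alpha> j) (fs j) n z\<bar> \<le> D"
        unfolding D_def
      proof (rule abs_prod_le)
        fix j assume "j \<in> {1..m} - {j0} - {j1}"
        then show "\<bar>dfac (\<alpha> j) (fs j) n z\<bar> \<le> \<kappa> j"
          using dfac_abs[of "fs j" "\<alpha> j" n z] loc k1 dE_eq[OF z] by force
      qed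
      then have "\<bar>\<epsilon> n k\<bar> * \<bar>\<Prod>j\<in>{1..m} - {j0} - {j1}. dfac (\<alpha> j) (fs j) n z\<bar> \<le> M * D"
        using eps \<open>M > 0\<close> by (intro mult_mono) auto
      from mult_right_mono[OF this, of "\<bar>G j0\<bar> * \<bar>G j1\<bar>"] show ?thesis
        unfolding dtm_def rem using G[OF l0(1) that] G[OF l0(2) that] z j0 j1
        by (simp add: abs_mult mem_dint algebra_simps)
    qed
    have amgm: "\<bar>G j0\<bar> * \<bar>G j1\<bar> \<le> (\<kappa> j1 / \<kappa> j0 * (G j0)\<^sup>2 + \<kappa> j0 / \<kappa> j1 * (G j1)\<^sup>2) / 2"
    proof -
      have "0 \<le> (\<kappa> j1 * \<bar>G j0\<bar> - \<kappa> j0 * \<bar>G j1\<bar>)\<^sup>2" by simp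
      then show ?thesis using k0 by (simp add: field_simps power2_eq_square)
    qed
    have Ysp: "Y j (n+1) (2*k) + Y j (n+1) (2*k+1) = Y j n k - (G j)\<^sup>2 * 2 powr (- real_of_int n)" if "dloc (fs j)" for j
      unfolding Y_def G_def using sq_avg_split[OF that, of n k] dI_split[OF dloc_abs[OF that], of n k]
      by (simp add: algebra_simps)
    have Vsp: "V (n+1) (2*k) + V (n+1) (2*k+1) = V n k - M * D * ((\<kappa> j1 / \<kappa> j0 * (G j0)\<^sup>2 + \<kappa> j0 / \<kappa> j1 * (G j1)\<^sup>2) / 2) * 2 powr (- real_of_int n)"
    proof -
      have "V (n+1) (2*k) + V (n+1) (2*k+1) = M * D / 2 * (\<kappa> j1 / \<kappa> j0 * (Y j0 (n+1) (2*k) + Y j0 (n+1) (2*k+1)) + \<kappa> j0 / \<kappa> j1 * (Y j1 (n+1) (2*k) + Y j1 (n+1) (2*k+1)))"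
        unfolding V_def by (simp only: distrib_left add_ac)
      also have "\<dots> = V n k - M * D * ((\<kappa> j1 / \<kappa> j0 * (G j0)\<^sup>2 + \<kappa> j0 / \<kappa> j1 * (G j1)\<^sup>2) / 2) * 2 powr (- real_of_int n)"
        unfolding Ysp[OF l0(1)] Ysp[OF l0(2)] V_def by (simp add: algebra_simps)
      finally show ?thesis .
    qed
    have q: "2 powr (- real_of_int (n + 1)) = 2 powr (- real_of_int n) / 2" by (simp add: powr_diff)
    let ?a = "dtm \<epsilon> m \<alpha> fs n x" and ?b = "dtm \<epsilon> m \<alpha> fs n y"
    have "\<bar>s + ?a\<bar> + \<bar>s + ?b\<bar> \<le> 2 * \<bar>s\<bar> + 2 * (M * D * (\<bar>G j0\<bar> * \<bar>G j1\<bar>))"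
      using tm[of x] tm[of y] abs_triangle_ineq[of s ?a] abs_triangle_ineq[of s ?b] by force
    also have "\<dots> \<le> 2 * \<bar>s\<bar> + 2 * (M * D * ((\<kappa> j1 / \<kappa> j0 * (G j0)\<^sup>2 + \<kappa> j0 / \<kappa> j1 * (G j1)\<^sup>2) / 2))"
      using amgm D \<open>M > 0\<close> by (intro add_left_mono mult_left_mono) auto
    finally have sum2: "\<bar>s + ?a\<bar> + \<bar>s + ?b\<bar> \<le> 2 * \<bar>s\<bar> + 2 * (M * D * ((\<kappa> j1 / \<kappa> j0 * (G j0)\<^sup>2 + \<kappa> j0 / \<kappa> j1 * (G j1)\<^sup>2) / 2))" .
    have alg: "A * (w / 2) + (v - X * w) \<le> \<sigma> * w + v" if "A \<le> 2 * \<sigma> + 2 * X" "0 \<le> w" for A w v X \<sigma> :: real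
      using mult_right_mono[OF that(1), of "w / 2"] that(2) by (simp add: algebra_simps)
    have sum: "(\<bar>s + ?a\<bar> + \<bar>s + ?b\<bar>) * (2 powr (- real_of_int n) / 2) + (V (n+1) (2*k) + V (n+1) (2*k+1)) \<le> \<bar>s\<bar> * 2 powr (- real_of_int n) + V n k"
      unfolding Vsp by (rule alg[OF sum2]) simp
    have "Z (n+1) (2*k) (s + ?a) + Z (n+1) (2*k+1) (s + ?b)
      = ((\<bar>s + ?a\<bar> + \<bar>s + ?b\<bar>) * (2 powr (- real_of_int n) / 2) + (V (n+1) (2*k) + V (n+1) (2*k+1))) / lam"
      unfolding Z_def q by (simp only: add_divide_distrib[symmetric] distrib_right add_ac)
    also have "\<dots> \<le> Z n k s"
      unfolding Z_def using sum lam_pos by (intro divide_right_mono) auto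
    finally show "Z (n+1) (2*k) (s + ?a) + Z (n+1) (2*k+1) (s + ?b) \<le> Z n k s" .
  next
    have le: "Y j n k \<le> 2 * \<kappa> j * dI (\<lambda>x. \<bar>fs j x\<bar>) n k" for j unfolding Y_def by simp
    have "V n k \<le> M * D / 2 * (\<kappa> j1 / \<kappa> j0 * (2 * \<kappa> j0 * dI (\<lambda>x. \<bar>fs j0 x\<bar>) n k) + \<kappa> j0 / \<kappa> j1 * (2 * \<kappa> j1 * dI (\<lambda>x. \<bar>fs j1 x\<bar>) n k))"
      unfolding V_def using D k0 \<open>M > 0\<close> by (intro mult_left_mono add_mono le) auto
    then have "Z n k 0 \<le> M * D / 2 * (\<kappa> j1 / \<kappa> j0 * (2 * \<kappa> j0 * dI (\<lambda>x. \<bar>fs j0 x\<bar>) n k) + \<kappa> j0 / \<kappa> j1 * (2 * \<kappa> j1 * dI (\<lambda>x. \<bar>fs j1 x\<bar>) n k)) / lam"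
      unfolding Z_def using lam_pos by (intro divide_right_mono) auto
    also have "\<dots> = dI (\<lambda>x. \<bar>fs j0 x\<bar>) n k / \<kappa> j0 + dI (\<lambda>x. \<bar>fs j1 x\<bar>) n k / \<kappa> j1"
      unfolding lam using D k0 \<open>M > 0\<close> by (simp add: field_simps)
    also have "\<dots> = (\<Sum>j\<in>{j0, j1}. dI (\<lambda>x. \<bar>fs j x\<bar>) n k / \<kappa> j)" using j1 by simp
    also have "\<dots> \<le> (\<Sum>j=1..m. dI (\<lambda>x. \<bar>fs j x\<bar>) n k / \<kappa> j)"
      by (rule sum_mono2) (use j0 j1 \<kappa> in \<open>auto intro!: divide_nonneg_pos dI_nonneg\<close>)
    also have "\<dots> \<le> 2 * (\<Sum>j=1..m. dI (\<lambda>x. \<bar>fs j x\<bar>) n k / \<kappa> j)"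
    proof -
      have "0 \<le> (\<Sum>j=1..m. dI (\<lambda>x. \<bar>fs j x\<bar>) n k / \<kappa> j)"
        by (rule sum_nonneg) (use \<kappa> in \<open>auto intro!: divide_nonneg_pos dI_nonneg\<close>)
      then show ?thesis by simp
    qed
    finally show "Z n k 0 \<le> 2 * (\<Sum>j=1..m. dI (\<lambda>x. \<bar>fs j x\<bar>) n k / \<kappa> j)" .
  qed
qed

lemma weak_type:
  assumes loc: "\<forall>j\<in>{1..m}. dloc (fs j)" and \<kappa>: "\<forall>j\<in>{1..m}. \<kappa> j > 0"
    and eps: "\<And>n k. \<bar>\<epsilon> n k\<bar> \<le> M" and "M > 0" and "U_set m \<alpha>"
  shows "measure lborel {x \<in> dint n k. \<exists>t\<in>{n..n + int d}. M * (\<Prod>j=1..m. \<kappa> j) < \<bar>\<Sum>u\<in>{n..<t}. dtm \<epsilon> m \<alpha> fs u x\<bar>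
            \<or> (\<exists>j\<in>{1..m}. \<kappa> j < dE (\<lambda>x. \<bar>fs j x\<bar>) t x)}
         \<le> 3 * (\<Sum>j=1..m. dI (\<lambda>x. \<bar>fs j x\<bar>) n k / \<kappa> j)"
proof -
  obtain j0 where j0: "j0 \<in> {1..m}" "\<alpha> j0 = 0" using assms(5) unfolding U_set_def by blast
  show ?thesis
  proof (cases "\<exists>j1\<in>{1..m}. \<alpha> j1 = 0 \<and> j0 \<noteq> j1")
    case True
    then obtain j1 where j1: "j1 \<in> {1..m}" "\<alpha> j1 = 0" "j0 \<noteq> j1" by blast
    show ?thesis by (rule weak_type_double[where \<alpha> = \<alpha> and ?j0.0 = j0 and ?j1.0 = j1]) (use assms j0 j1 in auto)
  next
    case False
    show ?thesis by (rule weak_type_single[where \<alpha> = \<alpha> and ?j0.0 = j0]) (use assms j0 False in auto)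
  qed
qed

section \<open>The maximal inequality and convergence of averages in the mean\<close>

text \<open>The graph of the convex function \<open>x powr p\<close> lies above its tangent at
  \<open>y\<close>.\<close>

lemma young_tangent:
  fixes x y p :: real
  assumes "1 < p" "0 \<le> x" "0 \<le> y"
  shows "p * y powr (p - 1) * x \<le> (p - 1) * y powr p + x powr p"
proof -
  have e: "(y powr (p - 1)) powr (p / (p - 1)) = y powr p"
    using assms by (simp add: powr_powr)
  have "x * y powr (p - 1) \<le> x powr p / p + (y powr (p - 1)) powr (p / (p - 1)) / (p / (p - 1))"
    using assms by (intro Youngs_inequality) (auto simp: field_simps)
  then have "p * (x * y powr (p - 1)) \<le> p * (x powr p / p + y powr p / (p / (p - 1)))"
    unfolding e using assms by (intro mult_left_mono) auto
  also have "\<dots> = (p - 1) * y powr p + x powr p" using assms by (simp add: field_simps)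
  finally show ?thesis by (simp add: mult_ac)
qed

lemma powr_minus_one_mult: "0 \<le> y \<Longrightarrow> y powr (p - 1) * y = y powr p" for y p :: real
  by (cases "y = 0") (auto simp: powr_diff)

text \<open>Jensen's inequality: the tangent inequality at the average, integrated over the
  interval.\<close>

lemma davg_powr_le:
  assumes "1 < p" "dloc w" "dloc (\<lambda>x. w x powr p)" "\<And>x. 0 \<le> w x"
  shows "davg w n k powr p \<le> davg (\<lambda>x. w x powr p) n k"
proof -
  let ?y = "davg w n k"
  have y: "0 \<le> ?y" using assms by (intro davg_nonneg) auto
  have "davg (\<lambda>x. p * ?y powr (p - 1) * w x) n k \<le> davg (\<lambda>x. (p - 1) * ?y powr p + w x powr p) n k"
    using assms y by (intro davg_mono dloc_cmult dloc_add dloc_const) (auto intro: young_tangent)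
  then have "p * ?y powr (p - 1) * ?y \<le> (p - 1) * ?y powr p + davg (\<lambda>x. w x powr p) n k"
    by (simp add: davg_cmult davg_add assms)
  then show ?thesis using powr_minus_one_mult[OF y, of p] by (simp add: algebra_simps)
qed

lemma dloc_invariant:
  fixes g :: "real \<Rightarrow> real"
  assumes "\<And>x y. didx L x = didx L y \<Longrightarrow> g x = g y"
  shows "dloc g"
proof -
  have "g = (\<lambda>x. (\<lambda>j. g (real_of_int j * 2 powr (- real_of_int L))) (didx L x))"
  proof
    fix x show "g x = (\<lambda>j. g (real_of_int j * 2 powr (- real_of_int L))) (didx L x)"
      using left_end_mem[of "didx L x" L] by (intro assms) (simp add: mem_dint)
  qed
  then show ?thesis using dloc_didx[of "\<lambda>j. g (real_of_int j * 2 powr (- real_of_int L))" L] by simp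
qed

text \<open>Only the scales from \<open>n\<close> to \<open>n + d\<close> enter, so the maximal
  function is constant on intervals of level \<open>n + d\<close>, and its powers are locally
  integrable without further argument.\<close>

definition dmax :: "(real \<Rightarrow> real) \<Rightarrow> int \<Rightarrow> nat \<Rightarrow> real \<Rightarrow> real" where
  "dmax w n d x = Max ((\<lambda>u. dE w u x) ` {n..n + int d})"

lemma dmax_0: "dmax w n 0 x = dE w n x"
  by (simp add: dmax_def)

lemma dmax_Suc: "dmax w n (Suc d) x = max (dE w n x) (dmax w (n + 1) d x)"
proof -
  have "{n..n + int (Suc d)} = insert n {n + 1..n + 1 + int d}" by auto
  then show ?thesis unfolding dmax_def by (simp only: image_insert) (subst Max_insert, auto)
qed

lemma dE_le_dmax: "u \<in> {n..n + int d} \<Longrightarrow> dE w u x \<le> dmax w n d x"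
  unfolding dmax_def by (intro Max_ge) auto

lemma dmax_nonneg: "(\<And>x. 0 \<le> w x) \<Longrightarrow> 0 \<le> dmax w n d x"
  using dE_le_dmax[of n n d w x] dE_nonneg[of w n x] by force

lemma dmax_cong: "didx (n + int d) x = didx (n + int d) y \<Longrightarrow> dmax w n d x = dmax w n d y"
  unfolding dmax_def by (intro arg_cong[where f = Max] image_cong refl) (auto simp: dE_def dest: didx_coarse)

text \<open>The second summand is Burkholder's special function for the maximal inequality:
  it is linear in the average as long as the running maximum \<open>t\<close> does not change, and it dominates
  the values after a new maximum has been reached.\<close>

lemma dyadic_doob_aux:
  assumes p: "1 < p" and w: "dloc w" "dloc (\<lambda>x. w x powr p)" "\<And>x. 0 \<le> w x"
    and t: "davg w n k \<le> t" and q: "q = p / (p - 1)"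
  shows "dI (\<lambda>x. max t (dmax w n d x) powr p) n k
    \<le> q powr p * dI (\<lambda>x. w x powr p) n k + 2 powr (- real_of_int n) * (p * t powr (p - 1) * (t - q * davg w n k))"
  using t
proof (induction d arbitrary: n k t)
  case 0
  let ?y = "davg w n k"
  have y: "0 \<le> ?y" using w by (intro davg_nonneg) auto
  have q0: "0 \<le> q" using p q by simp
  have t: "0 \<le> t" using y 0 by simp
  \<comment> \<open>At the bottom, the tangent at \<open>t\<close> is evaluated at
    \<open>q * ?y\<close>; Jensen's inequality then replaces the power of the average by the average
    of the power.\<close>
  have "p * t powr (p - 1) * (q * ?y) \<le> (p - 1) * t powr p + (q * ?y) powr p"
    using p t y q0 by (intro young_tangent) auto
  also have "(q * ?y) powr p = q powr p * ?y powr p" using y q0 by (simp add: powr_mult)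
  also have "\<dots> \<le> q powr p * davg (\<lambda>x. w x powr p) n k"
    using davg_powr_le[OF p w, of n k] by (intro mult_left_mono) auto
  finally have "t powr p \<le> q powr p * davg (\<lambda>x. w x powr p) n k + p * t powr (p - 1) * (t - q * ?y)"
    using powr_minus_one_mult[OF t, of p] by (simp add: algebra_simps)
  from mult_left_mono[OF this, of "2 powr (- real_of_int n)"]
  have "2 powr (- real_of_int n) * t powr p \<le> q powr p * dI (\<lambda>x. w x powr p) n k + 2 powr (- real_of_int n) * (p * t powr (p - 1) * (t - q * ?y))"
    unfolding dI_davg by (simp add: algebra_simps)
  moreover have "dI (\<lambda>x. max t (dmax w n 0 x) powr p) n k = dI (\<lambda>_. t powr p) n k"
    by (rule dI_cong) (use 0 in \<open>simp add: dmax_0 dE_eq max_absorb1\<close>)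
  ultimately show ?case by (simp add: dI_const mult.commute)
next
  case (Suc d)
  let ?y = "davg w n k"
  have y: "0 \<le> ?y" using w by (intro davg_nonneg) auto
  have t: "0 \<le> t" using y Suc.prems by simp
  have loc: "dloc (\<lambda>x. max t (dmax w n (Suc d) x) powr p)"
  proof (rule dloc_invariant)
    fix x y assume "didx (n + int (Suc d)) x = didx (n + int (Suc d)) y"
    from dmax_cong[OF this] show "max t (dmax w n (Suc d) x) powr p = max t (dmax w n (Suc d) y) powr p" by simp
  qed
  have child: "dI (\<lambda>x. max t (dmax w n (Suc d) x) powr p) (n + 1) c \<le>
      q powr p * dI (\<lambda>x. w x powr p) (n + 1) c + 2 powr (- real_of_int (n + 1)) * (p * t powr (p - 1) * (t - q * davg w (n + 1) c))"
    if c: "dint (n + 1) c \<subseteq> dint n k" for c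
  proof -
    let ?yc = "davg w (n + 1) c"
    let ?t = "max t ?yc"
    have yc: "0 \<le> ?yc" using w by (intro davg_nonneg) auto
    have "dI (\<lambda>x. max t (dmax w n (Suc d) x) powr p) (n + 1) c = dI (\<lambda>x. max ?t (dmax w (n + 1) d x) powr p) (n + 1) c"
    proof (rule dI_cong)
      fix x assume x: "x \<in> dint (n + 1) c"
      then have "x \<in> dint n k" using c by auto
      then have "dE w n x \<le> t" using Suc.prems by (simp add: dE_eq)
      moreover have "?yc \<le> dmax w (n + 1) d x" using dE_le_dmax[of "n+1" "n+1" d w x] dE_eq[OF x] by simp
      ultimately have "max t (dmax w n (Suc d) x) = max ?t (dmax w (n + 1) d x)" unfolding dmax_Suc by linarith
      then show "max t (dmax w n (Suc d) x) powr p = max ?t (dmax w (n + 1) d x) powr p" by simp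
    qed
    also have "\<dots> \<le> q powr p * dI (\<lambda>x. w x powr p) (n + 1) c + 2 powr (- real_of_int (n + 1)) * (p * ?t powr (p - 1) * (?t - q * ?yc))"
      by (rule Suc.IH) simp
    also have "p * ?t powr (p - 1) * (?t - q * ?yc) \<le> p * t powr (p - 1) * (t - q * ?yc)"
    proof (cases "?yc \<le> t")
      case True then show ?thesis by (simp add: max_def)
    next
      case False
      \<comment> \<open>At a new maximum the left side equals \<open>- q * ?yc powr p\<close>, and
        the claim is the tangent inequality at \<open>t\<close>, multiplied by
        \<open>q\<close>.\<close>
      have "p * t powr (p - 1) * ?yc \<le> (p - 1) * t powr p + ?yc powr p"
        using p t yc by (intro young_tangent) auto
      then have "- (?yc powr p) \<le> (p - 1) * t powr p - p * t powr (p - 1) * ?yc" by simp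
      then have "p / (p - 1) * - (?yc powr p) \<le> p / (p - 1) * ((p - 1) * t powr p - p * t powr (p - 1) * ?yc)"
        using p by (intro mult_left_mono) auto
      also have "\<dots> = p * t powr p - p * t powr (p - 1) * (q * ?yc)"
        using p unfolding q by (simp add: field_simps)
      also have "\<dots> = p * t powr (p - 1) * (t - q * ?yc)"
        using powr_minus_one_mult[OF t, of p] by (simp add: algebra_simps)
      finally have "p / (p - 1) * - (?yc powr p) \<le> p * t powr (p - 1) * (t - q * ?yc)" .
      moreover have "p * ?yc powr (p - 1) * (?yc - q * ?yc) = p / (p - 1) * - (?yc powr p)"
      proof -
        have "p * ?yc powr (p - 1) * (?yc - q * ?yc) = p * (1 - q) * (?yc powr (p - 1) * ?yc)" by (simp add: algebra_simps)
        also have "p * (1 - q) = - (p / (p - 1))" using p unfolding q by (simp add: field_simps)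
        finally show ?thesis using powr_minus_one_mult[OF yc, of p] by simp
      qed
      ultimately show ?thesis using False by (simp add: max_def)
    qed
    finally show ?thesis by simp
  qed
  have sub: "dint (n+1) (2*k) \<subseteq> dint n k" "dint (n+1) (2*k+1) \<subseteq> dint n k" using dint_split by blast+
  have h: "2 powr (- real_of_int (n + 1)) = 2 powr (- real_of_int n) / 2" by (simp add: powr_diff)
  have "dI (\<lambda>x. max t (dmax w n (Suc d) x) powr p) n k \<le>
     (q powr p * dI (\<lambda>x. w x powr p) (n + 1) (2*k) + 2 powr (- real_of_int (n + 1)) * (p * t powr (p - 1) * (t - q * davg w (n + 1) (2*k))))
   + (q powr p * dI (\<lambda>x. w x powr p) (n + 1) (2*k+1) + 2 powr (- real_of_int (n + 1)) * (p * t powr (p - 1) * (t - q * davg w (n + 1) (2*k+1))))"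
    unfolding dI_split[OF loc, of n k] by (intro add_mono child sub)
  also have "\<dots> = q powr p * dI (\<lambda>x. w x powr p) n k + 2 powr (- real_of_int n) * (p * t powr (p - 1) * (t - q * davg w n k))"
    unfolding dI_split[OF w(2), of n k] davg_split[OF w(1), of n k] h by (simp add: field_simps)
  finally show ?case .
qed

text \<open>The running maximum starts at the average of the top interval; there Burkholder's term
  is nonpositive because \<open>p / (p - 1)\<close> is at least 1.\<close>

lemma dyadic_doob:
  assumes p: "1 < p" and w: "dloc w" "dloc (\<lambda>x. w x powr p)" "\<And>x. 0 \<le> w x"
  shows "dI (\<lambda>x. dmax w n d x powr p) n k \<le> (p / (p - 1)) powr p * dI (\<lambda>x. w x powr p) n k"
proof -
  let ?y = "davg w n k" and ?q = "p / (p - 1)"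
  have y: "0 \<le> ?y" using w by (intro davg_nonneg) auto
  have "1 \<le> ?q" using p by (simp add: field_simps)
  then have "?y - ?q * ?y \<le> 0" using mult_right_mono[of 1 ?q ?y] y by simp
  then have neg: "2 powr (- real_of_int n) * (p * ?y powr (p - 1) * (?y - ?q * ?y)) \<le> 0"
    using p by (intro mult_nonneg_nonpos) auto
  have "dI (\<lambda>x. dmax w n d x powr p) n k = dI (\<lambda>x. max ?y (dmax w n d x) powr p) n k"
  proof (rule dI_cong)
    fix x assume "x \<in> dint n k"
    then have "?y \<le> dmax w n d x" using dE_le_dmax[of n n d w x] by (simp add: dE_eq)
    then show "dmax w n d x powr p = max ?y (dmax w n d x) powr p" by (simp add: max_def)
  qed
  then show ?thesis using dyadic_doob_aux[OF p w order_refl refl, of n k d] neg by simp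
qed

section \<open>Mean convergence of dyadic averages\<close>

lemma dloc_of_integrable: "integrable lborel f \<Longrightarrow> dloc f"
  unfolding dloc_def set_integrable_def
  by (intro conjI allI integrable_mult_indicator) (auto dest: borel_measurable_integrable)

lemma dI_le_integral:
  assumes "integrable lborel f" "\<And>x. 0 \<le> f x" shows "dI f n k \<le> integral\<^sup>L lborel f"
  unfolding dI_def set_lebesgue_integral_def using assms
  by (intro integral_mono integrable_mult_indicator) (auto simp: indicator_def)

text \<open>Averaging contracts the mean norm, so replacing \<open>f\<close> by \<open>g\<close>
  costs their distance twice; mean convergence is thereby reduced to approximating
  functions.\<close>

lemma dE_error_le:
  assumes "dloc f" "dloc g" "n \<le> L"
  shows "dI (\<lambda>x. \<bar>f x - dE f L x\<bar>) n k \<le> 2 * dI (\<lambda>x. \<bar>f x - g x\<bar>) n k + dI (\<lambda>x. \<bar>g x - dE g L x\<bar>) n k"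
proof -
  have fg: "dloc (\<lambda>x. \<bar>f x - g x\<bar>)" using assms by (intro dloc_abs dloc_diff)
  have "dI (\<lambda>x. \<bar>f x - dE f L x\<bar>) n k
     \<le> dI (\<lambda>x. (\<bar>f x - g x\<bar> + dE (\<lambda>x. \<bar>f x - g x\<bar>) L x) + \<bar>g x - dE g L x\<bar>) n k"
  proof (rule dI_mono)
    fix x
    have "\<bar>dE f L x - dE g L x\<bar> \<le> dE (\<lambda>x. \<bar>f x - g x\<bar>) L x"
      using dE_abs[OF dloc_diff[OF assms(1,2)], of L x] by (simp add: dE_diff assms)
    then show "\<bar>f x - dE f L x\<bar> \<le> \<bar>f x - g x\<bar> + dE (\<lambda>x. \<bar>f x - g x\<bar>) L x + \<bar>g x - dE g L x\<bar>" by linarith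
  qed (use assms fg in \<open>auto intro!: dloc_abs dloc_diff dloc_add\<close>)
  also have "\<dots> = 2 * dI (\<lambda>x. \<bar>f x - g x\<bar>) n k + dI (\<lambda>x. \<bar>g x - dE g L x\<bar>) n k"
    using assms fg by (simp add: dI_add dI_dE dloc_abs dloc_diff dloc_add)
  finally show ?thesis .
qed

lemma dE_didx_invariant:
  assumes "\<And>x y. didx L x = didx L y \<Longrightarrow> g x = g y"
  shows "dE g L x = g x"
proof -
  have "dE g L x = davg (\<lambda>_. g x) L (didx L x)"
    unfolding dE_def by (rule davg_cong) (auto simp: mem_dint intro: assms)
  then show ?thesis by simp
qed

lemma dint_diff_less: "x \<in> dint L j \<Longrightarrow> y \<in> dint L j \<Longrightarrow> \<bar>x - y\<bar> < 2 powr (- real_of_int L)"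
  unfolding dint_def by (auto simp: algebra_simps abs_less_iff)

text \<open>By regularity of the measure, \<open>A\<close> lies between a closed \<open>K\<close>
  and an open \<open>U\<close> of nearly equal measure. The union \<open>V\<close> of the fine
  intervals meeting the compact part of \<open>K\<close> stays inside \<open>U\<close>, and
  averaging at that level reproduces its indicator exactly.\<close>

lemma dE_L1_tendsto_indicator:
  assumes A: "A \<in> sets borel" and fin: "emeasure lborel A < \<infinity>"
  shows "(\<lambda>L. dI (\<lambda>x. \<bar>indicat_real A x - dE (indicat_real A) (n + int L) x\<bar>) n k) \<longlonglongrightarrow> 0"
proof (rule LIMSEQ_I)
  fix e :: real assume "e > 0"
  \<comment> \<open>\<open>U - A\<close> and \<open>A - K\<close> together contribute less than
    \<open>e/4\<close>, and \<open>dE_error_le\<close> doubles this.\<close>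
  then have e: "e / 8 > 0" by simp
  have AL: "A \<in> sets lebesgue" using A by auto
  obtain U where U: "open U" "A \<subseteq> U" "U - A \<in> lmeasurable" "emeasure lebesgue (U - A) < ennreal (e/8)"
    using sets_lebesgue_outer_open[OF AL e] by blast
  obtain K where K: "closed K" "K \<subseteq> A" "A - K \<in> lmeasurable" "emeasure lebesgue (A - K) < ennreal (e/8)"
    using sets_lebesgue_inner_closed[OF AL e] by blast
  have UK: "U \<in> sets borel" "K \<in> sets borel" using U(1) K(1) by auto
  have fm: "U - A \<in> fmeasurable lborel" "A - K \<in> fmeasurable lborel"
    using U(3,4) K(3,4) UK A by (auto simp: fmeasurable_def)
  have m: "measure lborel (U - A) < e/8" "measure lborel (A - K) < e/8"
    using U(4) K(4) UK A fm \<open>e > 0\<close> by (simp_all add: emeasure_eq_measure2 ennreal_less_iff)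
  define lo hi where "lo = real_of_int k * 2 powr (- real_of_int n)" and "hi = real_of_int (k + 1) * 2 powr (- real_of_int n)"
  have lohi: "dint n k \<subseteq> {lo..hi}" unfolding dint_def lo_def hi_def by auto
  define K' where "K' = K \<inter> {lo..hi}"
  have "compact K'" unfolding K'_def using K(1) by (intro closed_Int_compact) auto
  moreover have "closed (- U)" "K' \<inter> - U = {}" using U K unfolding K'_def by auto
  ultimately obtain \<delta> where \<delta>: "\<delta> > 0" "\<And>x y. x \<in> K' \<Longrightarrow> y \<in> - U \<Longrightarrow> \<delta> \<le> dist x y"
    using separate_compact_closed by metis
  have "(\<lambda>L. 2 powr (- real_of_int n) * (1/2) ^ L) \<longlonglongrightarrow> 2 powr (- real_of_int n) * (0::real)"
    by (intro tendsto_intros LIMSEQ_power_zero) auto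
  then have "\<forall>\<^sub>F L in sequentially. 2 powr (- real_of_int n) * (1/2) ^ L < \<delta>"
    using \<delta>(1) by (intro order_tendstoD) auto
  then obtain L0 where L0: "\<And>L. L \<ge> L0 \<Longrightarrow> 2 powr (- real_of_int n) * (1/2) ^ L < \<delta>"
    unfolding eventually_sequentially by blast
  have "dI (\<lambda>x. \<bar>indicat_real A x - dE (indicat_real A) (n + int L) x\<bar>) n k < e" if "L \<ge> L0" for L
  proof -
    define l where "l = n + int L"
    have "2 powr (- real L) = (1/2::real) ^ L"
      by (simp add: powr_minus powr_realpow power_one_over inverse_eq_divide)
    moreover have "2 powr (- real_of_int l) = 2 powr (- real_of_int n) * 2 powr (- real L)"
      unfolding l_def powr_add[symmetric] by simp
    ultimately have "2 powr (- real_of_int l) = 2 powr (- real_of_int n) * (1/2) ^ L" by simp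
    then have l: "2 powr (- real_of_int l) < \<delta>" using L0[OF that] by simp
    define V where "V = {x. \<exists>y\<in>K'. didx l x = didx l y}"
    have V: "V \<in> sets borel"
      by (rule didx_invariant_sets[of l]) (auto simp: V_def)
    have VU: "V \<subseteq> U"
    proof
      fix x assume "x \<in> V"
      then obtain y where y: "y \<in> K'" "didx l x = didx l y" unfolding V_def by blast
      have "\<bar>y - x\<bar> < \<delta>" using dint_diff_less[of y l "didx l y" x] y l by (simp add: mem_dint)
      then show "x \<in> U" using \<delta>(2)[OF y(1), of x] by (auto simp: dist_real_def)
    qed
    have KV: "x \<in> V" if "x \<in> K" "x \<in> dint n k" for x
      using that lohi unfolding V_def K'_def by auto
    have Viff: "x \<in> V \<longleftrightarrow> y \<in> V" if "didx l x = didx l y" for x y using that unfolding V_def by simp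
    have locA: "dloc (indicat_real A)" using A fin by (intro dloc_of_integrable) auto
    have Vind: "indicat_real V x = indicat_real V y" if "didx l x = didx l y" for x y
      using Viff[OF that] by (simp add: indicator_def)
    have locV: "dloc (indicat_real V)" by (rule dloc_invariant[OF Vind])
    have V0: "\<bar>indicat_real V x - dE (indicat_real V) l x\<bar> = 0" for x
      using dE_didx_invariant[OF Vind] by simp
    have int: "integrable lborel (\<lambda>x. indicat_real (U - A) x + indicat_real (A - K) x)"
      using fm by (intro Bochner_Integration.integrable_add) (auto simp: fmeasurable_def)
    have "dI (\<lambda>x. \<bar>indicat_real A x - indicat_real V x\<bar>) n k \<le> dI (\<lambda>x. indicat_real (U - A) x + indicat_real (A - K) x) n k"
    proof (rule dI_mono)
      show "dloc (\<lambda>x. \<bar>indicat_real A x - indicat_real V x\<bar>)" using locA locV by (intro dloc_abs dloc_diff)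
      show "dloc (\<lambda>x. indicat_real (U - A) x + indicat_real (A - K) x)" by (rule dloc_of_integrable[OF int])
      fix x assume "x \<in> dint n k"
      then show "\<bar>indicat_real A x - indicat_real V x\<bar> \<le> indicat_real (U - A) x + indicat_real (A - K) x"
        using KV[of x] VU by (auto simp: indicator_def)
    qed
    also have "\<dots> \<le> (LINT x|lborel. indicat_real (U - A) x + indicat_real (A - K) x)"
      by (rule dI_le_integral[OF int]) (auto simp: indicator_def)
    also have "\<dots> = measure lborel (U - A) + measure lborel (A - K)"
      using fm by (subst Bochner_Integration.integral_add) (auto simp: fmeasurable_def)
    also have "\<dots> < e / 4" using m by simp
    finally have "dI (\<lambda>x. \<bar>indicat_real A x - indicat_real V x\<bar>) n k < e / 4" .
    moreover have "dI (\<lambda>x. \<bar>indicat_real V x - dE (indicat_real V) l x\<bar>) n k = 0"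
      unfolding V0 using dI_const[of 0] by simp
    ultimately have "dI (\<lambda>x. \<bar>indicat_real A x - dE (indicat_real A) l x\<bar>) n k < e"
      using dE_error_le[OF locA locV, of n l k] \<open>e > 0\<close> unfolding l_def by auto
    then show ?thesis unfolding l_def .
  qed
  then show "\<exists>L0. \<forall>L\<ge>L0. norm (dI (\<lambda>x. \<bar>indicat_real A x - dE (indicat_real A) (n + int L) x\<bar>) n k - 0) < e"
    using dI_nonneg[of n k "\<lambda>x. \<bar>indicat_real A x - dE (indicat_real A) _ x\<bar>"] by (intro exI[of _ L0]) simp
qed

lemma dE_L1_tendsto_integrable:
  assumes "integrable lborel f"
  shows "(\<lambda>L. dI (\<lambda>x. \<bar>f x - dE f (n + int L) x\<bar>) n k) \<longlonglongrightarrow> 0"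
  using assms
proof (induction f)
  case (base A c)
  have "dE (\<lambda>x. indicat_real A x *\<^sub>R c) L x = c * dE (indicat_real A) L x" for L x
    unfolding dE_def davg_cmult[symmetric] by (intro davg_cong) simp
  then have "\<bar>indicat_real A x *\<^sub>R c - dE (\<lambda>x. indicat_real A x *\<^sub>R c) L x\<bar> = \<bar>c\<bar> * \<bar>indicat_real A x - dE (indicat_real A) L x\<bar>" for L x
    by (simp add: abs_mult[symmetric] algebra_simps)
  then show ?case using tendsto_mult_right_zero[OF dE_L1_tendsto_indicator[of A n k], of "\<bar>c\<bar>"] base by (simp add: dI_cmult)
next
  case (add f g)
  have loc: "dloc f" "dloc g" using add by (auto intro: dloc_of_integrable)
  have le: "dI (\<lambda>x. \<bar>f x + g x - dE (\<lambda>x. f x + g x) l x\<bar>) n k \<le> dI (\<lambda>x. \<bar>f x - dE f l x\<bar>) n k + dI (\<lambda>x. \<bar>g x - dE g l x\<bar>) n k" for l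
  proof -
    have "dI (\<lambda>x. \<bar>f x + g x - dE (\<lambda>x. f x + g x) l x\<bar>) n k \<le> dI (\<lambda>x. \<bar>f x - dE f l x\<bar> + \<bar>g x - dE g l x\<bar>) n k"
      using loc by (intro dI_mono dloc_abs dloc_diff dloc_add dloc_dE) (auto simp: dE_def davg_add)
    then show ?thesis using loc by (simp add: dI_add dloc_abs dloc_diff)
  qed
  show ?case
  proof (rule tendsto_sandwich[OF _ _ tendsto_const])
    show "(\<lambda>L. dI (\<lambda>x. \<bar>f x - dE f (n + int L) x\<bar>) n k + dI (\<lambda>x. \<bar>g x - dE g (n + int L) x\<bar>) n k) \<longlonglongrightarrow> 0"
      using tendsto_add[OF add.IH] by simp
  qed (auto intro!: always_eventually le dI_nonneg)
next
  case (lim f s)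
  have loc: "dloc f" "dloc (s i)" for i using lim by (auto intro: dloc_of_integrable)
  have int: "integrable lborel (\<lambda>x. \<bar>f x - s i x\<bar>)" for i using lim by auto
  have "(\<lambda>i. LINT x|lborel. \<bar>f x - s i x\<bar>) \<longlonglongrightarrow> (LINT x::real|lborel. 0)"
  proof (rule integral_dominated_convergence[where w = "\<lambda>x. 3 * \<bar>f x\<bar>"])
    show "integrable lborel (\<lambda>x. 3 * \<bar>f x\<bar>)" using lim by auto
    show "AE x in lborel. (\<lambda>i. \<bar>f x - s i x\<bar>) \<longlonglongrightarrow> 0"
    proof (rule AE_I2)
      fix x :: real
      have "(\<lambda>i. \<bar>f x - s i x\<bar>) \<longlonglongrightarrow> \<bar>f x - f x\<bar>" using lim.hyps(2)[of x] by (intro tendsto_intros) auto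
      then show "(\<lambda>i. \<bar>f x - s i x\<bar>) \<longlonglongrightarrow> 0" by simp
    qed
    show "AE x in lborel. norm \<bar>f x - s i x\<bar> \<le> 3 * \<bar>f x\<bar>" for i
    proof (rule AE_I2)
      fix x :: real
      have "\<bar>s i x\<bar> \<le> 2 * \<bar>f x\<bar>" using lim.hyps(3)[of x i] by simp
      then show "norm \<bar>f x - s i x\<bar> \<le> 3 * \<bar>f x\<bar>" using abs_triangle_ineq4[of "f x" "s i x"] by simp
    qed
  qed (use lim in auto)
  then have lim0: "(\<lambda>i. LINT x|lborel. \<bar>f x - s i x\<bar>) \<longlonglongrightarrow> 0" by simp
  show ?case
  proof (rule LIMSEQ_I)
    fix e :: real assume "e > 0"
    then obtain i where i: "(LINT x|lborel. \<bar>f x - s i x\<bar>) < e / 4"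
      using order_tendstoD(2)[OF lim0, of "e/4"] unfolding eventually_sequentially by auto
    have fs: "dI (\<lambda>x. \<bar>f x - s i x\<bar>) n k < e / 4"
      using dI_le_integral[OF int[of i], of n k] i by simp
    obtain L0 where L0: "\<And>L. L \<ge> L0 \<Longrightarrow> dI (\<lambda>x. \<bar>s i x - dE (s i) (n + int L) x\<bar>) n k < e / 4"
      using order_tendstoD(2)[OF lim.IH[of i], of "e/4"] \<open>e > 0\<close> unfolding eventually_sequentially by auto
    have "dI (\<lambda>x. \<bar>f x - dE f (n + int L) x\<bar>) n k < e" if "L \<ge> L0" for L
      using dE_error_le[OF loc(1) loc(2)[of i], of n "n + int L" k] L0[OF that] fs \<open>e > 0\<close> by simp
    then show "\<exists>L0. \<forall>L\<ge>L0. norm (dI (\<lambda>x. \<bar>f x - dE f (n + int L) x\<bar>) n k - 0) < e"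
      using dI_nonneg[of n k "\<lambda>x. \<bar>f x - dE f _ x\<bar>"] by (intro exI[of _ L0]) simp
  qed
qed

lemma dint_nested:
  assumes "x \<in> dint l j" "x \<in> dint n k" "n \<le> l" shows "dint l j \<subseteq> dint n k"
proof
  fix y assume "y \<in> dint l j"
  then show "y \<in> dint n k" using didx_coarse[of l y x n] assms by (simp add: mem_dint)
qed

text \<open>Averages at finer levels only see values inside the given interval, so \<open>f\<close>
  may be cut off outside it and becomes integrable on the line.\<close>

lemma dE_L1_tendsto:
  assumes "dloc f"
  shows "(\<lambda>L. dI (\<lambda>x. \<bar>f x - dE f (n + int L) x\<bar>) n k) \<longlonglongrightarrow> 0"
proof -
  let ?g = "\<lambda>x. indicat_real (dint n k) x *\<^sub>R f x"
  have "integrable lborel ?g" using dloc_integrable[OF assms] unfolding set_integrable_def .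
  from dE_L1_tendsto_integrable[OF this, of n k]
  have "(\<lambda>L. dI (\<lambda>x. \<bar>?g x - dE ?g (n + int L) x\<bar>) n k) \<longlonglongrightarrow> 0" .
  moreover have "dI (\<lambda>x. \<bar>?g x - dE ?g (n + int L) x\<bar>) n k = dI (\<lambda>x. \<bar>f x - dE f (n + int L) x\<bar>) n k" for L
  proof (rule dI_cong)
    fix x assume x: "x \<in> dint n k"
    let ?l = "n + int L"
    have "x \<in> dint ?l (didx ?l x)" by (simp add: mem_dint)
    then have "dint ?l (didx ?l x) \<subseteq> dint n k" using x by (rule dint_nested) simp
    then have "dE ?g ?l x = dE f ?l x" unfolding dE_def by (intro davg_cong) (auto simp: indicator_def)
    then show "\<bar>?g x - dE ?g ?l x\<bar> = \<bar>f x - dE f ?l x\<bar>" using x by simp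
  qed
  ultimately show ?thesis by simp
qed

section \<open>Sparse recursion and the John--Nirenberg inequality\<close>

lemma dI_indicator:
  assumes "E \<in> sets borel" "E \<subseteq> dint n k"
  shows "dI (indicat_real E) n k = measure lborel E"
proof -
  have "dI (indicat_real E) n k = (LINT x|lborel. indicat_real E x)"
    unfolding dI_def set_lebesgue_integral_def using assms(2)
    by (intro Bochner_Integration.integral_cong) (auto simp: indicator_def)
  then show ?thesis using assms by simp
qed

lemma dloc_mult_01:
  assumes "dloc f" "\<phi> \<in> borel_measurable borel" "\<And>x. 0 \<le> \<phi> x" "\<And>x. \<phi> x \<le> (1::real)"
  shows "dloc (\<lambda>x. \<phi> x * f x)"
proof (rule dloc_bound[OF assms(1)])
  show "(\<lambda>x. \<phi> x * f x) \<in> borel_measurable borel" using assms(2) dloc_measurable[OF assms(1)] by simp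
  fix x show "\<bar>\<phi> x * f x\<bar> \<le> \<bar>f x\<bar>"
    using mult_right_mono[OF assms(4)[of x], of "\<bar>f x\<bar>"] assms(3)[of x] by (simp add: abs_mult)
qed

text \<open>Sparse domination without sparse families: the part of the integral of \<open>good\<close> is charged to
  the complement of the stopping set, which fills at least half of the interval.\<close>

lemma sparse_recursion:
  fixes Hs :: "int \<Rightarrow> real \<Rightarrow> real" and W :: "real \<Rightarrow> real"
  assumes locH: "\<And>l. dloc (Hs l)" and posH: "\<And>l x. 0 \<le> Hs l x" and bottom: "\<And>x. Hs N x = 0"
    and locW: "dloc W" and posW: "\<And>x. 0 \<le> W x"
    and step: "\<And>n k. n0 \<le> n \<Longrightarrow> n < N \<Longrightarrow> \<exists>stop good. dloc good \<and> (\<forall>x. 0 \<le> good x)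
      \<and> (\<forall>x\<in>dint n k. \<forall>l\<in>{n<..N}. (\<forall>u\<in>{n<..<l}. \<not> stop u (didx u x)) \<longrightarrow> Hs n x \<le> good x + Hs l x)
      \<and> measure lborel {x \<in> dint n k. \<exists>u\<in>{n<..N}. stop u (didx u x)} \<le> 2 powr (- real_of_int n) / 2
      \<and> (\<forall>x\<in>dint n k. davg good n k \<le> W x)"
    and "n0 \<le> n" "n \<le> N"
  shows "dI (Hs n) n k \<le> 2 * dI W n k"
  using \<open>n0 \<le> n\<close> \<open>n \<le> N\<close>
proof (induction "nat (N - n)" arbitrary: n k rule: less_induct)
  case less
  show ?case
  proof (cases "n = N")
    case True
    have "dI (Hs n) n k = dI (\<lambda>_. 0) n k" using bottom True by (intro dI_cong) auto
    then show ?thesis using dI_nonneg[of n k W] posW dI_const[of 0 n k] by simp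
  next
    case False
    then have nN: "n < N" using less by simp
    obtain stop good where loc: "dloc good" and pos: "\<And>x. 0 \<le> good x"
      and dom: "\<And>x l. x \<in> dint n k \<Longrightarrow> l \<in> {n<..N} \<Longrightarrow> (\<forall>u\<in>{n<..<l}. \<not> stop u (didx u x)) \<Longrightarrow> Hs n x \<le> good x + Hs l x"
      and small: "measure lborel {x \<in> dint n k. \<exists>u\<in>{n<..N}. stop u (didx u x)} \<le> 2 powr (- real_of_int n) / 2"
      and avg: "\<And>x. x \<in> dint n k \<Longrightarrow> davg good n k \<le> W x"
      using step[OF less.prems(1) nN, of k] by blast
    define E where "E = {x \<in> dint n k. \<exists>u\<in>{n<..N}. stop u (didx u x)}"
    \<comment> \<open>Only the first stop counts: intervals of first stops are disjoint, so the
      weights \<open>\<phi> l\<close> sum to at most the indicator of \<open>E\<close>.\<close>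
    define first where "first l x \<longleftrightarrow> stop l (didx l x) \<and> (\<forall>u\<in>{n<..<l}. \<not> stop u (didx u x))" for l x
    define \<phi> where "\<phi> l x = (if first l x then 1 else 0 :: real)" for l x
    have first_cong: "first l x \<longleftrightarrow> first l y" if "didx l x = didx l y" for l x y
    proof -
      have "didx u x = didx u y" if "u \<in> {n<..<l}" for u using didx_coarse[OF \<open>didx l x = didx l y\<close>, of u] that by simp
      then show ?thesis unfolding first_def using that by auto
    qed
    have \<phi>_cong: "\<phi> l x = \<phi> l y" if "didx l x = didx l y" for l x y
      unfolding \<phi>_def using first_cong[OF that] by simp
    have \<phi>_loc: "dloc (\<phi> l)" for l by (rule dloc_invariant[OF \<phi>_cong])
    have E_sets: "E \<in> sets borel"
    proof (rule didx_invariant_sets[of N])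
      fix x y assume xy: "didx N x = didx N y" and x: "x \<in> E"
      have "didx u x = didx u y" if "u \<le> N" for u using didx_coarse[OF xy that] .
      then show "y \<in> E" using x nN unfolding E_def mem_dint by auto
    qed
    have E_ind: "indicat_real E \<in> borel_measurable borel" using E_sets by simp
    have phiH: "dloc (\<lambda>x. \<phi> l x * Hs l x)" and phiW: "dloc (\<lambda>x. \<phi> l x * W x)" for l
      by (intro dloc_mult_01 locH locW dloc_measurable[OF \<phi>_loc]; simp add: \<phi>_def)+
    have EW: "dloc (\<lambda>x. indicat_real E x * W x)"
      by (intro dloc_mult_01 locW E_ind) (auto simp: indicator_def)
    have pw: "Hs n x \<le> good x + (\<Sum>l\<in>{n<..N}. \<phi> l x * Hs l x)" if x: "x \<in> dint n k" for x
    proof (cases "\<exists>u\<in>{n<..N}. stop u (didx u x)")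
      case True
      let ?S = "{u \<in> {n<..N}. stop u (didx u x)}"
      have fin: "finite ?S" "?S \<noteq> {}"
        using True by (auto intro: finite_subset[of _ "{n<..N}"])
      define l where "l = Min ?S"
      have l: "l \<in> {n<..N}" "stop l (didx l x)" using Min_in[OF fin] unfolding l_def by auto
      have "\<not> stop u (didx u x)" if "u \<in> {n<..<l}" for u
        using Min_le[OF fin(1), of u] that l unfolding l_def by auto
      then have nost: "\<forall>u\<in>{n<..<l}. \<not> stop u (didx u x)" by blast
      have "Hs n x \<le> good x + Hs l x" by (rule dom[OF x l(1) nost])
      also have "Hs l x = \<phi> l x * Hs l x" using l nost unfolding \<phi>_def first_def by simp
      also have "\<dots> \<le> (\<Sum>l\<in>{n<..N}. \<phi> l x * Hs l x)"
        by (rule member_le_sum[OF l(1)]) (auto simp: \<phi>_def posH)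
      finally show ?thesis by simp
    next
      case False
      then have "Hs n x \<le> good x + Hs N x" using dom[OF x, of N] nN by auto
      moreover have "0 \<le> (\<Sum>l\<in>{n<..N}. \<phi> l x * Hs l x)" by (intro sum_nonneg) (auto simp: \<phi>_def posH)
      ultimately show ?thesis using bottom by simp
    qed
    have one: "(\<Sum>l\<in>{n<..N}. \<phi> l x * W x) \<le> indicat_real E x * W x" if x: "x \<in> dint n k" for x
    proof (cases "\<exists>l\<in>{n<..N}. first l x")
      case True
      then obtain l where l: "l \<in> {n<..N}" "first l x" by blast
      have "\<not> first l' x" if "l' \<in> {n<..N}" "l' \<noteq> l" for l'
        using l that unfolding first_def by (cases "l < l'") auto
      then have "(\<Sum>l\<in>{n<..N}. \<phi> l x * W x) = (\<Sum>l\<in>{l}. \<phi> l x * W x)"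
        using l by (intro sum.mono_neutral_right) (auto simp: \<phi>_def)
      moreover have "x \<in> E" using l x unfolding E_def first_def by auto
      ultimately show ?thesis using l by (simp add: \<phi>_def)
    next
      case False
      then have "(\<Sum>l\<in>{n<..N}. \<phi> l x * W x) = 0" by (intro sum.neutral) (auto simp: \<phi>_def)
      then show ?thesis using posW by (simp add: indicator_def)
    qed
    \<comment> \<open>The induction hypothesis is applied on each interval of level
      \<open>l\<close>; \<open>\<phi> l\<close> is constant there, being 1 exactly where the first
      stop occurs at that level.\<close>
    have level: "dI (\<lambda>x. \<phi> l x * Hs l x) n k \<le> dI (\<lambda>x. 2 * (\<phi> l x * W x)) n k" if l: "l \<in> {n<..N}" for l
    proof (rule dI_mono_levels[OF phiH dloc_cmult[OF phiW]])
      show "n \<le> l" using l by simp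
      fix j
      obtain y where y: "y \<in> dint l j" using dint_nonempty by blast
      have c: "\<phi> l x = \<phi> l y" if "x \<in> dint l j" for x using that y by (intro \<phi>_cong) (simp add: mem_dint)
      have "dI (\<lambda>x. \<phi> l x * Hs l x) l j = \<phi> l y * dI (Hs l) l j"
        unfolding dI_cmult[symmetric] by (rule dI_cong) (simp add: c)
      also have "\<dots> \<le> \<phi> l y * (2 * dI W l j)"
        using l less.prems by (intro mult_left_mono less.hyps) (auto simp: \<phi>_def)
      also have "\<dots> = dI (\<lambda>x. 2 * (\<phi> l y * W x)) l j" by (simp add: dI_cmult)
      also have "\<dots> = dI (\<lambda>x. 2 * (\<phi> l x * W x)) l j" by (rule dI_cong) (simp add: c)
      finally show "dI (\<lambda>x. \<phi> l x * Hs l x) l j \<le> dI (\<lambda>x. 2 * (\<phi> l x * W x)) l j" .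
    qed
    have "dI (Hs n) n k \<le> dI (\<lambda>x. good x + (\<Sum>l\<in>{n<..N}. \<phi> l x * Hs l x)) n k"
      by (intro dI_mono locH dloc_add loc dloc_sum phiH pw)
    also have "\<dots> = dI good n k + (\<Sum>l\<in>{n<..N}. dI (\<lambda>x. \<phi> l x * Hs l x) n k)"
      by (subst dI_add) (auto intro: loc dloc_sum phiH dI_sum)
    also have "\<dots> \<le> dI good n k + (\<Sum>l\<in>{n<..N}. dI (\<lambda>x. 2 * (\<phi> l x * W x)) n k)"
      by (intro add_left_mono sum_mono level)
    also have "(\<Sum>l\<in>{n<..N}. dI (\<lambda>x. 2 * (\<phi> l x * W x)) n k) = 2 * dI (\<lambda>x. \<Sum>l\<in>{n<..N}. \<phi> l x * W x) n k"
      by (simp add: dI_cmult dI_sum phiW sum_distrib_left)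
    also have "dI (\<lambda>x. \<Sum>l\<in>{n<..N}. \<phi> l x * W x) n k \<le> dI (\<lambda>x. indicat_real E x * W x) n k"
      by (intro dI_mono dloc_sum phiW EW one)
    finally have A: "dI (Hs n) n k \<le> dI good n k + 2 * dI (\<lambda>x. indicat_real E x * W x) n k" by simp
    let ?c = "davg good n k"
    have c: "0 \<le> ?c" using pos by (intro davg_nonneg)
    have "dloc (\<lambda>x. indicat_real E x * 1)"
      by (rule dloc_mult_01[OF dloc_const E_ind]) (auto simp: indicator_def)
    then have Eloc: "dloc (indicat_real E)" by simp
    have CEW: "dloc (\<lambda>x. (1 - indicat_real E x) * W x)"
      using dloc_diff[OF locW EW] by (simp add: algebra_simps)
    \<comment> \<open>\<open>W\<close> is at least the average of \<open>good\<close> throughout the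
      interval, and the complement of \<open>E\<close> has at least half its length, so
      \<open>good\<close> costs at most twice the integral of \<open>W\<close> off \<open>E\<close>.
      The stopping intervals cost twice the integral of \<open>W\<close> on \<open>E\<close>: the
      factor 2 reproduces itself.\<close>
    have "2 powr (- real_of_int n) / 2 * ?c \<le> (2 powr (- real_of_int n) - measure lborel E) * ?c"
      using small c unfolding E_def by (intro mult_right_mono) auto
    also have "\<dots> = dI (\<lambda>x. ?c * (1 - indicat_real E x)) n k"
      unfolding dI_cmult dI_diff[OF dloc_const Eloc] dI_const
      by (subst dI_indicator[OF E_sets]) (auto simp: E_def mult.commute)
    also have "\<dots> \<le> dI (\<lambda>x. (1 - indicat_real E x) * W x) n k"
    proof (intro dI_mono dloc_cmult dloc_diff dloc_const Eloc CEW)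
      fix x assume x: "x \<in> dint n k"
      have "0 \<le> 1 - indicat_real E x" by (simp add: indicator_def)
      from mult_right_mono[OF avg[OF x] this]
      show "?c * (1 - indicat_real E x) \<le> (1 - indicat_real E x) * W x" by (simp add: mult.commute)
    qed
    finally have B: "dI good n k \<le> 2 * dI (\<lambda>x. (1 - indicat_real E x) * W x) n k"
      by (simp add: dI_davg)
    have "dI W n k = dI (\<lambda>x. (1 - indicat_real E x) * W x + indicat_real E x * W x) n k"
      by (rule dI_cong) (simp add: algebra_simps)
    also have "\<dots> = dI (\<lambda>x. (1 - indicat_real E x) * W x) n k + dI (\<lambda>x. indicat_real E x * W x) n k"
      by (rule dI_add[OF CEW EW])
    finally show ?thesis using A B by simp
  qed
qed

text \<open>The potential is the integral divided by \<open>\<kappa>\<close>, which is additive over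
  halves; the increments are zero and a hit means an average above \<open>\<kappa>\<close>.\<close>

lemma dyadic_maximal_weak_type:
  assumes w: "dloc w" "\<And>x. 0 \<le> w x" and \<kappa>: "0 < \<kappa>"
  shows "measure lborel {x \<in> dint n k. \<exists>t\<in>{n..n + int d}. \<kappa> < dE w t x} \<le> dI w n k / \<kappa>"
proof -
  have 1: "0 \<le> dI w n k / \<kappa>" for n k using w \<kappa> by (auto intro!: divide_nonneg_pos dI_nonneg)
  have 2: "2 powr - real_of_int n \<le> dI w n k / \<kappa>" if "\<kappa> < davg w n k" for n k
    unfolding dI_davg using that \<kappa> by (simp add: pos_le_divide_eq)
  have 3: "dI w (n + 1) (2 * k) / \<kappa> + dI w (n + 1) (2 * k + 1) / \<kappa> \<le> dI w n k / \<kappa>" for n k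
    unfolding dI_split[OF w(1), of n k] by (simp add: add_divide_distrib)
  show ?thesis
    using tree_hit_measure[where R = "\<lambda>_ _. True" and hit = "\<lambda>n k s. \<kappa> < davg w n k" and a = "\<lambda>_ _. 0"
      and Xi = "\<lambda>n k s. dI w n k / \<kappa>" and n = n and k = k and d = d and s = 0, OF 1 2 _ 3]
    by (simp add: dE_def)
qed

lemma dyadic_maximal_sets: "{x \<in> dint n k. \<exists>t\<in>{n..n + int d}. \<kappa> < dE w t x} \<in> sets borel"
  using tree_hit_sets[of n k d "\<lambda>n k s. \<kappa> < davg w n k" 0 "\<lambda>_ _. 0"] by (simp add: dE_def)

text \<open>Each generation of stopping intervals adds at most \<open>4 * C\<close> to the
  oscillation of \<open>b\<close>, while it fills at most half of its parents. The sparse recursion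
  sums the generations, charging each of them to the maximal function of \<open>f\<close>.\<close>

lemma bmo_pairing_truncated:
  assumes b: "dloc b" and C: "0 < C" "\<And>n k. davg (\<lambda>x. \<bar>b x - davg b n k\<bar>) n k \<le> C"
    and f: "dloc f" "\<And>x. 0 \<le> f x"
  shows "dI (\<lambda>x. \<bar>dE b (n + int d + 1) x - davg b n k\<bar> * f x) n k \<le> 8 * C * dI (dmax f n d) n k"
proof -
  \<comment> \<open>The recursion takes steps at the levels below \<open>N\<close>, and these are
    exactly the levels \<open>n\<close> to \<open>n + d\<close> seen by \<open>dmax\<close>.\<close>
  define N where "N = n + int d + 1"
  define Hs where "Hs l x = \<bar>dE b N x - dE b l x\<bar> * f x" for l x
  define W where "W x = 4 * C * dmax f n d x" for x
  have bc: "dloc (\<lambda>x. \<bar>b x - c\<bar>)" for c using b by (intro dloc_abs dloc_diff dloc_const)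
  have "dI (Hs n) n k \<le> 2 * dI W n k"
  proof (rule sparse_recursion[where N = N and ?n0.0 = n])
    fix l
    have *: "Hs l = (\<lambda>x. \<bar>dE b N x * f x - dE b l x * f x\<bar>)"
    proof
      fix x show "Hs l x = \<bar>dE b N x * f x - dE b l x * f x\<bar>"
        unfolding Hs_def left_diff_distrib[symmetric] abs_mult using f(2)[of x] by simp
    qed
    show "dloc (Hs l)"
      unfolding * unfolding dE_def by (intro dloc_abs dloc_diff dloc_mult_didx f)
    show "0 \<le> Hs l x" for x unfolding Hs_def using f by simp
    show "Hs N x = 0" for x unfolding Hs_def by simp
    show "dloc W" unfolding W_def by (intro dloc_cmult dloc_invariant[of "n + int d"] dmax_cong)
    show "0 \<le> W x" for x unfolding W_def using C f dmax_nonneg[of f n d x] by simp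
  next
    fix n' k' assume n': "n \<le> n'" "n' < N"
    define c where "c = davg b n' k'"
    \<comment> \<open>Twice the mean oscillation as threshold makes the stopping set at most half of
      the interval by the weak-type bound.\<close>
    define stop where "stop u j \<longleftrightarrow> 2 * C < davg (\<lambda>x. \<bar>b x - c\<bar>) u j" for u j
    have osc: "davg (\<lambda>x. \<bar>b x - c\<bar>) n' k' \<le> C" unfolding c_def by (rule C)
    have "Hs n' x \<le> 4 * C * f x + Hs l x"
      if x: "x \<in> dint n' k'" and l: "l \<in> {n'<..N}" and ns: "\<forall>u\<in>{n'<..<l}. \<not> stop u (didx u x)" for x l
    proof -
      \<comment> \<open>At level \<open>l\<close> itself a stop is allowed. The bound is known one
        level earlier, and doubling carries it to \<open>l\<close> with
        \<open>4 * C\<close>.\<close>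
      have "dE (\<lambda>x. \<bar>b x - c\<bar>) (l - 1) x \<le> 2 * C"
      proof (cases "l - 1 = n'")
        case True then show ?thesis using osc C dE_eq[OF x] by simp
      next
        case False
        then have "l - 1 \<in> {n'<..<l}" using l by auto
        from bspec[OF ns this] show ?thesis unfolding stop_def dE_def by simp
      qed
      moreover have "dE (\<lambda>x. \<bar>b x - c\<bar>) l x \<le> 2 * dE (\<lambda>x. \<bar>b x - c\<bar>) (l - 1) x"
        using dE_child_le[OF bc, of c "l - 1" x] by simp
      moreover have "\<bar>dE b l x - c\<bar> \<le> dE (\<lambda>x. \<bar>b x - c\<bar>) l x"
        using dE_abs[OF dloc_diff[OF b dloc_const[of c]], of l x] by (simp add: dE_def davg_diff[OF b dloc_const])
      moreover have "dE b n' x = c" unfolding c_def using dE_eq[OF x] .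
      ultimately have "\<bar>dE b N x - dE b n' x\<bar> \<le> 4 * C + \<bar>dE b N x - dE b l x\<bar>" by linarith
      from mult_right_mono[OF this f(2)[of x]] show ?thesis unfolding Hs_def by (simp add: algebra_simps)
    qed
    moreover have "measure lborel {x \<in> dint n' k'. \<exists>u\<in>{n'<..N}. stop u (didx u x)} \<le> 2 powr (- real_of_int n') / 2"
    proof -
      let ?A = "{x \<in> dint n' k'. \<exists>t\<in>{n'..n' + int (nat (N - n'))}. 2 * C < dE (\<lambda>x. \<bar>b x - c\<bar>) t x}"
      have S: "{x \<in> dint n' k'. \<exists>u\<in>{n'<..N}. stop u (didx u x)} \<in> sets borel"
      proof (rule didx_invariant_sets[of N])
        fix x y assume xy: "didx N x = didx N y" and x: "x \<in> {x \<in> dint n' k'. \<exists>u\<in>{n'<..N}. stop u (didx u x)}"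
        have "didx u x = didx u y" if "u \<le> N" for u using didx_coarse[OF xy that] .
        then show "y \<in> {x \<in> dint n' k'. \<exists>u\<in>{n'<..N}. stop u (didx u x)}" using x n' unfolding mem_dint by auto
      qed
      have sub: "{x \<in> dint n' k'. \<exists>u\<in>{n'<..N}. stop u (didx u x)} \<subseteq> ?A"
      proof
        fix x assume "x \<in> {x \<in> dint n' k'. \<exists>u\<in>{n'<..N}. stop u (didx u x)}"
        then obtain u where "x \<in> dint n' k'" "u \<in> {n'<..N}" "stop u (didx u x)" by blast
        then show "x \<in> ?A" using n' unfolding stop_def dE_def by (auto intro!: bexI[of _ u])
      qed
      have fA: "?A \<in> fmeasurable lborel"
        by (rule dint_sub_fmeasurable[where n = n' and k = k'], rule dyadic_maximal_sets, blast)
      have "measure lborel {x \<in> dint n' k'. \<exists>u\<in>{n'<..N}. stop u (didx u x)} \<le> measure lborel ?A"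
        by (rule measure_mono_fmeasurable[OF sub _ fA]) (use S in simp)
      also have "\<dots> \<le> dI (\<lambda>x. \<bar>b x - c\<bar>) n' k' / (2 * C)"
        using C by (intro dyadic_maximal_weak_type bc) auto
      also have "\<dots> \<le> 2 powr (- real_of_int n') / 2"
        unfolding dI_davg using osc C by (simp add: field_simps)
      finally show ?thesis .
    qed
    moreover have "davg (\<lambda>x. 4 * C * f x) n' k' \<le> W x" if "x \<in> dint n' k'" for x
      unfolding W_def davg_cmult using dE_le_dmax[of n' n d f x] n' dE_eq[OF that, of f] C
      by (intro mult_left_mono) (auto simp: N_def)
    ultimately show "\<exists>stop good. dloc good \<and> (\<forall>x. 0 \<le> good x)
      \<and> (\<forall>x\<in>dint n' k'. \<forall>l\<in>{n'<..N}. (\<forall>u\<in>{n'<..<l}. \<not> stop u (didx u x)) \<longrightarrow> Hs n' x \<le> good x + Hs l x)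
      \<and> measure lborel {x \<in> dint n' k'. \<exists>u\<in>{n'<..N}. stop u (didx u x)} \<le> 2 powr (- real_of_int n') / 2
      \<and> (\<forall>x\<in>dint n' k'. davg good n' k' \<le> W x)"
      using f C by (intro exI[of _ stop] exI[of _ "\<lambda>x. 4 * C * f x"]) (auto intro: dloc_cmult)
  qed (auto simp: N_def)
  also have "dI W n k = 4 * C * dI (dmax f n d) n k" unfolding W_def dI_cmult ..
  also have "dI (Hs n) n k = dI (\<lambda>x. \<bar>dE b (n + int d + 1) x - davg b n k\<bar> * f x) n k"
    unfolding Hs_def N_def by (rule dI_cong) (simp add: dE_eq)
  finally show ?thesis by simp
qed

lemma dloc_dmax: "dloc (dmax w n d)"
  by (rule dloc_invariant[OF dmax_cong])

lemma dloc_dmax_powr: "dloc (\<lambda>x. dmax w n d x powr p)"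
proof (rule dloc_invariant[of "n + int d"])
  fix x y assume "didx (n + int d) x = didx (n + int d) y"
  then show "dmax w n d x powr p = dmax w n d y powr p" using dmax_cong[of n d x y w] by simp
qed

text \<open>Jensen's and Doob's inequalities lead from the maximal function back to a power mean of
  \<open>f\<close> on the top interval; any exponent above 1 works, at the price
  \<open>s / (s - 1)\<close>.\<close>

lemma dI_dmax_le:
  assumes s: "1 < s" and f: "dloc f" "dloc (\<lambda>x. f x powr s)" "\<And>x. 0 \<le> f x"
  shows "dI (dmax f n d) n k \<le> 2 powr (- real_of_int n) * (s / (s - 1)) * davg (\<lambda>x. f x powr s) n k powr (1 / s)"
proof -
  let ?q = "s / (s - 1)"
  have M: "\<And>x. 0 \<le> dmax f n d x" using f by (intro dmax_nonneg)
  have A: "0 \<le> davg (dmax f n d) n k" using M by (intro davg_nonneg)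
  have F: "0 \<le> davg (\<lambda>x. f x powr s) n k" by (intro davg_nonneg) simp
  have "davg (dmax f n d) n k powr s \<le> davg (\<lambda>x. dmax f n d x powr s) n k"
    by (rule davg_powr_le[OF s dloc_dmax dloc_dmax_powr M])
  also have "\<dots> \<le> ?q powr s * davg (\<lambda>x. f x powr s) n k"
    unfolding davg_dI using mult_left_mono[OF dyadic_doob[OF s f, of n d k], of "2 powr real_of_int n"] by (simp add: algebra_simps)
  finally have "(davg (dmax f n d) n k powr s) powr (1 / s) \<le> (?q powr s * davg (\<lambda>x. f x powr s) n k) powr (1 / s)"
    using s by (intro powr_mono2) auto
  then have "davg (dmax f n d) n k \<le> ?q * davg (\<lambda>x. f x powr s) n k powr (1 / s)"
    using s A F by (simp add: powr_powr powr_mult)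
  from mult_left_mono[OF this, of "2 powr (- real_of_int n)"] show ?thesis
    unfolding dI_davg[of "dmax f n d"] by (simp add: algebra_simps)
qed

text \<open>The truncations increase and at each point are eventually equal to \<open>f\<close>, so
  monotone convergence yields integrability together with the bound.\<close>

lemma dI_monotone_limit:
  assumes meas: "h \<in> borel_measurable borel" "f \<in> borel_measurable borel" and pos: "\<And>x. 0 \<le> h x" "\<And>x. 0 \<le> f x"
    and loc: "\<And>L::nat. dloc (\<lambda>x. h x * min (f x) (real L))"
    and le: "\<And>L::nat. dI (\<lambda>x. h x * min (f x) (real L)) n k \<le> K"
  shows "set_integrable lborel (dint n k) (\<lambda>x. h x * f x)" "dI (\<lambda>x. h x * f x) n k \<le> K"
proof -
  let ?g = "\<lambda>L x. indicat_real (dint n k) x *\<^sub>R (h x * min (f x) (real L))"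
  let ?u = "\<lambda>x. indicat_real (dint n k) x *\<^sub>R (h x * f x)"
  have mono: "?g L x \<le> ?g L' x" if "L \<le> L'" for L L' x
    using that pos by (auto intro!: mult_left_mono simp: indicator_def)
  have int: "integrable lborel (?g L)" for L
    using dloc_integrable[OF loc] unfolding set_integrable_def .
  have inc: "incseq (\<lambda>L. integral\<^sup>L lborel (?g L))"
    by (intro incseq_SucI integral_mono int mono) simp
  have bd: "\<forall>L. integral\<^sup>L lborel (?g L) \<le> K"
    using le unfolding dI_def set_lebesgue_integral_def by simp
  obtain I where I: "(\<lambda>L. integral\<^sup>L lborel (?g L)) \<longlonglongrightarrow> I"
    using incseq_convergent[OF inc bd] by blast
  have lim: "AE x in lborel. (\<lambda>L. ?g L x) \<longlonglongrightarrow> ?u x"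
  proof (rule AE_I2)
    fix x
    have "\<forall>\<^sub>F L in sequentially. ?g L x = ?u x"
      unfolding eventually_sequentially
    proof (intro exI allI impI)
      fix L assume "nat \<lceil>f x\<rceil> \<le> L"
      then have "f x \<le> real L" by linarith
      then show "?g L x = ?u x" by (simp add: min_def)
    qed
    then show "(\<lambda>L. ?g L x) \<longlonglongrightarrow> ?u x" by (rule tendsto_eventually)
  qed
  have m: "AE x in lborel. mono (\<lambda>L. ?g L x)" by (intro AE_I2 monoI mono)
  have u: "?u \<in> borel_measurable lborel" using meas by measurable
  show "set_integrable lborel (dint n k) (\<lambda>x. h x * f x)"
    unfolding set_integrable_def by (rule integrable_monotone_convergence[OF int m lim I u])
  have "dI (\<lambda>x. h x * f x) n k = I"
    unfolding dI_def set_lebesgue_integral_def by (rule integral_monotone_convergence[OF int m lim I u])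
  then show "dI (\<lambda>x. h x * f x) n k \<le> K" using LIMSEQ_le_const2[OF I] bd by blast
qed

lemma dloc_mult_bounded:
  assumes "dloc h" "g \<in> borel_measurable borel" "\<And>x. \<bar>g x\<bar> \<le> (L::real)"
  shows "dloc (\<lambda>x. h x * g x)"
proof (rule dloc_bound[OF dloc_cmult[OF assms(1), of L]])
  show "(\<lambda>x. h x * g x) \<in> borel_measurable borel" using assms(2) dloc_measurable[OF assms(1)] by simp
  fix x
  have "0 \<le> L" using assms(3)[of x] by linarith
  then show "\<bar>h x * g x\<bar> \<le> \<bar>L * h x\<bar>"
    using mult_left_mono[OF assms(3)[of x], of "\<bar>h x\<bar>"] by (simp add: abs_mult mult.commute)
qed

text \<open>This is the John--Nirenberg inequality in dual form.\<close>

lemma bmo_pairing: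
  assumes b: "dloc b" and C: "0 < C" "\<And>n k. davg (\<lambda>x. \<bar>b x - davg b n k\<bar>) n k \<le> C"
    and s: "1 < s" and f: "dloc f" "dloc (\<lambda>x. f x powr s)" "\<And>x. 0 \<le> f x"
  shows "set_integrable lborel (dint n k) (\<lambda>x. \<bar>b x - davg b n k\<bar> * f x)" (is ?A)
    and "dI (\<lambda>x. \<bar>b x - davg b n k\<bar> * f x) n k
      \<le> 8 * C * (s / (s - 1)) * (2 powr (- real_of_int n) * davg (\<lambda>x. f x powr s) n k powr (1 / s))" (is ?B)
proof -
  define c where "c = davg b n k"
  define K where "K = 8 * C * (s / (s - 1)) * (2 powr (- real_of_int n) * davg (\<lambda>x. f x powr s) n k powr (1 / s))"
  have bc: "dloc (\<lambda>x. \<bar>b x - c\<bar>)" using b by (intro dloc_abs dloc_diff dloc_const)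
  have fL: "(\<lambda>x. min (f x) (real L)) \<in> borel_measurable borel" for L
    using dloc_measurable[OF f(1)] by simp
  have fL1: "\<bar>min (f x) (real L)\<bar> \<le> real L" for L x using f(3)[of x] by simp
  have loc: "dloc (\<lambda>x. h x * min (f x) (real L))" if "dloc h" for h and L
    by (rule dloc_mult_bounded[OF that fL fL1])
  have le: "dI (\<lambda>x. \<bar>b x - c\<bar> * min (f x) (real L)) n k \<le> K" for L
  proof -
    \<comment> \<open>With \<open>f\<close> cut at height \<open>L\<close>, replacing
      \<open>b\<close> by its averages at a fine level costs at most \<open>L\<close> times their
      mean distance, which tends to 0. Only then is \<open>L\<close> sent to infinity.\<close>
    let ?e = "\<lambda>d. dI (\<lambda>x. \<bar>b x - dE b (n + int d) x\<bar>) n k"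
    have "dI (\<lambda>x. \<bar>b x - c\<bar> * min (f x) (real L)) n k \<le> K + real L * ?e (Suc d)" for d
    proof -
      let ?N = "n + int d + 1"
      have 1: "dloc (\<lambda>x. real L * \<bar>b x - dE b ?N x\<bar>)" using b by (intro dloc_cmult dloc_abs dloc_diff dloc_dE)
      have 2: "dloc (\<lambda>x. \<bar>dE b ?N x - c\<bar> * f x)"
        using dloc_mult_didx[OF f(1), of "\<lambda>j. \<bar>davg b ?N j - c\<bar>" ?N] by (simp add: dE_def)
      have "dI (\<lambda>x. \<bar>b x - c\<bar> * min (f x) (real L)) n k \<le> dI (\<lambda>x. \<bar>dE b ?N x - c\<bar> * f x + real L * \<bar>b x - dE b ?N x\<bar>) n k"
      proof (rule dI_mono[OF loc[OF bc] dloc_add[OF 2 1]])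
        fix x
        have "\<bar>b x - c\<bar> * min (f x) (real L) \<le> (\<bar>dE b ?N x - c\<bar> + \<bar>b x - dE b ?N x\<bar>) * min (f x) (real L)"
          using f(3)[of x] by (intro mult_right_mono) auto
        also have "\<dots> \<le> \<bar>dE b ?N x - c\<bar> * f x + \<bar>b x - dE b ?N x\<bar> * real L"
          unfolding distrib_right by (intro add_mono mult_left_mono) auto
        finally show "\<bar>b x - c\<bar> * min (f x) (real L) \<le> \<bar>dE b ?N x - c\<bar> * f x + real L * \<bar>b x - dE b ?N x\<bar>"
          by (simp add: mult.commute)
      qed
      also have "\<dots> = dI (\<lambda>x. \<bar>dE b ?N x - c\<bar> * f x) n k + real L * dI (\<lambda>x. \<bar>b x - dE b ?N x\<bar>) n k"
        using dI_add[OF 2 1] by (simp add: dI_cmult)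
      also have "dI (\<lambda>x. \<bar>dE b ?N x - c\<bar> * f x) n k \<le> 8 * C * dI (dmax f n d) n k"
        unfolding c_def by (rule bmo_pairing_truncated[OF b C f(1,3)])
      also have "\<dots> \<le> K"
        unfolding K_def using mult_left_mono[OF dI_dmax_le[OF s f, of n d k], of "8 * C"] C by (simp add: mult_ac)
      finally show ?thesis by (simp add: algebra_simps)
    qed
    moreover have "(\<lambda>d. K + real L * ?e (Suc d)) \<longlonglongrightarrow> K + real L * 0"
      using dE_L1_tendsto[OF b, of n k] by (intro tendsto_intros) (rule LIMSEQ_Suc)
    ultimately show ?thesis using LIMSEQ_le_const[of "\<lambda>d. K + real L * ?e (Suc d)" K] by auto
  qed
  have m: "(\<lambda>x. \<bar>b x - c\<bar>) \<in> borel_measurable borel" by (rule dloc_measurable[OF bc])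
  note lim = dI_monotone_limit[of "\<lambda>x. \<bar>b x - c\<bar>" f, OF m dloc_measurable[OF f(1)] _ f(3) loc[OF bc] le]
  show ?A using lim(1) unfolding c_def by simp
  show ?B using lim(2) unfolding c_def K_def by simp
qed

section \<open>Almost everywhere convergence\<close>

lemma dE_dE_coarse: "dloc f \<Longrightarrow> v \<le> L \<Longrightarrow> dE (dE f L) v x = dE f v x"
  by (simp add: dE_def[of _ v] davg_dE)

lemma dE_dE_fine: "L \<le> v \<Longrightarrow> dE (dE f L) v x = dE f L x"
  by (simp add: dE_def[of _ v] davg_dE_fine mem_dint)

text \<open>Successive averaging is averaging at the coarser level. Subtracting the averages of
  level \<open>L\<close> therefore removes the differences at coarser scales and leaves the finer
  ones unchanged.\<close>

lemma dfac_tail: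
  assumes "dloc f"
  shows "dfac 0 (\<lambda>x. f x - dE f L x) u x = (if u < L then 0 else dfac 0 f u x)"
proof -
  have d: "dE (\<lambda>x. f x - dE f L x) v x = dE f v x - dE (dE f L) v x" for v
    using assms by (intro dE_diff) auto
  show ?thesis
  proof (cases "u < L")
    case True
    then show ?thesis unfolding dfac_def d using assms dE_dE_coarse[of f u L x] dE_dE_coarse[of f "u+1" L x] by simp
  next
    case False
    then show ?thesis unfolding dfac_def d using dE_dE_fine[of L u f x] dE_dE_fine[of L "u+1" f x] by simp
  qed
qed

text \<open>A tail of the series is again a full series, with one function replaced by its distance
  to its own averages. The weak-type bound thus applies to tails, with one slot small in the
  mean.\<close>

lemma dtm_tail:
  assumes "dloc (fs j0)" "j0 \<in> {1..m}" "\<alpha> j0 = 0"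
  shows "dtm \<epsilon> m \<alpha> (fs(j0 := \<lambda>x. fs j0 x - dE (fs j0) L x)) u x = (if u < L then 0 else dtm \<epsilon> m \<alpha> fs u x)"
proof -
  let ?g = "fs(j0 := \<lambda>x. fs j0 x - dE (fs j0) L x)"
  have "(\<Prod>j=1..m. dfac (\<alpha> j) (?g j) u x) = dfac 0 (\<lambda>x. fs j0 x - dE (fs j0) L x) u x * (\<Prod>j\<in>{1..m}-{j0}. dfac (\<alpha> j) (fs j) u x)"
    using prod.remove[of "{1..m}" j0 "\<lambda>j. dfac (\<alpha> j) (?g j) u x"] assms by simp
  moreover have "(\<Prod>j=1..m. dfac (\<alpha> j) (fs j) u x) = dfac 0 (fs j0) u x * (\<Prod>j\<in>{1..m}-{j0}. dfac (\<alpha> j) (fs j) u x)"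
    using prod.remove[of "{1..m}" j0 "\<lambda>j. dfac (\<alpha> j) (fs j) u x"] assms by simp
  ultimately show ?thesis unfolding dtm_def dfac_tail[OF assms(1)] by simp
qed

lemma dtm_oscillation_measure:
  assumes loc: "\<forall>j\<in>{1..m}. dloc (fs j)" and eps: "\<And>n k. \<bar>\<epsilon> n k\<bar> \<le> M" "M > 0" and U: "U_set m \<alpha>"
    and pos: "0 < lam" "0 < \<eta>"
  shows "\<exists>L::nat. \<forall>d. measure lborel {x \<in> dint n k. \<exists>t\<in>{n..n + int d}. lam < \<bar>\<Sum>u\<in>{n..<t} \<inter> {n + int L..}. dtm \<epsilon> m \<alpha> fs u x\<bar>} \<le> \<eta>"
proof -
  obtain j0 where j0: "j0 \<in> {1..m}" "\<alpha> j0 = 0" using U unfolding U_set_def by blast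
  have l0: "dloc (fs j0)" using loc j0 by auto
  let ?J = "{1..m} - {j0}"
  define F where "F = (\<Sum>j\<in>?J. dI (\<lambda>x. \<bar>fs j x\<bar>) n k)"
  have F: "0 \<le> F" unfolding F_def by (intro sum_nonneg dI_nonneg) auto
  \<comment> \<open>\<open>K\<close> makes the unchanged slots contribute at most
    \<open>\<eta> / 6\<close>; then \<open>k0\<close> is forced, since \<open>M\<close> times the
    product of the thresholds must be \<open>lam\<close>; only afterwards does \<open>L\<close> make
    the tail in slot \<open>j0\<close> small. The factor 3 of the weak-type bound gives
    \<open>\<eta>\<close> in total.\<close>
  define K where "K = 1 + 6 * F / \<eta>"
  have K: "1 \<le> K" unfolding K_def using F pos by simp
  have FK: "F / K \<le> \<eta> / 6" using F pos K unfolding K_def by (simp add: field_simps)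
  define k0 where "k0 = lam / (M * K ^ card ?J)"
  have k0: "0 < k0" unfolding k0_def using pos eps K by simp
  define \<kappa> where "\<kappa> j = (if j = j0 then k0 else K)" for j
  have \<kappa>: "\<forall>j\<in>{1..m}. \<kappa> j > 0" unfolding \<kappa>_def using k0 K by auto
  have "(\<Prod>j=1..m. \<kappa> j) = k0 * K ^ card ?J"
    using prod.remove[of "{1..m}" j0 \<kappa>] j0 by (simp add: \<kappa>_def)
  then have lam: "M * (\<Prod>j=1..m. \<kappa> j) = lam" unfolding k0_def using eps K by simp
  have "\<forall>\<^sub>F L in sequentially. dI (\<lambda>x. \<bar>fs j0 x - dE (fs j0) (n + int L) x\<bar>) n k < \<eta> * k0 / 6"
    using dE_L1_tendsto[OF l0, of n k] pos k0 by (intro order_tendstoD) auto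
  then obtain L where L: "dI (\<lambda>x. \<bar>fs j0 x - dE (fs j0) (n + int L) x\<bar>) n k < \<eta> * k0 / 6"
    unfolding eventually_sequentially by blast
  let ?g = "fs(j0 := \<lambda>x. fs j0 x - dE (fs j0) (n + int L) x)"
  have locg: "\<forall>j\<in>{1..m}. dloc (?g j)" using loc l0 by (auto intro: dloc_diff)
  have "measure lborel {x \<in> dint n k. \<exists>t\<in>{n..n + int d}. lam < \<bar>\<Sum>u\<in>{n..<t} \<inter> {n + int L..}. dtm \<epsilon> m \<alpha> fs u x\<bar>} \<le> \<eta>" for d
  proof -
    let ?A = "{x \<in> dint n k. \<exists>t\<in>{n..n + int d}. M * (\<Prod>j=1..m. \<kappa> j) < \<bar>\<Sum>u\<in>{n..<t}. dtm \<epsilon> m \<alpha> ?g u x\<bar>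
            \<or> (\<exists>j\<in>{1..m}. \<kappa> j < dE (\<lambda>x. \<bar>?g j x\<bar>) t x)}"
    have eq: "(\<Sum>u\<in>{n..<t} \<inter> {n + int L..}. dtm \<epsilon> m \<alpha> fs u x) = (\<Sum>u\<in>{n..<t}. dtm \<epsilon> m \<alpha> ?g u x)" for t x
    proof -
      have "(\<Sum>u\<in>{n..<t}. dtm \<epsilon> m \<alpha> ?g u x) = (\<Sum>u\<in>{n..<t}. if u \<in> {n + int L..} then dtm \<epsilon> m \<alpha> fs u x else 0)"
        by (intro sum.cong refl) (simp add: dtm_tail[of fs j0 m \<alpha>, OF l0 j0])
      then show ?thesis by (simp add: sum.inter_restrict)
    qed
    have "{x \<in> dint n k. \<exists>t\<in>{n..n + int d}. lam < \<bar>\<Sum>u\<in>{n..<t} \<inter> {n + int L..}. dtm \<epsilon> m \<alpha> fs u x\<bar>} \<subseteq> ?A"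
      unfolding eq lam by blast
    then have "measure lborel {x \<in> dint n k. \<exists>t\<in>{n..n + int d}. lam < \<bar>\<Sum>u\<in>{n..<t} \<inter> {n + int L..}. dtm \<epsilon> m \<alpha> fs u x\<bar>} \<le> measure lborel ?A"
    proof (rule measure_mono_fmeasurable)
      show "{x \<in> dint n k. \<exists>t\<in>{n..n + int d}. lam < \<bar>\<Sum>u\<in>{n..<t} \<inter> {n + int L..}. dtm \<epsilon> m \<alpha> fs u x\<bar>} \<in> sets lborel"
        by measurable
      show "?A \<in> fmeasurable lborel"
        by (rule dint_sub_fmeasurable[where n = n and k = k], measurable)
    qed
    also have "\<dots> \<le> 3 * (\<Sum>j=1..m. dI (\<lambda>x. \<bar>?g j x\<bar>) n k / \<kappa> j)"
      by (rule weak_type[OF locg \<kappa> eps U])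
    also have "(\<Sum>j=1..m. dI (\<lambda>x. \<bar>?g j x\<bar>) n k / \<kappa> j) = dI (\<lambda>x. \<bar>fs j0 x - dE (fs j0) (n + int L) x\<bar>) n k / k0 + (\<Sum>j\<in>?J. dI (\<lambda>x. \<bar>fs j x\<bar>) n k / K)"
      using sum.remove[of "{1..m}" j0 "\<lambda>j. dI (\<lambda>x. \<bar>?g j x\<bar>) n k / \<kappa> j"] j0 by (simp add: \<kappa>_def)
    also have "(\<Sum>j\<in>?J. dI (\<lambda>x. \<bar>fs j x\<bar>) n k / K) = F / K" unfolding F_def by (simp add: sum_divide_distrib)
    also have "3 * (dI (\<lambda>x. \<bar>fs j0 x - dE (fs j0) (n + int L) x\<bar>) n k / k0 + F / K) \<le> 3 * (\<eta> / 6 + \<eta> / 6)"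
    proof (intro mult_left_mono add_mono FK)
      show "dI (\<lambda>x. \<bar>fs j0 x - dE (fs j0) (n + int L) x\<bar>) n k / k0 \<le> \<eta> / 6"
        using L k0 by (simp add: pos_divide_le_eq)
    qed simp
    finally show ?thesis by simp
  qed
  then show ?thesis by blast
qed

text \<open>On each unit interval and for each threshold, the oscillation past a suitable
  \<open>L\<close> is small in measure. A point where the partial sums are not Cauchy lies, for some
  threshold, in the exceptional sets of all \<open>L\<close> at once, and this intersection is
  null.\<close>

lemma dtm_small_scales_convergent:
  assumes loc: "\<forall>j\<in>{1..m}. dloc (fs j)" and eps: "\<And>n k. \<bar>\<epsilon> n k\<bar> \<le> M" "M > 0" and U: "U_set m \<alpha>"
  shows "AE x in lborel. convergent (\<lambda>N. \<Sum>u\<in>{0..int N}. dtm \<epsilon> m \<alpha> fs u x)"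
proof -
  define S where "S N x = (\<Sum>u\<in>{0..<int N}. dtm \<epsilon> m \<alpha> fs u x)" for N x
  have S_meas [measurable]: "S N \<in> borel_measurable borel" for N unfolding S_def by measurable
  have diff: "S t x - S L x = (\<Sum>u\<in>{0..<int t} \<inter> {int L..}. dtm \<epsilon> m \<alpha> fs u x)" if "L \<le> t" for t L x
  proof -
    have "{0..<int t} = {0..<int L} \<union> ({0..<int t} \<inter> {int L..})" using that by auto
    then have "S t x = S L x + (\<Sum>u\<in>{0..<int t} \<inter> {int L..}. dtm \<epsilon> m \<alpha> fs u x)"
      unfolding S_def by (subst \<open>{0..<int t} = _\<close>, subst sum.union_disjoint) auto
    then show ?thesis by simp
  qed
  define B where "B k lam L = {x \<in> dint 0 k. \<exists>t. L \<le> t \<and> lam < \<bar>S t x - S L x\<bar>}" for k and lam :: real and L :: nat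
  have B_meas: "B k lam L \<in> sets lborel" for k lam L unfolding B_def by measurable
  have B_small: "\<exists>L. emeasure lborel (B k lam L) \<le> ennreal \<eta>" if le: "0 < lam" "0 < \<eta>" for k lam \<eta>
  proof -
    obtain L :: nat where L: "\<And>d. measure lborel {x \<in> dint 0 k. \<exists>t\<in>{0..0 + int d}. lam < \<bar>\<Sum>u\<in>{0..<t} \<inter> {0 + int L..}. dtm \<epsilon> m \<alpha> fs u x\<bar>} \<le> \<eta>"
      using dtm_oscillation_measure[where \<epsilon> = \<epsilon>, OF loc eps U le, of 0 k] by blast
    define A where "A d = {x \<in> dint 0 k. \<exists>t\<le>d. L \<le> t \<and> lam < \<bar>S t x - S L x\<bar>}" for d :: nat
    have A_meas: "A d \<in> sets lborel" for d unfolding A_def by measurable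
    have "measure lborel (A d) \<le> \<eta>" for d
    proof -
      let ?C = "{x \<in> dint 0 k. \<exists>t\<in>{0..0 + int d}. lam < \<bar>\<Sum>u\<in>{0..<t} \<inter> {0 + int L..}. dtm \<epsilon> m \<alpha> fs u x\<bar>}"
      have "A d \<subseteq> ?C"
      proof
        fix x assume "x \<in> A d"
        then obtain t where "x \<in> dint 0 k" "t \<le> d" "L \<le> t" "lam < \<bar>S t x - S L x\<bar>" unfolding A_def by blast
        then show "x \<in> ?C" using diff[of L t x] by (auto intro!: bexI[of _ "int t"])
      qed
      then have "measure lborel (A d) \<le> measure lborel ?C"
        by (rule measure_mono_fmeasurable[OF _ A_meas]) (rule dint_sub_fmeasurable[where n = 0 and k = k], measurable)
      then show ?thesis using L[of d] by linarith
    qed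
    moreover have "A d \<in> fmeasurable lborel" for d
      by (rule dint_sub_fmeasurable[where n = 0 and k = k]) (use A_meas in \<open>auto simp: A_def\<close>)
    ultimately have Ad: "emeasure lborel (A d) \<le> ennreal \<eta>" for d
      by (simp add: emeasure_eq_measure2 ennreal_leI)
    \<comment> \<open>The bound on \<open>A d\<close> is independent of the depth \<open>d\<close>,
      so it passes to the increasing union over all depths.\<close>
    have "incseq A" unfolding A_def by (rule incseq_SucI) (auto intro: le_SucI)
    moreover have "B k lam L = (\<Union>d. A d)" unfolding B_def A_def by auto
    ultimately have "emeasure lborel (B k lam L) = (SUP d. emeasure lborel (A d))"
      using SUP_emeasure_incseq[of A lborel] A_meas by (metis image_subsetI)
    also have "\<dots> \<le> ennreal \<eta>" by (intro SUP_least Ad)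
    finally show ?thesis by blast
  qed
  have null: "(\<Inter>L. B k lam L) \<in> null_sets lborel" if "0 < lam" for k lam
  proof -
    have small: "emeasure lborel (\<Inter>L. B k lam L) \<le> 0 + ennreal \<eta>" if \<eta>: "0 < \<eta>" for \<eta>
    proof -
      obtain L where "emeasure lborel (B k lam L) \<le> ennreal \<eta>" using B_small[OF \<open>0 < lam\<close> \<eta>, of k] by blast
      moreover have "emeasure lborel (\<Inter>L. B k lam L) \<le> emeasure lborel (B k lam L)"
        using B_meas by (intro emeasure_mono) auto
      ultimately show ?thesis by simp
    qed
    have "emeasure lborel (\<Inter>L. B k lam L) \<le> 0" by (rule ennreal_le_epsilon) (rule small)
    then show ?thesis using B_meas by (auto simp: null_sets_def)
  qed
  have "AE x in lborel. \<forall>k::int. \<forall>i::nat. x \<notin> (\<Inter>L. B k (1 / real (Suc i)) L)"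
    unfolding AE_all_countable by (intro allI AE_not_in null) simp
  then show ?thesis
  proof eventually_elim
    fix x assume x: "\<forall>k i. x \<notin> (\<Inter>L. B k (1 / real (Suc i)) L)"
    have "Cauchy (\<lambda>N. S N x)"
    proof (rule metric_CauchyI)
      fix e :: real assume "e > 0"
      then obtain i where i: "1 / real (Suc i) < e / 2" using nat_approx_posE[of "e/2"] by auto
      obtain L where "x \<notin> B (didx 0 x) (1 / real (Suc i)) L" using x by blast
      then have c: "\<bar>S t x - S L x\<bar> \<le> 1 / real (Suc i)" if "L \<le> t" for t
        using that unfolding B_def mem_dint by force
      have "dist (S a x) (S b x) < e" if "L \<le> a" "L \<le> b" for a b
        using c[OF that(1)] c[OF that(2)] i unfolding dist_real_def by linarith
      then show "\<exists>M. \<forall>a\<ge>M. \<forall>b\<ge>M. dist (S a x) (S b x) < e" by blast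
    qed
    then have "convergent (\<lambda>N. S N x)" by (rule Cauchy_convergent)
    then have "convergent (\<lambda>N. S (Suc N) x)" unfolding convergent_def using LIMSEQ_Suc by blast
    moreover have "S (Suc N) x = (\<Sum>u\<in>{0..int N}. dtm \<epsilon> m \<alpha> fs u x)" for N
      unfolding S_def by (intro sum.cong) auto
    ultimately show "convergent (\<lambda>N. \<Sum>u\<in>{0..int N}. dtm \<epsilon> m \<alpha> fs u x)" by simp
  qed
qed

text \<open>A term is at most a constant times the product of \<open>m\<close> averages, whose rates
  \<open>1 / p j\<close> add up to \<open>1 / r\<close>; a geometric series dominates.\<close>

lemma dtm_large_scales_convergent:
  assumes loc: "\<forall>j\<in>{1..m}. dloc (fs j)" and eps: "\<And>n k. \<bar>\<epsilon> n k\<bar> \<le> M"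
    and decay: "\<And>j u. j \<in> {1..m} \<Longrightarrow> u \<le> 0 \<Longrightarrow> dE (\<lambda>x. \<bar>fs j x\<bar>) u x \<le> A j * 2 powr (real_of_int u / p j)"
    and r: "(\<Sum>j=1..m. 1 / p j) = 1 / r" "0 < r"
  shows "convergent (\<lambda>N. \<Sum>u\<in>{- int N..-1}. dtm \<epsilon> m \<alpha> fs u x)"
proof -
  define a where "a i = dtm \<epsilon> m \<alpha> fs (-1 - int i) x" for i
  have M: "0 \<le> M" using eps[of 0 0] by linarith
  define \<rho> where "\<rho> = 2 powr (- (1 / r))"
  have \<rho>: "0 < \<rho>" "\<rho> < 1" unfolding \<rho>_def using r powr_less_mono[of "- (1/r)" 0 "2::real"] by auto
  have bound: "norm (a i) \<le> (M * (\<Prod>j=1..m. A j) * \<rho>) * \<rho> ^ i" for i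
  proof -
    let ?u = "-1 - int i"
    have "norm (a i) \<le> M * (\<Prod>j=1..m. dE (\<lambda>x. \<bar>fs j x\<bar>) ?u x)"
      unfolding a_def using dtm_abs[OF loc eps] by simp
    also have "\<dots> \<le> M * (\<Prod>j=1..m. A j * 2 powr (real_of_int ?u / p j))"
    proof (intro mult_left_mono M prod_mono conjI)
      fix j assume "j \<in> {1..m}"
      then show "dE (\<lambda>x. \<bar>fs j x\<bar>) ?u x \<le> A j * 2 powr (real_of_int ?u / p j)" by (rule decay) simp
    qed (auto intro: dE_nonneg)
    also have "(\<Prod>j=1..m. A j * 2 powr (real_of_int ?u / p j)) = (\<Prod>j=1..m. A j) * 2 powr (\<Sum>j=1..m. real_of_int ?u / p j)"
      by (simp add: prod.distrib powr_sum)
    also have "(\<Sum>j=1..m. real_of_int ?u / p j) = real_of_int ?u * (1 / r)"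
      unfolding r(1)[symmetric] sum_distrib_left by simp
    also have "2 powr (real_of_int ?u * (1 / r)) = \<rho> powr (real (Suc i))"
      unfolding \<rho>_def powr_powr by (intro arg_cong2[where f="(powr)"] refl) (use r(2) in \<open>simp add: field_simps\<close>)
    also have "\<dots> = \<rho> ^ Suc i" using \<rho> by (rule_tac powr_realpow) auto
    finally show ?thesis by (simp add: mult_ac)
  qed
  have "summable (\<lambda>i. (M * (\<Prod>j=1..m. A j) * \<rho>) * \<rho> ^ i)"
    using \<rho> by (intro summable_mult summable_geometric) auto
  then have "summable a" using bound by (rule summable_comparison_test'[of _ 0])
  then have "convergent (\<lambda>N. \<Sum>i<N. a i)" by (simp add: summable_iff_convergent)
  moreover have "(\<Sum>i<N. a i) = (\<Sum>u\<in>{- int N..-1}. dtm \<epsilon> m \<alpha> fs u x)" for N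
    unfolding a_def
    by (rule sum.reindex_bij_witness[of _ "\<lambda>u. nat (-1 - u)" "\<lambda>i. -1 - int i"]) auto
  ultimately show ?thesis by simp
qed

section \<open>Hoelder's inequality for several functions\<close>

lemma weighted_am_gm:
  fixes w x :: "'a \<Rightarrow> real"
  assumes J: "finite J" "J \<noteq> {}" and w: "\<And>j. j \<in> J \<Longrightarrow> 0 < w j" "sum w J = 1" and x: "\<And>j. j \<in> J \<Longrightarrow> 0 \<le> x j"
  shows "(\<Prod>j\<in>J. x j powr w j) \<le> (\<Sum>j\<in>J. w j * x j)"
proof (cases "\<exists>j\<in>J. x j = 0")
  case True
  then have "(\<Prod>j\<in>J. x j powr w j) = 0" using J by (auto intro!: prod_zero)
  then show ?thesis using w x by (auto intro!: sum_nonneg mult_nonneg_nonneg simp: less_imp_le)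
next
  case False
  then have pos: "0 < x j" if "j \<in> J" for j using x[OF that] that by force
  have "(\<Prod>j\<in>J. x j powr w j) = exp (\<Sum>j\<in>J. w j *\<^sub>R ln (x j))"
    unfolding exp_sum[OF J(1)]
  proof (rule prod.cong[OF refl])
    fix j assume "j \<in> J"
    from pos[OF this] show "x j powr w j = exp (w j *\<^sub>R ln (x j))" by (simp add: powr_def)
  qed
  also have "\<dots> \<le> (\<Sum>j\<in>J. w j * exp (ln (x j)))"
    by (rule convex_on_sum[OF J exp_convex]) (use w in \<open>auto simp: less_imp_le\<close>)
  also have "\<dots> = (\<Sum>j\<in>J. w j * x j)" using pos by (intro sum.cong) auto
  finally show ?thesis .
qed

text \<open>Each factor is normalised by its integral and the weighted inequality of means is
  applied pointwise. Adding \<open>\<delta>\<close> to the integrals permits the division when one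
  of them vanishes; \<open>\<delta>\<close> tends to 0 at the end.\<close>

lemma dI_prod_holder:
  fixes F :: "'a \<Rightarrow> real \<Rightarrow> real" and P :: "'a \<Rightarrow> real"
  assumes J: "finite J" "J \<noteq> {}" and P: "\<And>j. j \<in> J \<Longrightarrow> 0 < P j" "(\<Sum>j\<in>J. 1 / P j) = 1"
    and F: "\<And>j x. j \<in> J \<Longrightarrow> 0 \<le> F j x" "\<And>j. j \<in> J \<Longrightarrow> dloc (\<lambda>x. F j x powr P j)"
    and loc: "dloc (\<lambda>x. \<Prod>j\<in>J. F j x)"
  shows "dI (\<lambda>x. \<Prod>j\<in>J. F j x) n k \<le> (\<Prod>j\<in>J. dI (\<lambda>x. F j x powr P j) n k powr (1 / P j))"
proof -
  let ?I = "\<lambda>j. dI (\<lambda>x. F j x powr P j) n k"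
  have I: "0 \<le> ?I j" for j by (rule dI_nonneg) simp
  have le: "dI (\<lambda>x. \<Prod>j\<in>J. F j x) n k \<le> (\<Prod>j\<in>J. (?I j + \<delta>) powr (1 / P j))" if "0 < \<delta>" for \<delta>
  proof -
    define A where "A j = ?I j + \<delta>" for j
    have A: "0 < A j" for j unfolding A_def using I[of j] that by simp
    define Q where "Q = (\<Prod>j\<in>J. A j powr (1 / P j))"
    have Q: "0 \<le> Q" unfolding Q_def by (intro prod_nonneg) auto
    have "(\<Prod>j\<in>J. F j x) \<le> Q * (\<Sum>j\<in>J. (1 / P j / A j) * (F j x powr P j))" for x
    proof -
      have "(\<Prod>j\<in>J. F j x) = (\<Prod>j\<in>J. A j powr (1 / P j) * (F j x powr P j / A j) powr (1 / P j))"
      proof (rule prod.cong[OF refl])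
        fix j assume j: "j \<in> J"
        have "A j powr (1 / P j) * (F j x powr P j / A j) powr (1 / P j) = (A j * (F j x powr P j / A j)) powr (1 / P j)"
          using A[of j] by (subst powr_mult) auto
        also have "\<dots> = F j x" using A[of j] F(1)[OF j, of x] P(1)[OF j] by (simp add: powr_powr)
        finally show "F j x = A j powr (1 / P j) * (F j x powr P j / A j) powr (1 / P j)" by simp
      qed
      also have "\<dots> = Q * (\<Prod>j\<in>J. (F j x powr P j / A j) powr (1 / P j))" unfolding Q_def prod.distrib ..
      also have "\<dots> \<le> Q * (\<Sum>j\<in>J. 1 / P j * (F j x powr P j / A j))"
        by (intro mult_left_mono Q weighted_am_gm J) (use P A in \<open>auto simp: less_imp_le\<close>)
      finally show ?thesis by simp
    qed
    then have "dI (\<lambda>x. \<Prod>j\<in>J. F j x) n k \<le> dI (\<lambda>x. Q * (\<Sum>j\<in>J. (1 / P j / A j) * (F j x powr P j))) n k"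
      by (intro dI_mono loc dloc_cmult dloc_sum F(2))
    also have "\<dots> = Q * (\<Sum>j\<in>J. (1 / P j / A j) * ?I j)"
      unfolding dI_cmult using J F(2) by (subst dI_sum) (auto intro!: dloc_cmult simp: dI_cmult simp del: times_divide_eq_left)
    also have "\<dots> \<le> Q * (\<Sum>j\<in>J. 1 / P j)"
    proof (intro mult_left_mono Q sum_mono)
      fix j assume "j \<in> J"
      then show "1 / P j / A j * ?I j \<le> 1 / P j"
        using A[of j] P(1)[of j] mult_left_mono[of "?I j / A j" 1 "1 / P j"] that unfolding A_def by simp
    qed
    finally show ?thesis unfolding Q_def A_def P(2) by simp
  qed
  have "(\<lambda>i. \<Prod>j\<in>J. (?I j + 1 / real (Suc i)) powr (1 / P j)) \<longlonglongrightarrow> (\<Prod>j\<in>J. (?I j + 0) powr (1 / P j))"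
  proof (intro tendsto_prod tendsto_powr' tendsto_add tendsto_const)
    fix j assume "j \<in> J"
    then show "?I j + 0 \<noteq> 0 \<or> 0 < 1 / P j \<and> (\<forall>\<^sub>F i in sequentially. 0 \<le> ?I j + 1 / real (Suc i))"
      using P(1)[of j] I[of j] by auto
    show "(\<lambda>i. 1 / real (Suc i)) \<longlonglongrightarrow> 0" using LIMSEQ_inverse_real_of_nat by (simp add: inverse_eq_divide)
  qed
  from LIMSEQ_le_const[OF this, of "dI (\<lambda>x. \<Prod>j\<in>J. F j x) n k"] show ?thesis
    using le by auto
qed

section \<open>Weak-type bound relative to the averages on an interval\<close>

lemma dE_zero_of_davg_zero:
  assumes w: "dloc w" "\<And>x. 0 \<le> w x" "davg w n k = 0" and x: "x \<in> dint n k" "n \<le> t"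
  shows "dE w t x = 0"
  using x(2)
proof (induction t rule: int_ge_induct)
  case base then show ?case using w x by (simp add: dE_eq)
next
  case (step t)
  then show ?case using dE_child_le[OF w(1,2), of t x] dE_nonneg[of w "t+1" x] w(2) by simp
qed

lemma weak_type_sets:
  "{x \<in> dint n k. \<exists>t\<in>{n..n + int d}. lam < \<bar>\<Sum>u\<in>{n..<t}. dtm \<epsilon> m \<alpha> fs u x\<bar>
            \<or> (\<exists>j\<in>{1..m}. \<kappa> j < dE (\<lambda>x. \<bar>fs j x\<bar>) t x)} \<in> sets borel"
  by measurable

text \<open>With thresholds \<open>K\<close> times the averages on the interval itself, each slot
  contributes at most the length divided by \<open>K\<close> to the weak-type bound, so the stopping
  set can be made as small a fraction of the interval as desired.\<close>

lemma weak_type_relative: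
  assumes loc: "\<forall>j\<in>{1..m}. dloc (fs j)" and eps: "\<And>n k. \<bar>\<epsilon> n k\<bar> \<le> M" "M > 0" and U: "U_set m \<alpha>" and K: "0 < K"
  shows "measure lborel {x \<in> dint n k. \<exists>t\<in>{n..n + int d}.
       M * K ^ m * (\<Prod>j=1..m. davg (\<lambda>x. \<bar>fs j x\<bar>) n k) < \<bar>\<Sum>u\<in>{n..<t}. dtm \<epsilon> m \<alpha> fs u x\<bar>
       \<or> (\<exists>j\<in>{1..m}. K * davg (\<lambda>x. \<bar>fs j x\<bar>) n k < dE (\<lambda>x. \<bar>fs j x\<bar>) t x)}
     \<le> 3 * real m / K * 2 powr (- real_of_int n)" (is "measure lborel ?A \<le> _")
proof -
  let ?a = "\<lambda>j. davg (\<lambda>x. \<bar>fs j x\<bar>) n k"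
  have a: "0 \<le> ?a j" for j by (rule davg_nonneg) simp
  \<comment> \<open>Thresholds must be positive. A slot with average 0 has average 0 at all finer
    scales inside the interval, so it never triggers a stop and it makes all partial sums vanish; 1
    is a placeholder for it.\<close>
  define \<kappa> where "\<kappa> j = (if ?a j = 0 then 1 else K * ?a j)" for j
  have \<kappa>: "\<forall>j\<in>{1..m}. \<kappa> j > 0" unfolding \<kappa>_def using K a by (simp add: order_less_le)
  let ?B = "{x \<in> dint n k. \<exists>t\<in>{n..n + int d}. M * (\<Prod>j=1..m. \<kappa> j) < \<bar>\<Sum>u\<in>{n..<t}. dtm \<epsilon> m \<alpha> fs u x\<bar>
            \<or> (\<exists>j\<in>{1..m}. \<kappa> j < dE (\<lambda>x. \<bar>fs j x\<bar>) t x)}"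
  have "?A \<subseteq> ?B"
  proof
    fix x assume "x \<in> ?A"
    then obtain t where x: "x \<in> dint n k" and t: "t \<in> {n..n + int d}"
      and h: "M * K ^ m * (\<Prod>j=1..m. ?a j) < \<bar>\<Sum>u\<in>{n..<t}. dtm \<epsilon> m \<alpha> fs u x\<bar> \<or> (\<exists>j\<in>{1..m}. K * ?a j < dE (\<lambda>x. \<bar>fs j x\<bar>) t x)"
      by blast
    have zero: "dE (\<lambda>x. \<bar>fs j x\<bar>) u x = 0" if "j \<in> {1..m}" "?a j = 0" "n \<le> u" for j u
      using that loc x by (intro dE_zero_of_davg_zero[of _ n k]) (auto intro: dloc_abs)
    have "M * (\<Prod>j=1..m. \<kappa> j) < \<bar>\<Sum>u\<in>{n..<t}. dtm \<epsilon> m \<alpha> fs u x\<bar> \<or> (\<exists>j\<in>{1..m}. \<kappa> j < dE (\<lambda>x. \<bar>fs j x\<bar>) t x)"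
      using h
    proof
      assume h: "M * K ^ m * (\<Prod>j=1..m. ?a j) < \<bar>\<Sum>u\<in>{n..<t}. dtm \<epsilon> m \<alpha> fs u x\<bar>"
      have "?a j \<noteq> 0" if j: "j \<in> {1..m}" for j
      proof
        assume j0: "?a j = 0"
        have "dtm \<epsilon> m \<alpha> fs u x = 0" if "u \<in> {n..<t}" for u
        proof -
          have zp: "(\<Prod>j=1..m. dE (\<lambda>x. \<bar>fs j x\<bar>) u x) = 0"
            using j zero[OF j j0, of u] that by (intro prod_zero) auto
          show ?thesis using dtm_abs[where \<epsilon> = \<epsilon>, OF loc eps(1), of \<alpha> u x] unfolding zp by simp
        qed
        then have "(\<Sum>u\<in>{n..<t}. dtm \<epsilon> m \<alpha> fs u x) = 0" by (intro sum.neutral) auto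
        moreover have "0 \<le> M * K ^ m * (\<Prod>j=1..m. ?a j)" using eps K a by (intro mult_nonneg_nonneg prod_nonneg) auto
        ultimately show False using h by simp
      qed
      then have "(\<Prod>j=1..m. \<kappa> j) = (\<Prod>j=1..m. K * ?a j)" unfolding \<kappa>_def by (intro prod.cong) auto
      then show ?thesis using h by (simp add: prod.distrib mult_ac)
    next
      assume "\<exists>j\<in>{1..m}. K * ?a j < dE (\<lambda>x. \<bar>fs j x\<bar>) t x"
      then obtain j where j: "j \<in> {1..m}" "K * ?a j < dE (\<lambda>x. \<bar>fs j x\<bar>) t x" by blast
      then have "?a j \<noteq> 0" using zero[OF j(1), of t] t by auto
      then show ?thesis using j unfolding \<kappa>_def by (intro disjI2 bexI[of _ j]) auto
    qed
    then show "x \<in> ?B" using x t by blast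
  qed
  then have "measure lborel ?A \<le> measure lborel ?B"
  proof (rule measure_mono_fmeasurable)
    show "?A \<in> sets lborel" using weak_type_sets[of n k d _ \<epsilon> m \<alpha> fs] by simp
    show "?B \<in> fmeasurable lborel"
      by (rule dint_sub_fmeasurable[where n = n and k = k], rule weak_type_sets, blast)
  qed
  also have "\<dots> \<le> 3 * (\<Sum>j=1..m. dI (\<lambda>x. \<bar>fs j x\<bar>) n k / \<kappa> j)"
    by (rule weak_type[OF loc \<kappa> eps U])
  also have "(\<Sum>j=1..m. dI (\<lambda>x. \<bar>fs j x\<bar>) n k / \<kappa> j) \<le> (\<Sum>j=1..m. 2 powr (- real_of_int n) / K)"
  proof (rule sum_mono)
    fix j
    show "dI (\<lambda>x. \<bar>fs j x\<bar>) n k / \<kappa> j \<le> 2 powr (- real_of_int n) / K"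
      unfolding \<kappa>_def dI_davg using K by (cases "?a j = 0") auto
  qed
  finally show ?thesis by (simp add: field_simps)
qed

lemma dfac_slot_diff:
  assumes "dloc f" "dloc g"
  shows "dfac a (\<lambda>x. f x - c * g x) u x = dfac a f u x - c * dfac a g u x"
  using assms by (simp add: dfac_def dE_def davg_diff dloc_cmult davg_cmult algebra_simps)

lemma dtm_slot_diff:
  assumes "i \<in> {1..m}" "dloc f" "dloc g"
  shows "dtm \<epsilon> m \<alpha> (fs(i := \<lambda>x. f x - c * g x)) u x = dtm \<epsilon> m \<alpha> (fs(i := f)) u x - c * dtm \<epsilon> m \<alpha> (fs(i := g)) u x"
proof -
  have eq: "(\<Prod>j=1..m. dfac (\<alpha> j) ((fs(i := h)) j) u x) = dfac (\<alpha> i) h u x * (\<Prod>j\<in>{1..m}-{i}. dfac (\<alpha> j) (fs j) u x)" for h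
    using prod.remove[of "{1..m}" i "\<lambda>j. dfac (\<alpha> j) ((fs(i := h)) j) u x"] assms by simp
  show ?thesis unfolding dtm_def eq dfac_slot_diff[OF assms(2,3)] by (simp add: algebra_simps)
qed

section \<open>The commutator estimate\<close>

lemma dloc_mult_invariant:
  assumes "dloc f" and inv: "\<And>x y. didx L x = didx L y \<Longrightarrow> \<phi> x = \<phi> y"
  shows "dloc (\<lambda>x. \<phi> x * f x)"
proof -
  have "\<phi> x = \<phi> (real_of_int (didx L x) * 2 powr (- real_of_int L))" for x
    using left_end_mem[of "didx L x" L] by (intro inv) (simp add: mem_dint)
  then have "(\<lambda>x. \<phi> x * f x) = (\<lambda>x. (\<lambda>j. \<phi> (real_of_int j * 2 powr (- real_of_int L))) (didx L x) * f x)"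
    by (intro ext) (metis (no_types))
  then show ?thesis using dloc_mult_didx[OF assms(1), of "\<lambda>j. \<phi> (real_of_int j * 2 powr (- real_of_int L))" L] by simp
qed

lemma dtm_sum_cong:
  assumes "didx N x = didx N y"
  shows "(\<Sum>u\<in>{l..<N}. dtm \<epsilon> m \<alpha> fs u x) = (\<Sum>u\<in>{l..<N}. dtm \<epsilon> m \<alpha> fs u y)"
proof (rule sum.cong[OF refl])
  fix u assume "u \<in> {l..<N}"
  then show "dtm \<epsilon> m \<alpha> fs u x = dtm \<epsilon> m \<alpha> fs u y"
    using didx_coarse[OF assms, of "u + 1"] by (intro dtm_cong) auto
qed

text \<open>The partial sum up to \<open>l - 1\<close> and the term of scale \<open>l - 1\<close>
  are each within the bound, which gives the factor 2. If \<open>l - 1 = n\<close>, no scale has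
  been tested yet, and \<open>1 \<le> K\<close> covers the averages on the interval itself.\<close>

lemma dtm_sum_before_stop:
  assumes loc: "\<forall>j\<in>{1..m}. dloc (fs j)" and eps: "\<And>n k. \<bar>\<epsilon> n k\<bar> \<le> M" "M > 0" and K: "1 \<le> K"
    and x: "x \<in> dint n k" and l: "n < l"
    and ns: "\<And>u. u \<in> {n<..<l} \<Longrightarrow>
       \<bar>\<Sum>v\<in>{n..<u}. dtm \<epsilon> m \<alpha> fs v x\<bar> \<le> M * K ^ m * (\<Prod>j=1..m. davg (\<lambda>x. \<bar>fs j x\<bar>) n k)
       \<and> (\<forall>j\<in>{1..m}. dE (\<lambda>x. \<bar>fs j x\<bar>) u x \<le> K * davg (\<lambda>x. \<bar>fs j x\<bar>) n k)"
  shows "\<bar>\<Sum>v\<in>{n..<l}. dtm \<epsilon> m \<alpha> fs v x\<bar> \<le> 2 * M * K ^ m * (\<Prod>j=1..m. davg (\<lambda>x. \<bar>fs j x\<bar>) n k)"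
proof -
  let ?a = "\<lambda>j. davg (\<lambda>x. \<bar>fs j x\<bar>) n k"
  let ?P = "\<Prod>j=1..m. ?a j"
  have a: "0 \<le> ?a j" for j by (rule davg_nonneg) simp
  have P: "0 \<le> M * K ^ m * ?P" using eps K a by (intro mult_nonneg_nonneg prod_nonneg) auto
  have "{n..<l} = insert (l - 1) {n..<l - 1}" using l by auto
  then have e: "(\<Sum>v\<in>{n..<l}. dtm \<epsilon> m \<alpha> fs v x) = dtm \<epsilon> m \<alpha> fs (l - 1) x + (\<Sum>v\<in>{n..<l - 1}. dtm \<epsilon> m \<alpha> fs v x)" by simp
  have 1: "\<bar>\<Sum>v\<in>{n..<l - 1}. dtm \<epsilon> m \<alpha> fs v x\<bar> \<le> M * K ^ m * ?P"
    using P ns[of "l - 1"] l by (cases "l - 1 = n") auto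
  have "dE (\<lambda>x. \<bar>fs j x\<bar>) (l - 1) x \<le> K * ?a j" if j: "j \<in> {1..m}" for j
  proof (cases "l - 1 = n")
    case True
    then show ?thesis using dE_eq[OF x] mult_right_mono[OF K a[of j]] by simp
  next
    case False
    then show ?thesis using ns[of "l - 1"] l j by auto
  qed
  then have "(\<Prod>j=1..m. dE (\<lambda>x. \<bar>fs j x\<bar>) (l - 1) x) \<le> (\<Prod>j=1..m. K * ?a j)"
    by (intro prod_mono) (auto intro: dE_nonneg)
  then have "M * (\<Prod>j=1..m. dE (\<lambda>x. \<bar>fs j x\<bar>) (l - 1) x) \<le> M * K ^ m * ?P"
    using eps(2) by (simp add: prod.distrib mult.assoc)
  then have "\<bar>dtm \<epsilon> m \<alpha> fs (l - 1) x\<bar> \<le> M * K ^ m * ?P"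
    using dtm_abs[where \<epsilon> = \<epsilon>, OF loc eps(1), of \<alpha> "l - 1" x] by linarith
  then show ?thesis unfolding e using 1 by linarith
qed

lemma davg_le_power_mean:
  assumes "1 < s" "dloc w" "dloc (\<lambda>x. w x powr s)" "\<And>x. 0 \<le> w x"
  shows "davg w n k \<le> davg (\<lambda>x. w x powr s) n k powr (1 / s)"
proof -
  have "0 \<le> davg w n k" using assms by (intro davg_nonneg) auto
  then have "davg w n k = (davg w n k powr s) powr (1 / s)" using assms by (simp add: powr_powr)
  also have "\<dots> \<le> davg (\<lambda>x. w x powr s) n k powr (1 / s)"
    using davg_powr_le[OF assms] assms(1) by (intro powr_mono2) auto
  finally show ?thesis .
qed

text \<open>The partial sums are constant on intervals of level \<open>N\<close>, hence harmless
  multipliers, and the unbounded \<open>b\<close> is paired with the bounded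
  \<open>g\<close>.\<close>

lemma commutator_weight_dloc:
  assumes b: "dloc b" and g: "g \<in> borel_measurable borel" "\<And>x. 0 \<le> g x" "\<And>x. \<bar>g x\<bar> \<le> L"
  shows "dloc (\<lambda>x. \<bar>\<Sum>u\<in>{l..<N}. (dtm \<epsilon> m \<alpha> fb u x - b x * dtm \<epsilon> m \<alpha> fs u x)\<bar> * g x)"
proof -
  have locg: "dloc g" using dloc_mult_bounded[OF dloc_const[of 1] g(1) g(3)] by simp
  have bg: "dloc (\<lambda>x. b x * g x)" by (rule dloc_mult_bounded[OF b g(1) g(3)])
  have eq: "\<bar>\<Sum>u\<in>{l..<N}. (dtm \<epsilon> m \<alpha> fb u x - b x * dtm \<epsilon> m \<alpha> fs u x)\<bar> * g x
    = \<bar>(\<Sum>u\<in>{l..<N}. dtm \<epsilon> m \<alpha> fb u x) * g x - (\<Sum>u\<in>{l..<N}. dtm \<epsilon> m \<alpha> fs u x) * (b x * g x)\<bar>" for x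
  proof -
    have "(\<Sum>u\<in>{l..<N}. dtm \<epsilon> m \<alpha> fb u x) * g x - (\<Sum>u\<in>{l..<N}. dtm \<epsilon> m \<alpha> fs u x) * (b x * g x)
      = (\<Sum>u\<in>{l..<N}. (dtm \<epsilon> m \<alpha> fb u x - b x * dtm \<epsilon> m \<alpha> fs u x)) * g x"
      unfolding sum_subtractf sum_distrib_left[symmetric] by (simp add: algebra_simps)
    then show ?thesis using g(2)[of x] by (simp add: abs_mult)
  qed
  show ?thesis unfolding eq
    by (intro dloc_abs dloc_diff dloc_mult_invariant[where L = N, OF locg] dloc_mult_invariant[where L = N, OF bg] dtm_sum_cong)
qed

text \<open>Before the stop the commutator is at most
  \<open>A * P' + \<bar>b x - c\<bar> * (A * P)\<close>. As \<open>b - c\<close> is unbounded even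
  there, it is integrated against \<open>g\<close>. Both terms lead to the same product of power
  means on the interval, which \<open>V\<close> dominates at each of its points.\<close>

lemma commutator_pairing:
  assumes U: "U_set m \<alpha>" and i: "i \<in> {1..m}" and eps: "\<And>n k. \<bar>\<epsilon> n k\<bar> \<le> M" "M > 0"
    and b: "dloc b" and C: "0 < C" "\<And>n k. davg (\<lambda>x. \<bar>b x - davg b n k\<bar>) n k \<le> C" and s: "1 < s"
    and loc: "\<forall>j\<in>{1..m}. dloc (fs j)" "\<forall>j\<in>{1..m}. dloc (\<lambda>x. \<bar>fs j x\<bar> powr s)"
    and locb: "dloc (\<lambda>x. b x * fs i x)"
    and g: "g \<in> borel_measurable borel" "\<And>x. 0 \<le> g x" "\<And>x. g x \<le> L"
  shows "dI (\<lambda>x. \<bar>\<Sum>u\<in>{n..<n + int d + 1}. (dtm \<epsilon> m \<alpha> (fs(i := \<lambda>x. b x * fs i x)) u x - b x * dtm \<epsilon> m \<alpha> fs u x)\<bar> * g x) n k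
    \<le> 2 * (2 * (2 * M * (12 * real (m + 1)) ^ m) * (8 * C * (s / (s - 1))))
      * dI (\<lambda>x. (\<Prod>j=1..m. dmax (\<lambda>x. \<bar>fs j x\<bar> powr s) n d x powr (1 / s)) * dmax (\<lambda>x. g x powr s) n d x powr (1 / s)) n k"
proof -
  define N where "N = n + int d + 1"
  \<comment> \<open>Each of the two stopping families, for \<open>fs\<close> and for
    \<open>f'\<close>, then covers at most \<open>3 * m / K\<close>, that is less than a quarter, of
    the interval.\<close>
  define K where "K = 12 * real (m + 1)"
  have K: "1 \<le> K" unfolding K_def by simp
  define A where "A = 2 * M * K ^ m"
  have A: "0 \<le> A" unfolding A_def using eps(2) K by simp
  define B where "B = 8 * C * (s / (s - 1))"
  have B: "0 \<le> B" unfolding B_def using C(1) s by simp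
  define fb where "fb = fs(i := \<lambda>x. b x * fs i x)"
  define cm where "cm u x = dtm \<epsilon> m \<alpha> fb u x - b x * dtm \<epsilon> m \<alpha> fs u x" for u x
  define Hs where "Hs l x = \<bar>\<Sum>u\<in>{l..<N}. cm u x\<bar> * g x" for l x
  define V where "V x = (\<Prod>j=1..m. dmax (\<lambda>x. \<bar>fs j x\<bar> powr s) n d x powr (1 / s)) * dmax (\<lambda>x. g x powr s) n d x powr (1 / s)" for x
  define W where "W x = 2 * A * B * V x" for x
  have gL: "\<bar>g x\<bar> \<le> L" for x using g(2,3)[of x] by simp
  have L: "0 \<le> L" using gL[of 0] by linarith
  have locg: "dloc g" using dloc_mult_bounded[OF dloc_const[of 1] g(1) gL] by simp
  have locgs: "dloc (\<lambda>x. g x powr s)"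
  proof -
    have m: "(\<lambda>x. g x powr s) \<in> borel_measurable borel" using g(1) by simp
    have "\<bar>g x powr s\<bar> \<le> L powr s" for x using g(2,3)[of x] s by (simp add: powr_mono2)
    from dloc_mult_bounded[OF dloc_const[of 1] m this] show ?thesis by simp
  qed
  have locbc: "dloc (\<lambda>x. \<bar>b x - c\<bar>)" for c using b by (intro dloc_abs dloc_diff dloc_const)
  have li: "dloc (fs i)" using loc i by auto
  have V0: "0 \<le> V x" for x unfolding V_def by (intro mult_nonneg_nonneg prod_nonneg) auto
  have "dI (Hs n) n k \<le> 2 * dI W n k"
  proof (rule sparse_recursion[where N = N and ?n0.0 = n])
    fix l
    show "dloc (Hs l)"
      unfolding Hs_def cm_def by (rule commutator_weight_dloc[OF b g(1) g(2) gL])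
    show "0 \<le> Hs l x" for x unfolding Hs_def using g by simp
    show "Hs N x = 0" for x unfolding Hs_def by simp
    show "dloc W"
    proof (rule dloc_invariant[of "n + int d"])
      fix x y assume xy: "didx (n + int d) x = didx (n + int d) y"
      show "W x = W y" unfolding W_def V_def by (simp add: dmax_cong[OF xy])
    qed
    show "0 \<le> W x" for x unfolding W_def using A B V0 by simp
  next
    fix n' k' assume n': "n \<le> n'" "n' < N"
    define c where "c = davg b n' k'"
    define f' where "f' = fs(i := \<lambda>x. b x * fs i x - c * fs i x)"
    have loc': "\<forall>j\<in>{1..m}. dloc (f' j)" unfolding f'_def using loc(1) locb li by (auto intro: dloc_diff dloc_cmult)
    have cm: "cm u x = dtm \<epsilon> m \<alpha> f' u x - (b x - c) * dtm \<epsilon> m \<alpha> fs u x" for u x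
      unfolding cm_def f'_def fb_def dtm_slot_diff[OF i locb li] fun_upd_triv by (simp add: algebra_simps)
    define bad where "bad h u x \<longleftrightarrow> M * K ^ m * (\<Prod>j=1..m. davg (\<lambda>x. \<bar>h j x\<bar>) n' k') < \<bar>\<Sum>v\<in>{n'..<u}. dtm \<epsilon> m \<alpha> h v x\<bar>
       \<or> (\<exists>j\<in>{1..m}. K * davg (\<lambda>x. \<bar>h j x\<bar>) n' k' < dE (\<lambda>x. \<bar>h j x\<bar>) u x)" for h u x
    have bad_cong: "bad h u x \<longleftrightarrow> bad h u y" if "didx u x = didx u y" for h u x y
      unfolding bad_def dtm_sum_cong[OF that] using that by (simp add: dE_def)
    \<comment> \<open>\<open>sparse_recursion\<close> expects a predicate of intervals, while
      \<open>bad\<close> speaks of points; it is constant on intervals of level \<open>u\<close>, so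
      any point of the interval may be asked.\<close>
    define stop where "stop u j \<longleftrightarrow> (\<exists>y\<in>dint u j. bad fs u y \<or> bad f' u y)" for u j
    have stop: "stop u (didx u x) \<longleftrightarrow> bad fs u x \<or> bad f' u x" for u x
    proof -
      have "bad fs u y = bad fs u x" "bad f' u y = bad f' u x" if "y \<in> dint u (didx u x)" for y
        using that by (auto simp: mem_dint intro!: bad_cong)
      moreover have "x \<in> dint u (didx u x)" by (simp add: mem_dint)
      ultimately show ?thesis unfolding stop_def by blast
    qed
    define P where "P = (\<Prod>j=1..m. davg (\<lambda>x. \<bar>fs j x\<bar>) n' k')"
    define P' where "P' = (\<Prod>j=1..m. davg (\<lambda>x. \<bar>f' j x\<bar>) n' k')"
    have PP: "0 \<le> P" "0 \<le> P'" unfolding P_def P'_def by (intro prod_nonneg; simp add: davg_nonneg)+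
    define good where "good x = A * P' * g x + A * P * (\<bar>b x - c\<bar> * g x)" for x
    have good_loc: "dloc good"
      unfolding good_def by (intro dloc_add dloc_cmult locg dloc_mult_bounded[OF locbc g(1) gL])
    have good0: "0 \<le> good x" for x unfolding good_def using A PP g(2)[of x] by simp
    have dom: "Hs n' x \<le> good x + Hs l x"
      if x: "x \<in> dint n' k'" and l: "l \<in> {n'<..N}" and ns: "\<forall>u\<in>{n'<..<l}. \<not> stop u (didx u x)" for x l
    proof -
      have nb: "\<not> bad fs u x" "\<not> bad f' u x" if "u \<in> {n'<..<l}" for u using ns that unfolding stop by auto
      have "n' < l" using l by simp
      have 1: "\<bar>\<Sum>v\<in>{n'..<l}. dtm \<epsilon> m \<alpha> fs v x\<bar> \<le> A * P" unfolding A_def P_def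
        by (rule dtm_sum_before_stop[OF loc(1) eps K x \<open>n' < l\<close>]) (use nb(1) in \<open>auto simp: bad_def not_less\<close>)
      have 2: "\<bar>\<Sum>v\<in>{n'..<l}. dtm \<epsilon> m \<alpha> f' v x\<bar> \<le> A * P'" unfolding A_def P'_def
        by (rule dtm_sum_before_stop[OF loc' eps K x \<open>n' < l\<close>]) (use nb(2) in \<open>auto simp: bad_def not_less\<close>)
      have "{n'..<N} = {n'..<l} \<union> {l..<N}" "{n'..<l} \<inter> {l..<N} = {}" using l by auto
      then have "(\<Sum>u\<in>{n'..<N}. cm u x) = (\<Sum>u\<in>{n'..<l}. cm u x) + (\<Sum>u\<in>{l..<N}. cm u x)"
        by (simp add: sum.union_disjoint)
      moreover have "(\<Sum>u\<in>{n'..<l}. cm u x) = (\<Sum>u\<in>{n'..<l}. dtm \<epsilon> m \<alpha> f' u x) - (b x - c) * (\<Sum>u\<in>{n'..<l}. dtm \<epsilon> m \<alpha> fs u x)"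
        unfolding cm sum_subtractf sum_distrib_left ..
      moreover have "\<bar>(b x - c) * (\<Sum>u\<in>{n'..<l}. dtm \<epsilon> m \<alpha> fs u x)\<bar> \<le> \<bar>b x - c\<bar> * (A * P)"
        unfolding abs_mult by (intro mult_left_mono 1) simp
      ultimately have "\<bar>\<Sum>u\<in>{n'..<N}. cm u x\<bar> \<le> A * P' + \<bar>b x - c\<bar> * (A * P) + \<bar>\<Sum>u\<in>{l..<N}. cm u x\<bar>"
        using 2 by linarith
      from mult_right_mono[OF this g(2)[of x]] show ?thesis unfolding Hs_def good_def by (simp add: algebra_simps)
    qed
    have small: "measure lborel {x \<in> dint n' k'. \<exists>u\<in>{n'<..N}. stop u (didx u x)} \<le> 2 powr (- real_of_int n') / 2"
    proof -
      define E where "E h = {x \<in> dint n' k'. \<exists>u\<in>{n'..n' + int (nat (N - n'))}. bad h u x}" for h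
      have E_sets: "E h \<in> sets borel" for h unfolding E_def bad_def by (rule weak_type_sets)
      have E_fm: "E h \<in> fmeasurable lborel" for h
        by (rule dint_sub_fmeasurable[OF E_sets, of _ n' k']) (auto simp: E_def)
      have E_small: "measure lborel (E h) \<le> 2 powr (- real_of_int n') / 4" if "\<forall>j\<in>{1..m}. dloc (h j)" for h
      proof -
        have "measure lborel (E h) \<le> 3 * real m / K * 2 powr (- real_of_int n')"
          unfolding E_def bad_def using K by (intro weak_type_relative[OF that eps U]) simp
        also have "\<dots> \<le> 1 / 4 * 2 powr (- real_of_int n')"
          unfolding K_def by (intro mult_right_mono) (auto simp: field_simps)
        finally show ?thesis by simp
      qed
      have sub: "{x \<in> dint n' k'. \<exists>u\<in>{n'<..N}. stop u (didx u x)} \<subseteq> E fs \<union> E f'"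
      proof
        fix x assume "x \<in> {x \<in> dint n' k'. \<exists>u\<in>{n'<..N}. stop u (didx u x)}"
        then obtain u where u: "x \<in> dint n' k'" "u \<in> {n'<..N}" "bad fs u x \<or> bad f' u x" unfolding stop by blast
        then have "u \<in> {n'..n' + int (nat (N - n'))}" by auto
        then show "x \<in> E fs \<union> E f'" using u unfolding E_def by blast
      qed
      have S: "{x \<in> dint n' k'. \<exists>u\<in>{n'<..N}. stop u (didx u x)} \<in> sets borel"
      proof (rule didx_invariant_sets[of N])
        fix x y assume xy: "didx N x = didx N y" and x: "x \<in> {x \<in> dint n' k'. \<exists>u\<in>{n'<..N}. stop u (didx u x)}"
        have "didx u x = didx u y" if "u \<le> N" for u using didx_coarse[OF xy that] .
        then show "y \<in> {x \<in> dint n' k'. \<exists>u\<in>{n'<..N}. stop u (didx u x)}" using x n' unfolding mem_dint by auto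
      qed
      have "measure lborel {x \<in> dint n' k'. \<exists>u\<in>{n'<..N}. stop u (didx u x)} \<le> measure lborel (E fs \<union> E f')"
        by (rule measure_mono_fmeasurable[OF sub _ fmeasurable.Un[OF E_fm E_fm]]) (use S in simp)
      also have "\<dots> \<le> measure lborel (E fs) + measure lborel (E f')"
        by (rule measure_Un_le[OF fmeasurableD[OF E_fm] fmeasurableD[OF E_fm]])
      also have "\<dots> \<le> 2 powr (- real_of_int n') / 2"
        using E_small[OF loc(1)] E_small[OF loc'] by simp
      finally show ?thesis .
    qed
    have avg: "davg good n' k' \<le> W x" if x: "x \<in> dint n' k'" for x
    proof -
      define \<rho> where "\<rho> h = davg (\<lambda>x. \<bar>h x\<bar> powr s) n' k' powr (1 / s)" for h
      have \<rho>0: "0 \<le> \<rho> h" for h unfolding \<rho>_def by simp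
      have "n' \<in> {n..n + int d}" using n' unfolding N_def by auto
      then have dm: "\<rho> h \<le> dmax (\<lambda>x. \<bar>h x\<bar> powr s) n d x powr (1 / s)" for h
        unfolding \<rho>_def using dE_le_dmax[of n' n d "\<lambda>x. \<bar>h x\<bar> powr s" x] dE_eq[OF x] s
        by (intro powr_mono2) (auto intro: davg_nonneg)
      have pair: "davg (\<lambda>x. \<bar>b x - c\<bar> * \<bar>h x\<bar>) n' k' \<le> B * \<rho> h" if "dloc h" "dloc (\<lambda>x. \<bar>h x\<bar> powr s)" for h
      proof -
        have "dI (\<lambda>x. \<bar>b x - c\<bar> * \<bar>h x\<bar>) n' k' \<le> B * (2 powr (- real_of_int n') * \<rho> h)"
          unfolding c_def B_def \<rho>_def by (rule bmo_pairing(2)[OF b C s dloc_abs[OF that(1)] that(2)]) simp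
        from mult_left_mono[OF this, of "2 powr real_of_int n'"]
        show ?thesis unfolding davg_dI by (simp add: powr_minus field_simps)
      qed
      have single: "davg (\<lambda>x. \<bar>h x\<bar>) n' k' \<le> \<rho> h" if "dloc h" "dloc (\<lambda>x. \<bar>h x\<bar> powr s)" for h
        unfolding \<rho>_def by (rule davg_le_power_mean[OF s dloc_abs[OF that(1)] that(2)]) simp
      have gabs: "\<bar>g x\<bar> = g x" for x using g(2)[of x] by simp
      have g1: "davg g n' k' \<le> \<rho> g" and g2: "davg (\<lambda>x. \<bar>b x - c\<bar> * g x) n' k' \<le> B * \<rho> g"
        using single[OF locg] pair[OF locg] locgs unfolding gabs by auto
      have g0: "0 \<le> davg g n' k'" "0 \<le> davg (\<lambda>x. \<bar>b x - c\<bar> * g x) n' k'" using g(2) by (auto intro!: davg_nonneg)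
      define R where "R = (\<Prod>j=1..m. \<rho> (fs j))"
      have R0: "0 \<le> R" unfolding R_def by (intro prod_nonneg) (auto simp: \<rho>0)
      have PR: "P \<le> R" unfolding P_def R_def
        by (intro prod_mono conjI single davg_nonneg) (use loc in auto)
      \<comment> \<open>Slot \<open>i\<close> alone carries \<open>b - c\<close>; the dual
        John--Nirenberg inequality exchanges it for the factor \<open>B\<close>.\<close>
      have P'R: "P' \<le> B * R"
      proof -
        have rem: "(\<Prod>j=1..m. h j) = h i * (\<Prod>j\<in>{1..m}-{i}. h j)" for h :: "nat \<Rightarrow> real"
          using prod.remove[of "{1..m}" i h] i by simp
        have e: "davg (\<lambda>x. \<bar>f' i x\<bar>) n' k' = davg (\<lambda>x. \<bar>b x - c\<bar> * \<bar>fs i x\<bar>) n' k'"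
          unfolding f'_def by (intro davg_cong) (simp add: left_diff_distrib[symmetric] abs_mult)
        have "(\<Prod>j\<in>{1..m}-{i}. davg (\<lambda>x. \<bar>f' j x\<bar>) n' k') \<le> (\<Prod>j\<in>{1..m}-{i}. \<rho> (fs j))"
          unfolding f'_def by (intro prod_mono conjI davg_nonneg) (use loc single in auto)
        moreover have "davg (\<lambda>x. \<bar>f' i x\<bar>) n' k' \<le> B * \<rho> (fs i)" unfolding e using pair li loc i by auto
        ultimately have "P' \<le> (B * \<rho> (fs i)) * (\<Prod>j\<in>{1..m}-{i}. \<rho> (fs j))"
          unfolding P'_def rem[of "\<lambda>j. davg (\<lambda>x. \<bar>f' j x\<bar>) n' k'"]
          by (intro mult_mono) (auto intro!: mult_nonneg_nonneg prod_nonneg davg_nonneg simp: B \<rho>0)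
        then show ?thesis unfolding R_def rem[of "\<lambda>j. \<rho> (fs j)"] by (simp add: mult_ac)
      qed
      have "davg good n' k' = A * P' * davg g n' k' + A * P * davg (\<lambda>x. \<bar>b x - c\<bar> * g x) n' k'"
        unfolding good_def by (subst davg_add) (auto intro!: dloc_cmult locg dloc_mult_bounded[OF locbc g(1) gL] simp: davg_cmult simp del: mult.assoc)
      also have "\<dots> \<le> A * (B * R) * \<rho> g + A * R * (B * \<rho> g)"
        using A B PP R0 PR P'R g0 g1 g2 \<rho>0[of g] by (intro add_mono mult_mono) auto
      also have "\<dots> = 2 * A * B * (R * \<rho> g)" by (simp add: algebra_simps)
      also have "\<dots> \<le> 2 * A * B * V x"
      proof -
        have "R * \<rho> g \<le> V x"
          unfolding V_def R_def
          using dm[of g] unfolding gabs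
          by (intro mult_mono prod_mono) (auto intro!: prod_nonneg simp: dm \<rho>0)
        then show ?thesis using A B by (intro mult_left_mono) auto
      qed
      finally show ?thesis unfolding W_def .
    qed
    show "\<exists>stop good. dloc good \<and> (\<forall>x. 0 \<le> good x)
      \<and> (\<forall>x\<in>dint n' k'. \<forall>l\<in>{n'<..N}. (\<forall>u\<in>{n'<..<l}. \<not> stop u (didx u x)) \<longrightarrow> Hs n' x \<le> good x + Hs l x)
      \<and> measure lborel {x \<in> dint n' k'. \<exists>u\<in>{n'<..N}. stop u (didx u x)} \<le> 2 powr (- real_of_int n') / 2
      \<and> (\<forall>x\<in>dint n' k'. davg good n' k' \<le> W x)"
      using good_loc good0 dom small avg by (intro exI[of _ stop] exI[of _ good]) blast
  qed (auto simp: N_def)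
  then show ?thesis
    unfolding Hs_def W_def dI_cmult cm_def fb_def V_def N_def A_def B_def K_def by (simp add: mult.assoc)
qed

section \<open>Local integrability and decay on large intervals\<close>

lemma Lp_norm_nonneg: "0 \<le> Lp_norm p f"
  unfolding Lp_norm_def by simp

lemma Lp_norm_powr: "0 < p \<Longrightarrow> Lp_norm p f powr p = (LINT x|lborel. \<bar>f x\<bar> powr p)"
  unfolding Lp_norm_def by (simp add: powr_powr integral_nonneg_AE)

text \<open>Powers up to \<open>p\<close> are dominated by
  \<open>1 + \<bar>f x\<bar> powr p\<close>, and the constant 1 is integrable on bounded
  intervals.\<close>

lemma Lp_mem_dloc_powr:
  assumes "Lp_mem p f" "0 < s" "s \<le> p"
  shows "dloc (\<lambda>x. \<bar>f x\<bar> powr s)"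
proof -
  have f: "f \<in> borel_measurable borel" using assms unfolding Lp_mem_def by simp
  have loc: "dloc (\<lambda>x. 1 + \<bar>f x\<bar> powr p)"
    using assms unfolding Lp_mem_def by (intro dloc_add dloc_const dloc_of_integrable) auto
  show ?thesis
  proof (rule dloc_bound[OF loc])
    show "(\<lambda>x. \<bar>f x\<bar> powr s) \<in> borel_measurable borel" using f by simp
    fix x
    have "\<bar>f x\<bar> powr s \<le> 1 + \<bar>f x\<bar> powr p"
    proof (cases "\<bar>f x\<bar> \<le> 1")
      case True
      then have "\<bar>f x\<bar> powr s \<le> 1 powr s" using assms by (intro powr_mono2) auto
      then show ?thesis using powr_ge_zero[of "\<bar>f x\<bar>" p] by (simp del: powr_ge_zero)
    next
      case False
      then have "\<bar>f x\<bar> powr s \<le> \<bar>f x\<bar> powr p" using assms by (intro powr_mono) auto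
      then show ?thesis by simp
    qed
    then show "\<bar>\<bar>f x\<bar> powr s\<bar> \<le> \<bar>1 + \<bar>f x\<bar> powr p\<bar>" by simp
  qed
qed

lemma Lp_mem_dloc:
  assumes "Lp_mem p f" "1 \<le> p" shows "dloc f"
proof (rule dloc_bound[OF Lp_mem_dloc_powr[OF assms(1), of 1]])
  show "f \<in> borel_measurable borel" using assms unfolding Lp_mem_def by simp
qed (use assms in auto)

lemma dI_powr_le_Lp_norm:
  assumes "Lp_mem p f" "0 < p"
  shows "dI (\<lambda>x. \<bar>f x\<bar> powr p) n k \<le> Lp_norm p f powr p"
  unfolding Lp_norm_powr[OF assms(2)] using assms unfolding Lp_mem_def by (intro dI_le_integral) auto

text \<open>Jensen's inequality with exponent \<open>p / s\<close>. The factor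
  \<open>2 powr (n / p)\<close> is \<open>|I|^(-1/p)\<close> and becomes small on large
  intervals.\<close>

lemma power_mean_decay:
  assumes f: "Lp_mem p f" and s: "1 < s" "s < p"
  shows "davg (\<lambda>x. \<bar>f x\<bar> powr s) n k powr (1 / s) \<le> 2 powr (real_of_int n / p) * Lp_norm p f"
proof -
  have ps: "1 < p / s" using s by simp
  have e: "(\<bar>f x\<bar> powr s) powr (p / s) = \<bar>f x\<bar> powr p" for x using s by (simp add: powr_powr)
  let ?a = "davg (\<lambda>x. \<bar>f x\<bar> powr s) n k"
  have a: "0 \<le> ?a" by (rule davg_nonneg) simp
  have "?a powr (p / s) \<le> davg (\<lambda>x. (\<bar>f x\<bar> powr s) powr (p / s)) n k"
    by (rule davg_powr_le[OF ps]) (use Lp_mem_dloc_powr[OF f, of s] Lp_mem_dloc_powr[OF f, of p] s in \<open>auto simp: e\<close>)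
  also have "\<dots> \<le> 2 powr real_of_int n * Lp_norm p f powr p"
    unfolding e davg_dI using s by (intro mult_left_mono dI_powr_le_Lp_norm f) auto
  finally have "(?a powr (p / s)) powr (1 / p) \<le> (2 powr real_of_int n * Lp_norm p f powr p) powr (1 / p)"
    using s by (intro powr_mono2) auto
  then show ?thesis using s a Lp_norm_nonneg[of p f] by (simp add: powr_powr powr_mult)
qed

lemma dE_decay:
  assumes f: "Lp_mem p f" and p: "1 < p"
  shows "dE (\<lambda>x. \<bar>f x\<bar>) u x \<le> 2 powr (real_of_int u / p) * Lp_norm p f"
proof -
  define s where "s = (1 + p) / 2"
  have s: "1 < s" "s < p" unfolding s_def using p by auto
  have "dE (\<lambda>x. \<bar>f x\<bar>) u x \<le> davg (\<lambda>x. \<bar>f x\<bar> powr s) u (didx u x) powr (1 / s)"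
    unfolding dE_def
    by (rule davg_le_power_mean[OF s(1)])
      (use Lp_mem_dloc[OF f] Lp_mem_dloc_powr[OF f, of s] s in \<open>auto intro: dloc_abs\<close>)
  also have "\<dots> \<le> 2 powr (real_of_int u / p) * Lp_norm p f" by (rule power_mean_decay[OF f s])
  finally show ?thesis .
qed

lemma BMO_d_dloc:
  assumes "BMO_d b" shows "dloc b"
proof -
  have "set_integrable lborel (dint n k) b" for n k
  proof -
    let ?K = "{real_of_int k * 2 powr (- real_of_int n)..real_of_int (k + 1) * 2 powr (- real_of_int n)}"
    have "set_integrable lborel ?K b" using assms unfolding BMO_d_def by auto
    then show ?thesis by (rule set_integrable_subset) (auto simp: dint_def)
  qed
  then show ?thesis using assms unfolding dloc_def BMO_d_def by auto
qed

lemma BMO_d_bound: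
  assumes "BMO_d b"
  shows "\<exists>C>0. \<forall>n k. davg (\<lambda>x. \<bar>b x - davg b n k\<bar>) n k \<le> C"
proof -
  obtain C where C: "\<And>n k. 2 powr (real_of_int n) * (LINT x:dint n k|lborel. \<bar>b x - davg b n k\<bar>) \<le> C"
    using assms unfolding BMO_d_def by blast
  have "davg (\<lambda>x. \<bar>b x - davg b n k\<bar>) n k \<le> \<bar>C\<bar> + 1" for n k
    using C[of n k] unfolding davg_def[of "\<lambda>x. \<bar>b x - davg b n k\<bar>"] by linarith
  then show ?thesis by (intro exI[of _ "\<bar>C\<bar> + 1"]) simp
qed

text \<open>On each interval \<open>b\<close> is split into its mean and its oscillation; the
  product of the oscillation with \<open>f\<close> is integrable by the dual John--Nirenberg
  inequality.\<close>

lemma bmo_mult_dloc: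
  assumes b: "dloc b" and C: "0 < C" "\<And>n k. davg (\<lambda>x. \<bar>b x - davg b n k\<bar>) n k \<le> C"
    and s: "1 < s" and f: "dloc f" "dloc (\<lambda>x. \<bar>f x\<bar> powr s)"
  shows "dloc (\<lambda>x. b x * f x)"
  unfolding dloc_def
proof (intro conjI allI)
  show m: "(\<lambda>x. b x * f x) \<in> borel_measurable borel" using dloc_measurable[OF b] dloc_measurable[OF f(1)] by simp
  fix n k
  let ?c = "davg b n k"
  have "set_integrable lborel (dint n k) (\<lambda>x. \<bar>b x - ?c\<bar> * \<bar>f x\<bar>)"
    by (rule bmo_pairing(1)[OF b C s dloc_abs[OF f(1)] f(2)]) simp
  moreover have "set_integrable lborel (dint n k) (\<lambda>x. \<bar>?c\<bar> * \<bar>f x\<bar>)"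
    using dloc_integrable[OF dloc_cmult[OF dloc_abs[OF f(1)]]] .
  ultimately have "set_integrable lborel (dint n k) (\<lambda>x. \<bar>b x - ?c\<bar> * \<bar>f x\<bar> + \<bar>?c\<bar> * \<bar>f x\<bar>)" by (rule set_integral_add(1))
  then show "set_integrable lborel (dint n k) (\<lambda>x. b x * f x)"
  proof (rule set_integrable_bound)
    show "set_borel_measurable lborel (dint n k) (\<lambda>x. b x * f x)"
      unfolding set_borel_measurable_def using m by measurable
    show "AE x in lborel. x \<in> dint n k \<longrightarrow> norm (b x * f x) \<le> norm (\<bar>b x - ?c\<bar> * \<bar>f x\<bar> + \<bar>?c\<bar> * \<bar>f x\<bar>)"
    proof (intro AE_I2 impI)
      fix x
      have "\<bar>b x\<bar> * \<bar>f x\<bar> \<le> (\<bar>b x - ?c\<bar> + \<bar>?c\<bar>) * \<bar>f x\<bar>" by (intro mult_right_mono) auto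
      then show "norm (b x * f x) \<le> norm (\<bar>b x - ?c\<bar> * \<bar>f x\<bar> + \<bar>?c\<bar> * \<bar>f x\<bar>)"
        by (simp add: abs_mult algebra_simps)
    qed
  qed
qed

text \<open>The oscillation of \<open>b\<close> costs a constant by the dual John--Nirenberg
  inequality, and the mean is at most the norm of \<open>b\<close>, because the intervals have
  length at least 1. Here global integrability of \<open>b\<close> enters: the means of a BMO
  function may grow with the length.\<close>

lemma bmo_mult_decay:
  assumes b: "dloc b" and C: "0 < C" "\<And>n k. davg (\<lambda>x. \<bar>b x - davg b n k\<bar>) n k \<le> C"
    and bq: "Lp_mem q b" "1 < q" and f: "Lp_mem p f" "1 < p"
  shows "\<exists>A. \<forall>u\<le>0. \<forall>x. dE (\<lambda>x. \<bar>b x * f x\<bar>) u x \<le> A * 2 powr (real_of_int u / p)"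
proof -
  define s where "s = (1 + p) / 2"
  have s: "1 < s" "s < p" unfolding s_def using f(2) by auto
  have lf: "dloc f" "dloc (\<lambda>x. \<bar>f x\<bar> powr s)" using Lp_mem_dloc[OF f(1)] Lp_mem_dloc_powr[OF f(1), of s] s by auto
  define B where "B = 8 * C * (s / (s - 1))"
  have B: "0 \<le> B" unfolding B_def using C(1) s by simp
  have "dE (\<lambda>x. \<bar>b x * f x\<bar>) u x \<le> ((B + Lp_norm q b) * Lp_norm p f) * 2 powr (real_of_int u / p)" if u: "u \<le> 0" for u x
  proof -
    let ?k = "didx u x"
    let ?c = "davg b u ?k"
    define \<rho> where "\<rho> = davg (\<lambda>x. \<bar>f x\<bar> powr s) u ?k powr (1 / s)"
    have \<rho>: "\<rho> \<le> 2 powr (real_of_int u / p) * Lp_norm p f" unfolding \<rho>_def by (rule power_mean_decay[OF f(1) s])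
    have \<rho>0: "0 \<le> \<rho>" unfolding \<rho>_def by simp
    have bf: "dloc (\<lambda>x. b x * f x)" by (rule bmo_mult_dloc[OF b C s(1) lf])
    have cbf: "dloc (\<lambda>x. \<bar>b x - ?c\<bar> * \<bar>f x\<bar>)"
      using dloc_abs[OF dloc_diff[OF bf dloc_cmult[OF lf(1), of ?c]]]
      by (simp add: left_diff_distrib[symmetric] abs_mult)
    have "dI (\<lambda>x. \<bar>b x - ?c\<bar> * \<bar>f x\<bar>) u ?k \<le> B * (2 powr (- real_of_int u) * \<rho>)"
      unfolding B_def \<rho>_def by (rule bmo_pairing(2)[OF b C s(1) dloc_abs[OF lf(1)] lf(2)]) simp
    from mult_left_mono[OF this, of "2 powr real_of_int u"]
    have 1: "davg (\<lambda>x. \<bar>b x - ?c\<bar> * \<bar>f x\<bar>) u ?k \<le> B * \<rho>" unfolding davg_dI by (simp add: powr_minus field_simps)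
    have "\<bar>?c\<bar> \<le> dE (\<lambda>x. \<bar>b x\<bar>) u x" unfolding dE_def by (rule davg_abs[OF b])
    also have "\<dots> \<le> 2 powr (real_of_int u / q) * Lp_norm q b" by (rule dE_decay[OF bq])
    also have "\<dots> \<le> 1 * Lp_norm q b"
    proof (rule mult_right_mono)
      have "2 powr (real_of_int u / q) \<le> 2 powr 0" using u bq by (intro powr_mono) (auto simp: divide_nonpos_pos)
      then show "2 powr (real_of_int u / q) \<le> 1" by simp
    qed (rule Lp_norm_nonneg)
    finally have 2: "\<bar>?c\<bar> \<le> Lp_norm q b" by simp
    have 3: "davg (\<lambda>x. \<bar>f x\<bar>) u ?k \<le> \<rho>"
      unfolding \<rho>_def by (rule davg_le_power_mean[OF s(1) dloc_abs[OF lf(1)] lf(2)]) simp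
    have "dE (\<lambda>x. \<bar>b x * f x\<bar>) u x \<le> davg (\<lambda>x. \<bar>b x - ?c\<bar> * \<bar>f x\<bar> + \<bar>?c\<bar> * \<bar>f x\<bar>) u ?k"
      unfolding dE_def
    proof (rule davg_mono[OF dloc_abs[OF bf] dloc_add[OF cbf dloc_cmult[OF dloc_abs[OF lf(1)]]]])
      fix x
      have "\<bar>b x\<bar> * \<bar>f x\<bar> \<le> (\<bar>b x - ?c\<bar> + \<bar>?c\<bar>) * \<bar>f x\<bar>" by (intro mult_right_mono) auto
      then show "\<bar>b x * f x\<bar> \<le> \<bar>b x - ?c\<bar> * \<bar>f x\<bar> + \<bar>?c\<bar> * \<bar>f x\<bar>" by (simp add: abs_mult algebra_simps)
    qed
    also have "\<dots> = davg (\<lambda>x. \<bar>b x - ?c\<bar> * \<bar>f x\<bar>) u ?k + \<bar>?c\<bar> * davg (\<lambda>x. \<bar>f x\<bar>) u ?k"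
      by (subst davg_add[OF cbf dloc_cmult[OF dloc_abs[OF lf(1)]]]) (simp add: davg_cmult)
    also have "\<dots> \<le> B * \<rho> + Lp_norm q b * \<rho>"
      using 1 2 3 Lp_norm_nonneg[of q b] by (intro add_mono mult_mono) (auto intro: davg_nonneg)
    also have "\<dots> = (B + Lp_norm q b) * \<rho>" by (simp add: algebra_simps)
    also have "\<dots> \<le> (B + Lp_norm q b) * (2 powr (real_of_int u / p) * Lp_norm p f)"
      using B Lp_norm_nonneg[of q b] by (intro mult_left_mono \<rho>) auto
    finally show ?thesis by (simp add: mult_ac)
  qed
  then show ?thesis by blast
qed

text \<open>Duality by hand: with \<open>G\<close> the commutator cut at \<open>L\<close> and
  \<open>g\<close> its power \<open>r - 1\<close>, the integral \<open>I\<close> of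
  \<open>G powr r\<close> is at most a constant times \<open>I powr (1 / r')\<close>. The cut makes
  \<open>I\<close> finite, so this power can be divided out. \<open>K\<close> is fixed before
  functions, scales, interval and cut.\<close>

lemma commutator_truncated_Lr:
  assumes U: "U_set m \<alpha>" and i: "i \<in> {1..m}" and eps: "\<And>n k. \<bar>\<epsilon> n k\<bar> \<le> M" "M > 0"
    and b: "dloc b" and C: "0 < C" "\<And>n k. davg (\<lambda>x. \<bar>b x - davg b n k\<bar>) n k \<le> C"
    and p: "\<forall>j\<in>{1..m}. 1 < p j" and r: "1 < r" "(\<Sum>j=1..m. 1 / p j) = 1 / r"
  shows "\<exists>K\<ge>0. \<forall>fs. (\<forall>j\<in>{1..m}. Lp_mem (p j) (fs j)) \<longrightarrow> (\<forall>n d k L. 0 \<le> L \<longrightarrow>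
     dI (\<lambda>x. min \<bar>\<Sum>u\<in>{n..<n + int d + 1}. (dtm \<epsilon> m \<alpha> (fs(i := \<lambda>x. b x * fs i x)) u x - b x * dtm \<epsilon> m \<alpha> fs u x)\<bar> L powr r) n k
     \<le> (K * (\<Prod>j=1..m. Lp_norm (p j) (fs j))) powr r)"
proof -
  define r' where "r' = r / (r - 1)"
  have r': "1 < r'" unfolding r'_def using r by simp
  have r'_inv: "1 / r' = 1 - 1 / r" unfolding r'_def using r by (simp add: field_simps)
  \<comment> \<open>Index 0 is reserved for the dual function \<open>g\<close>, with the conjugate
    exponent of \<open>r\<close>; the \<open>m + 1\<close> reciprocals then add up to 1.\<close>
  define P where "P j = (if j = 0 then r' else p j)" for j
  have P: "1 < P j" if "j \<in> {0..m}" for j using that p r' unfolding P_def by auto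
  have sumP: "(\<Sum>j=0..m. 1 / P j) = 1"
  proof -
    have "(\<Sum>j=0..m. 1 / P j) = 1 / P 0 + (\<Sum>j=1..m. 1 / P j)"
      using sum.atLeast_Suc_atMost[of 0 m "\<lambda>j. 1 / P j"] by simp
    also have "(\<Sum>j=1..m. 1 / P j) = (\<Sum>j=1..m. 1 / p j)" by (intro sum.cong) (auto simp: P_def)
    finally show ?thesis using r(2) r'_inv by (simp add: P_def)
  qed
  define mn where "mn = Min (P ` {0..m})"
  have "1 < mn" unfolding mn_def using P by (subst Min_gr_iff) auto
  \<comment> \<open>\<open>s\<close> lies below every \<open>P j\<close>, so Doob's inequality
    applies to the maximal functions of \<open>s\<close>-th powers, with exponents
    \<open>P j / s\<close> above 1.\<close>
  define s where "s = (1 + mn) / 2"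
  have s: "1 < s" "s < mn" unfolding s_def using \<open>1 < mn\<close> by auto
  have sP: "s < P j" if "j \<in> {0..m}" for j
    using s(2) Min_le[of "P ` {0..m}" "P j"] that unfolding mn_def by auto
  define D where "D t = (t / (t - 1)) powr t" for t :: real
  have D0: "0 \<le> D t" for t unfolding D_def by simp
  define K1 where "K1 = 2 * (2 * (2 * M * (12 * real (m + 1)) ^ m) * (8 * C * (s / (s - 1))))"
  have K1: "0 \<le> K1" unfolding K1_def using eps C s by simp
  define K where "K = K1 * D (r' / s) powr (1 / r') * (\<Prod>j=1..m. D (p j / s) powr (1 / p j))"
  have K: "0 \<le> K" unfolding K_def using K1 by (intro mult_nonneg_nonneg prod_nonneg) auto
  have "dI (\<lambda>x. min \<bar>\<Sum>u\<in>{n..<n + int d + 1}. (dtm \<epsilon> m \<alpha> (fs(i := \<lambda>x. b x * fs i x)) u x - b x * dtm \<epsilon> m \<alpha> fs u x)\<bar> L powr r) n k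
     \<le> (K * (\<Prod>j=1..m. Lp_norm (p j) (fs j))) powr r"
    if fs: "\<forall>j\<in>{1..m}. Lp_mem (p j) (fs j)" and L: "0 \<le> L" for fs n d k L
  proof -
    have sp: "s < p j" if "j \<in> {1..m}" for j using sP[of j] that unfolding P_def by auto
    have loc: "\<forall>j\<in>{1..m}. dloc (fs j)" using fs p by (auto intro: Lp_mem_dloc less_imp_le)
    have locs: "\<forall>j\<in>{1..m}. dloc (\<lambda>x. \<bar>fs j x\<bar> powr s)"
      using fs sp s by (auto intro!: Lp_mem_dloc_powr less_imp_le)
    have locb: "dloc (\<lambda>x. b x * fs i x)" using loc locs i by (intro bmo_mult_dloc[OF b C s(1)]) auto
    define X where "X x = \<bar>\<Sum>u\<in>{n..<n + int d + 1}. (dtm \<epsilon> m \<alpha> (fs(i := \<lambda>x. b x * fs i x)) u x - b x * dtm \<epsilon> m \<alpha> fs u x)\<bar>" for x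
    define G where "G x = min (X x) L" for x
    define g where "g x = G x powr (r - 1)" for x
    have [measurable]: "b \<in> borel_measurable borel" using dloc_measurable[OF b] .
    have X_meas [measurable]: "X \<in> borel_measurable borel" unfolding X_def by measurable
    have G_meas [measurable]: "G \<in> borel_measurable borel" unfolding G_def by measurable
    have g_meas [measurable]: "g \<in> borel_measurable borel" unfolding g_def by measurable
    have X0: "0 \<le> X x" for x unfolding X_def by simp
    have G0: "0 \<le> G x" "G x \<le> L" "G x \<le> X x" for x unfolding G_def using X0[of x] L by auto
    have g0: "0 \<le> g x" "g x \<le> L powr (r - 1)" for x unfolding g_def using G0[of x] r by (auto intro: powr_mono2)
    then have g1: "\<bar>g x\<bar> \<le> L powr (r - 1)" for x by (metis abs_of_nonneg)
    have bounded: "dloc h" if "h \<in> borel_measurable borel" "\<And>x. 0 \<le> h x" "\<And>x. h x \<le> c" for h c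
    proof -
      have "\<bar>h x\<bar> \<le> c" for x using that(2,3)[of x] by simp
      from dloc_mult_bounded[OF dloc_const[of 1] that(1) this] show ?thesis by simp
    qed
    have Gr: "dloc (\<lambda>x. G x powr r)" by (rule bounded[of _ "L powr r"]) (use G0 r in \<open>auto intro: powr_mono2\<close>)
    define I where "I = dI (\<lambda>x. G x powr r) n k"
    have I0: "0 \<le> I" unfolding I_def by (rule dI_nonneg) simp
    define w where "w j = (if j = 0 then (\<lambda>x. g x powr s) else (\<lambda>x. \<bar>fs j x\<bar> powr s))" for j
    define F where "F j x = dmax (w j) n d x powr (1 / s)" for j x
    have w0: "0 \<le> w j x" for j x unfolding w_def by simp
    have wloc: "dloc (w j)" if "j \<in> {0..m}" for j
    proof (cases "j = 0")
      case True
      have "dloc (\<lambda>x. g x powr s)"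
        by (rule bounded[of _ "(L powr (r - 1)) powr s"]) (use g0 s in \<open>auto intro: powr_mono2\<close>)
      then show ?thesis unfolding w_def using True by simp
    next
      case False then show ?thesis using locs that unfolding w_def by auto
    qed
    have wP: "w j x powr (P j / s) = (if j = 0 then G x powr r else \<bar>fs j x\<bar> powr p j)" if "j \<in> {0..m}" for j x
    proof -
      have "(r - 1) * r' = r" unfolding r'_def using r by simp
      then show ?thesis using s unfolding w_def P_def g_def by (auto simp: powr_powr)
    qed
    have wPloc: "dloc (\<lambda>x. w j x powr (P j / s))" if "j \<in> {0..m}" for j
    proof (cases "j = 0")
      case True then show ?thesis using wP[OF that] Gr by simp
    next
      case False
      then have "Lp_mem (p j) (fs j)" "1 < p j" using fs that p by auto
      then have "dloc (\<lambda>x. \<bar>fs j x\<bar> powr p j)" by (intro Lp_mem_dloc_powr[of "p j"]) auto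
      then show ?thesis using wP[OF that] False by simp
    qed
    have FP: "F j x powr P j = dmax (w j) n d x powr (P j / s)" for j x
      unfolding F_def by (simp add: powr_powr)
    have FI: "dI (\<lambda>x. F j x powr P j) n k \<le> D (P j / s) * dI (\<lambda>x. w j x powr (P j / s)) n k" if "j \<in> {0..m}" for j
      unfolding FP D_def using sP[OF that] s by (intro dyadic_doob wloc wPloc w0 that) simp
    have FI': "dI (\<lambda>x. F j x powr P j) n k powr (1 / P j) \<le> D (P j / s) powr (1 / P j) * (if j = 0 then I powr (1 / r') else Lp_norm (p j) (fs j))"
      if j: "j \<in> {0..m}" for j
    proof -
      have pos: "0 \<le> dI (\<lambda>x. F j x powr P j) n k" "0 \<le> dI (\<lambda>x. w j x powr (P j / s)) n k" by (rule dI_nonneg; simp)+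
      have "dI (\<lambda>x. F j x powr P j) n k powr (1 / P j) \<le> (D (P j / s) * dI (\<lambda>x. w j x powr (P j / s)) n k) powr (1 / P j)"
        using P[OF j] by (intro powr_mono2 FI j pos) auto
      also have "\<dots> = D (P j / s) powr (1 / P j) * dI (\<lambda>x. w j x powr (P j / s)) n k powr (1 / P j)"
        by (rule powr_mult)
      also have "dI (\<lambda>x. w j x powr (P j / s)) n k powr (1 / P j) \<le> (if j = 0 then I powr (1 / r') else Lp_norm (p j) (fs j))"
      proof (cases "j = 0")
        case True then show ?thesis unfolding wP[OF j] unfolding I_def P_def by simp
      next
        case False
        then have "j \<in> {1..m}" using j by auto
        then have j1: "Lp_mem (p j) (fs j)" "1 < p j" using fs p by auto
        have "dI (\<lambda>x. \<bar>fs j x\<bar> powr p j) n k powr (1 / p j) \<le> (Lp_norm (p j) (fs j) powr p j) powr (1 / p j)"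
          using j1 by (intro powr_mono2 dI_powr_le_Lp_norm dI_nonneg) auto
        also have "\<dots> = Lp_norm (p j) (fs j)" using j1(2) Lp_norm_nonneg[of "p j" "fs j"] by (simp add: powr_powr)
        finally show ?thesis using False unfolding wP[OF j] unfolding P_def by simp
      qed
      finally show ?thesis by (simp add: mult_left_mono)
    qed
    have Finv: "F j x = F j y" if "didx (n + int d) x = didx (n + int d) y" for j x y
      unfolding F_def using dmax_cong[OF that] by simp
    have prodF: "(\<Prod>j=0..m. F j x) = (\<Prod>j=1..m. dmax (\<lambda>x. \<bar>fs j x\<bar> powr s) n d x powr (1 / s)) * dmax (\<lambda>x. g x powr s) n d x powr (1 / s)" for x
    proof -
      have "(\<Prod>j=0..m. F j x) = F 0 x * (\<Prod>j=1..m. F j x)"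
        using prod.atLeast_Suc_atMost[of 0 m "\<lambda>j. F j x"] by simp
      also have "(\<Prod>j=1..m. F j x) = (\<Prod>j=1..m. dmax (\<lambda>x. \<bar>fs j x\<bar> powr s) n d x powr (1 / s))"
        unfolding F_def w_def by (intro prod.cong) auto
      finally show ?thesis by (simp add: F_def w_def)
    qed
    have "I \<le> dI (\<lambda>x. X x * g x) n k"
      unfolding I_def
    proof (rule dI_mono[OF Gr])
      show "dloc (\<lambda>x. X x * g x)" unfolding X_def by (rule commutator_weight_dloc[OF b g_meas g0(1) g1])
      fix x
      have "G x powr r = G x * g x" using powr_minus_one_mult[OF G0(1), of x r] unfolding g_def by (simp add: mult.commute)
      also have "\<dots> \<le> X x * g x" using G0(3) g0(1) by (intro mult_right_mono) auto
      finally show "G x powr r \<le> X x * g x" .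
    qed
    also have "\<dots> \<le> K1 * dI (\<lambda>x. \<Prod>j=0..m. F j x) n k"
      unfolding X_def K1_def prodF by (rule commutator_pairing[OF U i eps b C s(1) loc locs locb g_meas g0])
    also have "\<dots> \<le> K1 * (\<Prod>j=0..m. dI (\<lambda>x. F j x powr P j) n k powr (1 / P j))"
    proof (intro mult_left_mono K1 dI_prod_holder)
      fix j assume j: "j \<in> {0..m}"
      show "0 < P j" using P[OF j] by simp
      show "0 \<le> F j x" for x unfolding F_def by simp
      show "dloc (\<lambda>x. F j x powr P j)" unfolding FP by (rule dloc_dmax_powr)
    next
      show "dloc (\<lambda>x. \<Prod>j = 0..m. F j x)"
      proof (rule dloc_invariant[of "n + int d"])
        fix x y assume "didx (n + int d) x = didx (n + int d) y"
        from Finv[OF this] show "(\<Prod>j = 0..m. F j x) = (\<Prod>j = 0..m. F j y)" by simp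
      qed
    qed (use sumP in auto)
    also have "\<dots> \<le> K1 * (\<Prod>j=0..m. D (P j / s) powr (1 / P j) * (if j = 0 then I powr (1 / r') else Lp_norm (p j) (fs j)))"
      by (intro mult_left_mono K1 prod_mono conjI FI') auto
    also have "(\<Prod>j=0..m. D (P j / s) powr (1 / P j) * (if j = 0 then I powr (1 / r') else Lp_norm (p j) (fs j)))
      = (D (r' / s) powr (1 / r') * I powr (1 / r')) * (\<Prod>j=1..m. D (p j / s) powr (1 / p j) * Lp_norm (p j) (fs j))"
    proof -
      let ?h = "\<lambda>j. D (P j / s) powr (1 / P j) * (if j = 0 then I powr (1 / r') else Lp_norm (p j) (fs j))"
      have "(\<Prod>j=0..m. ?h j) = ?h 0 * (\<Prod>j=1..m. ?h j)"
        using prod.atLeast_Suc_atMost[of 0 m ?h] by simp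
      also have "(\<Prod>j=1..m. ?h j) = (\<Prod>j=1..m. D (p j / s) powr (1 / p j) * Lp_norm (p j) (fs j))"
        by (intro prod.cong) (auto simp: P_def)
      finally show ?thesis by (simp add: P_def)
    qed
    finally have main: "I \<le> (K * (\<Prod>j=1..m. Lp_norm (p j) (fs j))) * I powr (1 / r')"
      unfolding K_def prod.distrib by (simp add: mult_ac)
    let ?Y = "K * (\<Prod>j=1..m. Lp_norm (p j) (fs j))"
    have "I \<le> ?Y powr r"
    proof (cases "I = 0")
      case True then show ?thesis by simp
    next
      case False
      then have Ip: "0 < I" using I0 by simp
      have "I powr (1 / r) * I powr (1 / r') = I"
        using Ip unfolding r'_inv powr_add[symmetric] by simp
      then have "I powr (1 / r) * I powr (1 / r') \<le> ?Y * I powr (1 / r')" using main by simp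
      then have "I powr (1 / r) \<le> ?Y" using Ip by simp
      then have "(I powr (1 / r)) powr r \<le> ?Y powr r" using r by (intro powr_mono2) auto
      then show ?thesis using Ip r by (simp add: powr_powr)
    qed
    then show ?thesis unfolding I_def G_def X_def .
  qed
  then show ?thesis using K by blast
qed

section \<open>From truncations to the limit operator\<close>

lemma comm_trunc_eq:
  assumes U: "U_set m \<alpha>" and loc: "\<forall>j\<in>{1..m}. dloc (fs j)" and locb: "dloc (\<lambda>x. b x * fs i x)"
  shows "comm_trunc b i \<epsilon> m \<alpha> N fs x =
    (\<Sum>u\<in>{- int N..int N}. (dtm \<epsilon> m \<alpha> (fs(i := \<lambda>x. b x * fs i x)) u x - b x * dtm \<epsilon> m \<alpha> fs u x))"
proof -
  have locb': "\<forall>j\<in>{1..m}. dloc ((fs(i := \<lambda>x. b x * fs i x)) j)" using loc locb by auto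
  show ?thesis
    unfolding comm_trunc_def T_trunc_eq[OF U loc] T_trunc_eq[OF U locb'] by (simp add: sum_subtractf sum_distrib_left)
qed

lemma two_sided_convergent:
  fixes a :: "int \<Rightarrow> real"
  assumes "convergent (\<lambda>N. \<Sum>u\<in>{- int N..-1}. a u)" "convergent (\<lambda>N. \<Sum>u\<in>{0..int N}. a u)"
  shows "convergent (\<lambda>N. \<Sum>u\<in>{- int N..int N}. a u)"
proof -
  have "(\<Sum>u\<in>{- int N..int N}. a u) = (\<Sum>u\<in>{- int N..-1}. a u) + (\<Sum>u\<in>{0..int N}. a u)" for N
  proof -
    have "{- int N..int N} = {- int N..-1} \<union> {0..int N}" by auto
    then show ?thesis by (simp add: sum.union_disjoint)
  qed
  then show ?thesis using convergent_add[OF assms] by simp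
qed

lemma comm_trunc_AE_convergent:
  assumes U: "U_set m \<alpha>" and i: "i \<in> {1..m}" and eps: "\<And>n k. \<bar>\<epsilon> n k\<bar> \<le> M" "M > 0"
    and b: "dloc b" and C: "0 < C" "\<And>n k. davg (\<lambda>x. \<bar>b x - davg b n k\<bar>) n k \<le> C"
    and bq: "Lp_mem q b" "1 < q"
    and p: "\<forall>j\<in>{1..m}. 1 < p j" and r: "1 < r" "(\<Sum>j=1..m. 1 / p j) = 1 / r"
    and fs: "\<forall>j\<in>{1..m}. Lp_mem (p j) (fs j)"
    and loc: "\<forall>j\<in>{1..m}. dloc (fs j)" and locb: "dloc (\<lambda>x. b x * fs i x)"
  shows "AE x in lborel. convergent (\<lambda>N. comm_trunc b i \<epsilon> m \<alpha> N fs x)"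
proof -
  let ?fb = "fs(i := \<lambda>x. b x * fs i x)"
  have locb': "\<forall>j\<in>{1..m}. dloc (?fb j)" using loc locb by auto
  have large: "convergent (\<lambda>N. \<Sum>u\<in>{- int N..-1}. dtm \<epsilon> m \<alpha> fs u x)" for x
  proof (rule dtm_large_scales_convergent[where \<epsilon> = \<epsilon> and p = p and r = r and A = "\<lambda>j. Lp_norm (p j) (fs j)", OF loc eps(1)])
    fix j and u :: int assume "j \<in> {1..m}"
    then show "dE (\<lambda>x. \<bar>fs j x\<bar>) u x \<le> Lp_norm (p j) (fs j) * 2 powr (real_of_int u / p j)"
      using dE_decay[of "p j" "fs j" u x] fs p by (simp add: mult.commute)
  qed (use r in auto)
  \<comment> \<open>\<open>b * fs i\<close> need not have a finite norm with exponent
    \<open>p i\<close>, but its averages on large intervals decay at the same rate.\<close>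
  obtain A where A: "\<And>u x. u \<le> 0 \<Longrightarrow> dE (\<lambda>x. \<bar>b x * fs i x\<bar>) u x \<le> A * 2 powr (real_of_int u / p i)"
    using bmo_mult_decay[OF b C bq, of "p i" "fs i"] fs p i by blast
  have large_b: "convergent (\<lambda>N. \<Sum>u\<in>{- int N..-1}. dtm \<epsilon> m \<alpha> ?fb u x)" for x
  proof (rule dtm_large_scales_convergent[where \<epsilon> = \<epsilon> and p = p and r = r and A = "\<lambda>j. if j = i then A else Lp_norm (p j) (fs j)", OF locb' eps(1)])
    fix j and u :: int assume "j \<in> {1..m}" "u \<le> 0"
    then show "dE (\<lambda>x. \<bar>?fb j x\<bar>) u x \<le> (if j = i then A else Lp_norm (p j) (fs j)) * 2 powr (real_of_int u / p j)"
      using dE_decay[of "p j" "fs j" u x] fs p A[of u x] by (simp add: mult.commute)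
  qed (use r in auto)
  have "AE x in lborel. convergent (\<lambda>N. \<Sum>u\<in>{0..int N}. dtm \<epsilon> m \<alpha> fs u x)"
    by (rule dtm_small_scales_convergent[OF loc eps U])
  moreover have "AE x in lborel. convergent (\<lambda>N. \<Sum>u\<in>{0..int N}. dtm \<epsilon> m \<alpha> ?fb u x)"
    by (rule dtm_small_scales_convergent[OF locb' eps U])
  ultimately show ?thesis
  proof eventually_elim
    fix x
    assume 1: "convergent (\<lambda>N. \<Sum>u\<in>{0..int N}. dtm \<epsilon> m \<alpha> fs u x)"
      and 2: "convergent (\<lambda>N. \<Sum>u\<in>{0..int N}. dtm \<epsilon> m \<alpha> ?fb u x)"
    have "convergent (\<lambda>N. (\<Sum>u\<in>{- int N..int N}. dtm \<epsilon> m \<alpha> ?fb u x) - b x * (\<Sum>u\<in>{- int N..int N}. dtm \<epsilon> m \<alpha> fs u x))"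
      by (intro convergent_diff convergent_mult convergent_const two_sided_convergent large large_b 1 2)
    then show "convergent (\<lambda>N. comm_trunc b i \<epsilon> m \<alpha> N fs x)"
      unfolding comm_trunc_eq[where fs = fs and i = i and b = b, OF U loc locb] by (simp add: sum_subtractf sum_distrib_left)
  qed
qed

text \<open>Convergence is restated as the Cauchy condition, a countable combination of measurable
  conditions.\<close>

lemma op_limit_measurable:
  assumes "\<And>N. S N fs \<in> borel_measurable borel"
  shows "op_limit S fs \<in> borel_measurable borel"
proof -
  have [measurable]: "\<And>N. S N fs \<in> borel_measurable borel" by fact
  have "op_limit S fs = (\<lambda>x. if Cauchy (\<lambda>N. S N fs x) then lim (\<lambda>N. S N fs x) else 0)"
    unfolding op_limit_def Cauchy_convergent_iff ..
  moreover have "(\<lambda>x. if Cauchy (\<lambda>N. S N fs x) then lim (\<lambda>N. S N fs x) else 0) \<in> borel_measurable borel"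
    by measurable
  ultimately show ?thesis by simp
qed

text \<open>No dyadic interval contains a neighbourhood of 0, so a single growing interval never
  exhausts the line; the two intervals of length \<open>2^N\<close> adjacent to 0 do.\<close>

lemma eventually_central_dint:
  "\<forall>\<^sub>F N in sequentially. x \<in> dint (- int N) (-1) \<union> dint (- int N) 0"
proof -
  obtain N0 :: nat where N0: "\<bar>x\<bar> < 2 ^ N0" using real_arch_pow[of 2 "\<bar>x\<bar>"] by auto
  have "x \<in> dint (- int N) (-1) \<union> dint (- int N) 0" if "N \<ge> N0" for N
  proof -
    have "(2::real) ^ N0 \<le> 2 ^ N" using that by (intro power_increasing) auto
    then have "\<bar>x\<bar> < 2 powr real N" using N0 by (simp add: powr_realpow del: power_increasing_iff)
    then show ?thesis unfolding dint_def by (cases "x < 0") auto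
  qed
  then show ?thesis unfolding eventually_sequentially by blast
qed

text \<open>Fatou's lemma for functions cut off outside the two central intervals of length
  \<open>2^N\<close> and truncated at height \<open>N\<close>; at a point of convergence both cuts
  are eventually invisible. The two intervals account for the factor
  \<open>2 powr (1 / r)\<close>.\<close>

lemma Lr_bound_of_local_bounds:
  assumes meas: "\<And>N. S N fs \<in> borel_measurable borel" and conv: "AE x in lborel. convergent (\<lambda>N. S N fs x)"
    and r: "1 < r" and Y: "0 \<le> Y"
    and le: "\<And>N k. dI (\<lambda>x. min \<bar>S N fs x\<bar> (real N) powr r) (- int N) k \<le> Y powr r"
  shows "Lp_mem r (op_limit S fs)" "Lp_norm r (op_limit S fs) \<le> 2 powr (1 / r) * Y"
proof -
  have [measurable]: "\<And>N. S N fs \<in> borel_measurable borel" by fact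
  have lim_meas [measurable]: "op_limit S fs \<in> borel_measurable borel" by (rule op_limit_measurable) (rule meas)
  define G where "G N x = min \<bar>S N fs x\<bar> (real N) powr r" for N x
  have [measurable]: "G N \<in> borel_measurable borel" for N unfolding G_def by measurable
  have G0: "0 \<le> G N x" for N x unfolding G_def by simp
  have Gloc: "dloc (G N)" for N
  proof -
    have "\<bar>G N x\<bar> \<le> real N powr r" for x unfolding G_def using r by (simp add: powr_mono2)
    from dloc_mult_bounded[OF dloc_const[of 1] _ this] show ?thesis by simp
  qed
  define h where "h N x = indicat_real (dint (- int N) (-1)) x *\<^sub>R G N x + indicat_real (dint (- int N) 0) x *\<^sub>R G N x" for N x
  have h_int: "(\<integral>\<^sup>+x. ennreal (h N x) \<partial>lborel) \<le> ennreal (2 * Y powr r)" for N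
  proof -
    have int: "integrable lborel (\<lambda>x. indicat_real (dint (- int N) k) x *\<^sub>R G N x)" for k
      using dloc_integrable[OF Gloc] unfolding set_integrable_def .
    have "(LINT x|lborel. indicat_real (dint (- int N) k) x *\<^sub>R G N x) \<le> Y powr r" for k
      using le[of N k] unfolding dI_def set_lebesgue_integral_def G_def .
    from add_mono[OF this[of "-1"] this[of 0]] have "(LINT x|lborel. h N x) \<le> 2 * Y powr r"
      unfolding h_def by (subst Bochner_Integration.integral_add[OF int int]) simp
    moreover have "(\<integral>\<^sup>+x. ennreal (h N x) \<partial>lborel) = ennreal (LINT x|lborel. h N x)"
      unfolding h_def using int by (intro nn_integral_eq_integral Bochner_Integration.integrable_add) (auto simp: G0)
    ultimately show ?thesis by (simp add: ennreal_leI)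
  qed
  have lim: "AE x in lborel. ennreal (\<bar>op_limit S fs x\<bar> powr r) \<le> liminf (\<lambda>N. ennreal (h N x))"
    using conv
  proof eventually_elim
    fix x assume c: "convergent (\<lambda>N. S N fs x)"
    then have "(\<lambda>N. S N fs x) \<longlonglongrightarrow> op_limit S fs x" unfolding op_limit_def by (simp add: convergent_LIMSEQ_iff)
    then have l1: "(\<lambda>N. \<bar>S N fs x\<bar>) \<longlonglongrightarrow> \<bar>op_limit S fs x\<bar>" by (rule tendsto_rabs)
    have "\<forall>\<^sub>F N in sequentially. \<bar>S N fs x\<bar> < \<bar>op_limit S fs x\<bar> + 1"
      using l1 by (rule order_tendstoD(2)) simp
    moreover have "\<forall>\<^sub>F N in sequentially. \<bar>op_limit S fs x\<bar> + 1 \<le> real N"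
      by (rule eventually_sequentiallyI[of "nat \<lceil>\<bar>op_limit S fs x\<bar> + 1\<rceil>"]) linarith
    moreover note eventually_central_dint[of x]
    ultimately have ev: "\<forall>\<^sub>F N in sequentially. \<bar>S N fs x\<bar> powr r = h N x"
    proof eventually_elim
      case (elim N)
      then have "G N x = \<bar>S N fs x\<bar> powr r" unfolding G_def by (simp add: min_def)
      then show ?case using elim(3) unfolding h_def by (auto simp: indicator_def mem_dint)
    qed
    have "(\<lambda>N. \<bar>S N fs x\<bar> powr r) \<longlonglongrightarrow> \<bar>op_limit S fs x\<bar> powr r"
      using r by (intro tendsto_powr' l1 tendsto_const) auto
    then have "(\<lambda>N. h N x) \<longlonglongrightarrow> \<bar>op_limit S fs x\<bar> powr r" using ev by (rule Lim_transform_eventually)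
    then have "(\<lambda>N. ennreal (h N x)) \<longlonglongrightarrow> ennreal (\<bar>op_limit S fs x\<bar> powr r)" by (rule tendsto_ennrealI)
    then show "ennreal (\<bar>op_limit S fs x\<bar> powr r) \<le> liminf (\<lambda>N. ennreal (h N x))"
      by (simp add: lim_imp_Liminf)
  qed
  have [measurable]: "h N \<in> borel_measurable borel" for N unfolding h_def by measurable
  have "(\<integral>\<^sup>+x. ennreal (\<bar>op_limit S fs x\<bar> powr r) \<partial>lborel) \<le> (\<integral>\<^sup>+x. liminf (\<lambda>N. ennreal (h N x)) \<partial>lborel)"
    by (rule nn_integral_mono_AE[OF lim])
  also have "\<dots> \<le> liminf (\<lambda>N. \<integral>\<^sup>+x. ennreal (h N x) \<partial>lborel)"
    by (rule nn_integral_liminf) measurable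
  also have "\<dots> \<le> limsup (\<lambda>N. \<integral>\<^sup>+x. ennreal (h N x) \<partial>lborel)"
    by (rule Liminf_le_Limsup) simp
  also have "\<dots> \<le> ennreal (2 * Y powr r)"
    by (rule Limsup_bounded) (simp add: h_int)
  finally have bd: "(\<integral>\<^sup>+x. ennreal (\<bar>op_limit S fs x\<bar> powr r) \<partial>lborel) \<le> ennreal (2 * Y powr r)" .
  have int: "integrable lborel (\<lambda>x. \<bar>op_limit S fs x\<bar> powr r)"
  proof (rule integrableI_bounded)
    show "(\<integral>\<^sup>+x. ennreal (norm (\<bar>op_limit S fs x\<bar> powr r)) \<partial>lborel) < \<infinity>"
      using bd by (simp add: le_less_trans[OF _ ennreal_less_top])
  qed simp
  then show "Lp_mem r (op_limit S fs)" unfolding Lp_mem_def by simp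
  have "ennreal (LINT x|lborel. \<bar>op_limit S fs x\<bar> powr r) \<le> ennreal (2 * Y powr r)"
    using bd nn_integral_eq_integral[OF int] by simp
  then have "(LINT x|lborel. \<bar>op_limit S fs x\<bar> powr r) \<le> 2 * Y powr r" by (subst (asm) ennreal_le_iff) auto
  then have "Lp_norm r (op_limit S fs) \<le> (2 * Y powr r) powr (1 / r)"
    unfolding Lp_norm_def using r by (intro powr_mono2) (auto simp: integral_nonneg_AE)
  also have "\<dots> = 2 powr (1 / r) * Y" using r Y by (simp add: powr_mult powr_powr)
  finally show "Lp_norm r (op_limit S fs) \<le> 2 powr (1 / r) * Y" .
qed

lemma bounded_multi_of_BMO_d:
  assumes U: "U_set m \<alpha>" and i: "i \<in> {1..m}" and p: "\<forall>j\<in>{1..m}. 1 < p j"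
    and r: "1 < r" "(\<Sum>j=1..m. 1 / p j) = 1 / r" and bq: "1 < q" "Lp_mem q b"
    and bmo: "BMO_d b" and eps: "bounded_seq \<epsilon>"
  shows "bounded_multi m p r (comm_trunc b i \<epsilon> m \<alpha>)"
proof -
  obtain M0 where *: "\<And>n k. \<bar>\<epsilon> n k\<bar> \<le> M0" using eps unfolding bounded_seq_def by blast
  have M: "\<bar>\<epsilon> n k\<bar> \<le> \<bar>M0\<bar> + 1" for n k using *[of n k] by linarith
  have M0: "0 < \<bar>M0\<bar> + 1" by simp
  have b: "dloc b" by (rule BMO_d_dloc[OF bmo])
  obtain C where C: "0 < C" "\<And>n k. davg (\<lambda>x. \<bar>b x - davg b n k\<bar>) n k \<le> C" using BMO_d_bound[OF bmo] by blast
  obtain K where K: "0 \<le> K" and bound: "\<And>fs n d k L. \<forall>j\<in>{1..m}. Lp_mem (p j) (fs j) \<Longrightarrow> 0 \<le> L \<Longrightarrow>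
     dI (\<lambda>x. min \<bar>\<Sum>u\<in>{n..<n + int d + 1}. (dtm \<epsilon> m \<alpha> (fs(i := \<lambda>x. b x * fs i x)) u x - b x * dtm \<epsilon> m \<alpha> fs u x)\<bar> L powr r) n k
     \<le> (K * (\<Prod>j=1..m. Lp_norm (p j) (fs j))) powr r"
    using commutator_truncated_Lr[where \<epsilon> = \<epsilon> and b = b, OF U i M M0 b C p r] by blast
  show ?thesis unfolding bounded_multi_def
  proof (intro exI[of _ "2 powr (1 / r) * K"] allI impI)
    fix fs assume fs: "\<forall>j\<in>{1..m}. Lp_mem (p j) (fs j)"
    let ?S = "comm_trunc b i \<epsilon> m \<alpha>"
    have loc: "\<forall>j\<in>{1..m}. dloc (fs j)" using fs p by (auto intro: Lp_mem_dloc less_imp_le)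
    have pi: "1 < p i" "Lp_mem (p i) (fs i)" using p fs i by auto
    define s where "s = (1 + p i) / 2"
    have s: "1 < s" "s < p i" unfolding s_def using pi by auto
    have locb: "dloc (\<lambda>x. b x * fs i x)"
      using loc i pi s by (intro bmo_mult_dloc[OF b C s(1)] Lp_mem_dloc_powr[of "p i"]) auto
    have conv: "AE x in lborel. convergent (\<lambda>N. ?S N fs x)"
      by (rule comm_trunc_AE_convergent[where \<epsilon> = \<epsilon>, OF U i M M0 b C bq(2,1) p r fs loc locb])
    \<comment> \<open>The scales from \<open>-N\<close> to \<open>N\<close> are
      \<open>2 * N + 1\<close> in number, and the coarsest belongs to the interval on which the
      integral is taken.\<close>
    have eq: "?S N fs x = (\<Sum>u\<in>{- int N..<- int N + int (2 * N) + 1}. (dtm \<epsilon> m \<alpha> (fs(i := \<lambda>x. b x * fs i x)) u x - b x * dtm \<epsilon> m \<alpha> fs u x))" for N x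
    proof -
      have "{- int N..int N} = {- int N..<- int N + int (2 * N) + 1}" by auto
      then show ?thesis unfolding comm_trunc_eq[where fs = fs and i = i and b = b, OF U loc locb] by simp
    qed
    have [measurable]: "b \<in> borel_measurable borel" using dloc_measurable[OF b] .
    have meas: "?S N fs \<in> borel_measurable borel" for N
    proof -
      have "?S N fs = (\<lambda>x. \<Sum>u\<in>{- int N..<- int N + int (2 * N) + 1}. (dtm \<epsilon> m \<alpha> (fs(i := \<lambda>x. b x * fs i x)) u x - b x * dtm \<epsilon> m \<alpha> fs u x))"
        using eq by blast
      then show ?thesis by simp
    qed
    let ?Y = "K * (\<Prod>j=1..m. Lp_norm (p j) (fs j))"
    have Y: "0 \<le> ?Y" using K by (intro mult_nonneg_nonneg prod_nonneg) (auto simp: Lp_norm_nonneg)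
    have le: "dI (\<lambda>x. min \<bar>?S N fs x\<bar> (real N) powr r) (- int N) k \<le> ?Y powr r" for N k
      unfolding eq by (rule bound[OF fs]) simp
    note res = Lr_bound_of_local_bounds[where S = ?S and fs = fs, OF meas conv r(1) Y le]
    show "(AE x in lborel. convergent (\<lambda>N. ?S N fs x)) \<and> Lp_mem r (op_limit ?S fs)
      \<and> Lp_norm r (op_limit ?S fs) \<le> 2 powr (1 / r) * K * (\<Prod>j=1..m. Lp_norm (p j) (fs j))"
      using conv res by (simp add: mult.assoc)
  qed
qed

section \<open>Test functions\<close>

lemma Lp_norm_step:
  assumes m: "f \<in> borel_measurable borel" and f: "\<And>x. \<bar>f x\<bar> = c * indicat_real (dint n k) x" and c: "0 \<le> c" and p: "0 < p"
  shows "Lp_mem p f" "Lp_norm p f = c * 2 powr (- real_of_int n / p)"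
proof -
  have e: "\<bar>f x\<bar> powr p = c powr p * indicat_real (dint n k) x" for x
    unfolding f by (simp add: indicator_def)
  have "integrable lborel (\<lambda>x. c powr p * indicat_real (dint n k) x)"
    by (intro integrable_mult_right) (simp add: emeasure_dint)
  then show "Lp_mem p f" unfolding Lp_mem_def e using m by simp
  have "(LINT x|lborel. \<bar>f x\<bar> powr p) = c powr p * 2 powr (- real_of_int n)"
    unfolding e by (simp add: measure_dint)
  then show "Lp_norm p f = c * 2 powr (- real_of_int n / p)"
    unfolding Lp_norm_def using c p by (simp add: powr_mult powr_powr)
qed

text \<open>Hoelder's inequality on the interval passes from the Lr norm of the oscillation to its
  mean; the power of the length it produces cancels the one coming from the norms of the test
  functions.\<close>

lemma oscillation_bound:
  assumes b: "dloc b" and G: "Lp_mem r G" "Lp_norm r G \<le> C * (A * 2 powr (- real_of_int n / r))"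
    and eq: "AE x in lborel. \<bar>G x\<bar> = A * \<bar>indicat_real (dint n k) x * (b x - davg b n k)\<bar>" and A: "0 < A" and r: "1 < r"
  shows "davg (\<lambda>x. \<bar>b x - davg b n k\<bar>) n k \<le> C"
proof -
  define v where "v x = indicat_real (dint n k) x * (b x - davg b n k)" for x
  have [measurable]: "b \<in> borel_measurable borel" using dloc_measurable[OF b] .
  have [measurable]: "G \<in> borel_measurable borel" using G(1) unfolding Lp_mem_def by simp
  have v_meas [measurable]: "v \<in> borel_measurable borel" unfolding v_def by measurable
  have Gv: "AE x in lborel. \<bar>G x\<bar> powr r = A powr r * \<bar>v x\<bar> powr r"
    using eq by eventually_elim (use A in \<open>simp add: v_def powr_mult\<close>)
  have "integrable lborel (\<lambda>x. A powr r * \<bar>v x\<bar> powr r)"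
    using G(1) Gv unfolding Lp_mem_def by (subst (asm) integrable_cong_AE[where g = "\<lambda>x. A powr r * \<bar>v x\<bar> powr r"]) auto
  then have v: "Lp_mem r v" unfolding Lp_mem_def using A by simp
  have "(LINT x|lborel. \<bar>G x\<bar> powr r) = A powr r * (LINT x|lborel. \<bar>v x\<bar> powr r)"
    by (subst integral_cong_AE[OF _ _ Gv]) auto
  then have "Lp_norm r G = A * Lp_norm r v"
    unfolding Lp_norm_def using A r by (simp add: powr_mult powr_powr integral_nonneg_AE)
  then have nv: "Lp_norm r v \<le> C * 2 powr (- real_of_int n / r)" using G(2) A by simp
  obtain x where x: "x \<in> dint n k" using dint_nonempty by blast
  have "davg (\<lambda>x. \<bar>b x - davg b n k\<bar>) n k = dE (\<lambda>x. \<bar>v x\<bar>) n x"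
    unfolding dE_eq[OF x] by (rule davg_cong) (simp add: v_def)
  also have "\<dots> \<le> 2 powr (real_of_int n / r) * Lp_norm r v" by (rule dE_decay[OF v r])
  also have "\<dots> \<le> 2 powr (real_of_int n / r) * (C * 2 powr (- real_of_int n / r))"
    by (intro mult_left_mono nv) simp
  also have "\<dots> = C" by (simp add: powr_minus)
  finally show ?thesis .
qed

lemma haar_abs: "\<bar>haar n k x\<bar> = 2 powr (real_of_int n / 2) * indicat_real (dint n k) x"
  using haar_eq[of x n k] haar_eq_0[of x n k] by (cases "x \<in> dint n k") auto

lemma haar_measurable [measurable]: "haar n k \<in> borel_measurable borel"
  unfolding haar_def by measurable

lemma haar_cong:
  assumes "didx (n + 1) x = didx (n + 1) y" shows "haar n k x = haar n k y"
  using assms unfolding haar_def by (simp add: indicator_def mem_dint)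

lemma dloc_haar: "dloc (haar n k)"
  by (rule dloc_invariant[OF haar_cong])

text \<open>Mean zero kills every average at levels up to \<open>n\<close>; from level
  \<open>n + 1\<close> on the Haar function is constant on the intervals.\<close>

lemma dE_haar: "dE (haar n k) v x = (if n < v then haar n k x else 0)"
proof (cases "n < v")
  case True
  have "dE (haar n k) v x = haar n k x"
  proof (rule dE_didx_invariant)
    fix x y assume "didx v x = didx v y"
    then have "didx (n + 1) x = didx (n + 1) y" by (rule didx_coarse) (use True in simp)
    then show "haar n k x = haar n k y" by (rule haar_cong)
  qed
  then show ?thesis using True by simp
next
  case False
  have z: "dI (haar n k) n j = dI (\<lambda>_. 0) n j" for j
  proof (cases "j = k")
    case True
    have c: "dI (haar n k) (n + 1) (2 * k + 1) = dI (\<lambda>_. 2 powr (real_of_int n / 2)) (n + 1) (2 * k + 1)"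
      "dI (haar n k) (n + 1) (2 * k) = dI (\<lambda>_. - (2 powr (real_of_int n / 2))) (n + 1) (2 * k)"
      by (intro dI_cong; simp add: haar_def indicator_def mem_dint)+
    show ?thesis unfolding True dI_split[OF dloc_haar, of n k n k] c dI_const by simp
  next
    case False
    then show ?thesis by (intro dI_cong) (auto simp: mem_dint intro!: haar_eq_0)
  qed
  have "dI (haar n k) v j = dI (\<lambda>_. 0) v j" for j
    by (rule dI_eq_levels[OF dloc_haar dloc_const, of v n]) (use False z in auto)
  then have "dE (haar n k) v x = 0" unfolding dE_def davg_dI by (simp add: dI_const)
  then show ?thesis using False by simp
qed

lemma dfac_haar: "dfac 0 (haar n k) u x = (if u = n then haar n k x else 0)"
  unfolding dfac_def dE_haar by auto

lemma dE_dint_mult: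
  assumes "n \<le> v" shows "dE (\<lambda>x. b x * indicat_real (dint n k) x) v x = indicat_real (dint n k) x * dE b v x"
proof -
  have m: "x \<in> dint v (didx v x)" by (simp add: mem_dint)
  show ?thesis
  proof (cases "x \<in> dint n k")
    case True
    then have "dint v (didx v x) \<subseteq> dint n k" using dint_nested[OF m True assms] by simp
    then have "dE (\<lambda>x. b x * indicat_real (dint n k) x) v x = dE b v x"
      unfolding dE_def by (intro davg_cong) auto
    then show ?thesis using True by simp
  next
    case False
    have "y \<notin> dint n k" if y: "y \<in> dint v (didx v x)" for y
    proof
      assume "y \<in> dint n k"
      then have "dint v (didx v x) \<subseteq> dint n k" using dint_nested[OF y _ assms] by simp
      then show False using m False by auto
    qed
    then have "dE (\<lambda>x. b x * indicat_real (dint n k) x) v x = davg (\<lambda>_. 0) v (didx v x)"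
      unfolding dE_def by (intro davg_cong) auto
    then show ?thesis using False by simp
  qed
qed

lemma dE_const [simp]: "dE (\<lambda>_. c) v x = c"
  by (simp add: dE_def)

lemma dE_dint: "n \<le> v \<Longrightarrow> dE (indicat_real (dint n k)) v x = indicat_real (dint n k) x"
  using dE_dint_mult[of n v "\<lambda>_. 1" k x] by simp

lemma dtm_zero: "j \<in> {1..m} \<Longrightarrow> dfac (\<alpha> j) (fs j) u x = 0 \<Longrightarrow> dtm \<epsilon> m \<alpha> fs u x = 0"
  unfolding dtm_def using prod_zero[of "{1..m}" "\<lambda>j. dfac (\<alpha> j) (fs j) u x"] by auto

text \<open>The squared Haar function is the indicator divided by the length, so the Haar
  coefficient of the product is the mean of \<open>b\<close>.\<close>

lemma dfac_haar_mult:
  assumes b: "dloc b" and x: "x \<in> dint n k"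
  shows "dfac 0 (\<lambda>x. b x * haar n k x) n x = davg b n k * haar n k x"
proof -
  have bh: "dloc (\<lambda>x. b x * haar n k x)"
    by (rule dloc_mult_bounded[OF b haar_measurable, of _ _ "2 powr (real_of_int n / 2)"]) (simp add: haar_abs indicator_def)
  have sq: "haar n k y * haar n k y = 2 powr real_of_int n * indicat_real (dint n k) y" for y
  proof -
    have "haar n k y * haar n k y = \<bar>haar n k y\<bar> * \<bar>haar n k y\<bar>" by simp
    also have "\<dots> = (2 powr (real_of_int n / 2) * 2 powr (real_of_int n / 2)) * indicat_real (dint n k) y"
      unfolding haar_abs by (simp add: indicator_def)
    also have "2 powr (real_of_int n / 2) * 2 powr (real_of_int n / 2) = 2 powr real_of_int n" by (simp flip: powr_add)
    finally show ?thesis .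
  qed
  have "dcoef (\<lambda>x. b x * haar n k x) n k 0 = (LINT y|lborel. 2 powr real_of_int n * (indicat_real (dint n k) y *\<^sub>R b y))"
  proof -
    have q: "(b y * haar n k y) * haar n k y = 2 powr real_of_int n * (indicat_real (dint n k) y *\<^sub>R b y)" for y
      using sq[of y] by (simp add: mult.assoc)
    show ?thesis by (simp only: dcoef_def q refl if_True)
  qed
  also have "\<dots> = davg b n k" unfolding davg_def set_lebesgue_integral_def by simp
  finally show ?thesis using dcoef_0_haar[OF bh x] unfolding dfac_def by simp
qed

text \<open>Slot \<open>j0\<close> holds the Haar function of the interval \<open>I\<close> in both
  terms of the commutator, hence no other interval survives. Slot \<open>i\<close> yields the mean
  of \<open>b\<close> over \<open>I\<close>, whether it is cancellative or not. \<open>A\<close> is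
  \<open>|I|\<close> to minus half the number of zeros of \<open>\<alpha>\<close>.\<close>

lemma commutator_test_cancel:
  assumes U: "U_set m \<alpha>" and i: "i \<in> {1..m}" and p: "\<forall>j\<in>{1..m}. 1 < p j" and r: "(\<Sum>j=1..m. 1 / p j) = 1 / r"
    and b: "dloc b" and j0: "j0 \<in> {1..m}" "j0 \<noteq> i" "\<alpha> j0 = 0"
  obtains fs A where "\<forall>j\<in>{1..m}. Lp_mem (p j) (fs j)" "0 < A" "(\<Prod>j=1..m. Lp_norm (p j) (fs j)) = A * 2 powr (- real_of_int n / r)"
    "\<And>N x. nat \<bar>n\<bar> \<le> N \<Longrightarrow> \<bar>comm_trunc b i (\<lambda>_ _. 1) m \<alpha> N fs x\<bar> = A * \<bar>indicat_real (dint n k) x * (b x - davg b n k)\<bar>"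
proof -
  define fs where "fs j = (if \<alpha> j = 0 then haar n k else indicat_real (dint n k))" for j :: nat
  define a where "a j = (if \<alpha> j = 0 then 2 powr (real_of_int n / 2) else 1)" for j
  define A where "A = (\<Prod>j=1..m. a j)"
  have a: "0 < a j" for j unfolding a_def by simp
  have fs_meas: "fs j \<in> borel_measurable borel" for j unfolding fs_def by simp
  have fs_abs: "\<bar>fs j x\<bar> = a j * indicat_real (dint n k) x" for j x
    unfolding fs_def a_def by (simp add: haar_abs)
  have mem: "Lp_mem (p j) (fs j)" and norm: "Lp_norm (p j) (fs j) = a j * 2 powr (- real_of_int n / p j)" if "j \<in> {1..m}" for j
  proof -
    have "0 < p j" using p that by force
    then show "Lp_mem (p j) (fs j)" "Lp_norm (p j) (fs j) = a j * 2 powr (- real_of_int n / p j)"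
      using Lp_norm_step[OF fs_meas fs_abs less_imp_le[OF a]] by auto
  qed
  have "(\<Prod>j=1..m. Lp_norm (p j) (fs j)) = A * 2 powr (\<Sum>j=1..m. - real_of_int n / p j)"
    unfolding A_def by (simp add: norm prod.distrib powr_sum)
  also have "(\<Sum>j=1..m. - real_of_int n / p j) = - real_of_int n / r"
    using arg_cong[OF r, of "\<lambda>t. - real_of_int n * t"] by (simp add: sum_distrib_left)
  finally have nrm: "(\<Prod>j=1..m. Lp_norm (p j) (fs j)) = A * 2 powr (- real_of_int n / r)" .
  have loc: "\<forall>j\<in>{1..m}. dloc (fs j)"
  proof
    fix j assume j: "j \<in> {1..m}"
    have "1 \<le> p j" using p j by force
    then show "dloc (fs j)" by (rule Lp_mem_dloc[OF mem[OF j]])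
  qed
  have "\<bar>fs i x\<bar> \<le> a i" for x unfolding fs_abs using a[of i] by (simp add: indicator_def)
  then have locb: "dloc (\<lambda>x. b x * fs i x)" by (rule dloc_mult_bounded[OF b fs_meas])
  let ?fb = "fs(i := \<lambda>x. b x * fs i x)"
  have z: "dtm (\<lambda>_ _. 1) m \<alpha> fs u x = 0" "dtm (\<lambda>_ _. 1) m \<alpha> ?fb u x = 0" if "u \<noteq> n \<or> x \<notin> dint n k" for u x
  proof -
    have 0: "dfac (\<alpha> j0) (fs j0) u x = 0" using that j0 haar_eq_0[of x n k] by (auto simp: fs_def dfac_haar)
    then have "dfac (\<alpha> j0) (?fb j0) u x = 0" using j0 by simp
    then show "dtm (\<lambda>_ _. 1) m \<alpha> fs u x = 0" "dtm (\<lambda>_ _. 1) m \<alpha> ?fb u x = 0"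
      using dtm_zero[where \<alpha> = \<alpha>, OF j0(1)] 0 by blast+
  qed
  have fac: "dfac (\<alpha> j) (fs j) n x = fs j x" for j x
    unfolding fs_def using dfac_haar[of n k n x] dE_dint[of n n k x] by (simp add: dfac_def)
  have faci: "dfac (\<alpha> i) (\<lambda>x. b x * fs i x) n x = davg b n k * fs i x" if x: "x \<in> dint n k" for x
  proof (cases "\<alpha> i = 0")
    case True
    then show ?thesis using dfac_haar_mult[OF b x] by (simp add: fs_def)
  next
    case False
    then show ?thesis using dE_dint_mult[of n n b k x] x by (simp add: fs_def dfac_def dE_eq)
  qed
  have t1: "dtm (\<lambda>_ _. 1) m \<alpha> fs n x = (\<Prod>j=1..m. fs j x)" for x unfolding dtm_def fac by simp
  have t2: "dtm (\<lambda>_ _. 1) m \<alpha> ?fb n x = davg b n k * (\<Prod>j=1..m. fs j x)" if x: "x \<in> dint n k" for x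
  proof -
    have "(\<Prod>j=1..m. dfac (\<alpha> j) (?fb j) n x) = dfac (\<alpha> i) (\<lambda>x. b x * fs i x) n x * (\<Prod>j\<in>{1..m}-{i}. dfac (\<alpha> j) (fs j) n x)"
      using prod.remove[of "{1..m}" i "\<lambda>j. dfac (\<alpha> j) (?fb j) n x"] i by simp
    also have "\<dots> = davg b n k * (fs i x * (\<Prod>j\<in>{1..m}-{i}. fs j x))" unfolding faci[OF x] fac by simp
    also have "fs i x * (\<Prod>j\<in>{1..m}-{i}. fs j x) = (\<Prod>j=1..m. fs j x)"
      using prod.remove[of "{1..m}" i "\<lambda>j. fs j x"] i by simp
    finally show ?thesis unfolding dtm_def by simp
  qed
  have "\<bar>comm_trunc b i (\<lambda>_ _. 1) m \<alpha> N fs x\<bar> = A * \<bar>indicat_real (dint n k) x * (b x - davg b n k)\<bar>" if N: "nat \<bar>n\<bar> \<le> N" for N x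
  proof -
    have n: "n \<in> {- int N..int N}" using N by auto
    have "comm_trunc b i (\<lambda>_ _. 1) m \<alpha> N fs x = (\<Sum>u\<in>{n}. (dtm (\<lambda>_ _. 1) m \<alpha> ?fb u x - b x * dtm (\<lambda>_ _. 1) m \<alpha> fs u x))"
      unfolding comm_trunc_eq[where fs = fs and i = i and b = b, OF U loc locb]
      using n z by (intro sum.mono_neutral_right) auto
    also have "\<dots> = indicat_real (dint n k) x * ((davg b n k - b x) * (\<Prod>j=1..m. fs j x))"
      using z[of n x] t1[of x] t2[of x] by (cases "x \<in> dint n k") (auto simp: algebra_simps)
    finally have e: "\<bar>comm_trunc b i (\<lambda>_ _. 1) m \<alpha> N fs x\<bar> = indicat_real (dint n k) x * (\<bar>b x - davg b n k\<bar> * (\<Prod>j=1..m. \<bar>fs j x\<bar>))"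
      by (simp add: abs_mult abs_prod abs_minus_commute)
    show ?thesis unfolding e fs_abs A_def by (cases "x \<in> dint n k") (auto simp: abs_mult)
  qed
  moreover have "0 < A" unfolding A_def using a by (intro prod_pos) simp
  moreover have "\<forall>j\<in>{1..m}. Lp_mem (p j) (fs j)" using mem by blast
  ultimately show ?thesis using that[of fs A] nrm by blast
qed

text \<open>Mean convergence gives almost everywhere convergence along a subsequence. This suffices
  in place of the differentiation theorem: the commutators are assumed to converge almost
  everywhere, so their limit can be identified along a subsequence.\<close>

lemma dE_subseq_AE:
  assumes b: "dloc b"
  obtains \<rho> :: "nat \<Rightarrow> nat" where "strict_mono \<rho>" "AE x in lborel. x \<in> dint n k \<longrightarrow> (\<lambda>l. dE b (n + int (\<rho> l)) x) \<longlonglongrightarrow> b x"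
proof -
  define u where "u L x = indicat_real (dint n k) x *\<^sub>R (b x - dE b (n + int L) x)" for L x
  have int: "integrable lborel (u L)" for L
    unfolding u_def using dloc_integrable[OF dloc_diff[OF b dloc_dE]] unfolding set_integrable_def .
  have "(LINT x|lborel. norm (u L x)) = dI (\<lambda>x. \<bar>b x - dE b (n + int L) x\<bar>) n k" for L
    unfolding dI_def set_lebesgue_integral_def u_def
    by (intro Bochner_Integration.integral_cong) (auto simp: abs_mult)
  then have "(\<lambda>L. LINT x|lborel. norm (u L x)) \<longlonglongrightarrow> 0" using dE_L1_tendsto[OF b, of n k] by simp
  then obtain \<rho> :: "nat \<Rightarrow> nat" where \<rho>: "strict_mono \<rho>" "AE x in lborel. (\<lambda>l. u (\<rho> l) x) \<longlonglongrightarrow> 0"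
    using tendsto_L1_AE_subseq[of lborel u, OF int] by blast
  have "AE x in lborel. x \<in> dint n k \<longrightarrow> (\<lambda>l. dE b (n + int (\<rho> l)) x) \<longlonglongrightarrow> b x"
    using \<rho>(2)
  proof eventually_elim
    fix x assume l: "(\<lambda>l. u (\<rho> l) x) \<longlonglongrightarrow> 0"
    show "x \<in> dint n k \<longrightarrow> (\<lambda>l. dE b (n + int (\<rho> l)) x) \<longlonglongrightarrow> b x"
    proof
      assume x: "x \<in> dint n k"
      have "(\<lambda>l. b x - u (\<rho> l) x) \<longlonglongrightarrow> b x - 0" by (intro tendsto_diff tendsto_const l)
      then show "(\<lambda>l. dE b (n + int (\<rho> l)) x) \<longlonglongrightarrow> b x" using x by (simp add: u_def)
    qed
  qed
  then show ?thesis using that \<rho>(1) by blast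
qed

lemma sum_telescope_int:
  fixes g :: "int \<Rightarrow> real"
  assumes "n \<le> N" shows "(\<Sum>u\<in>{n..<N}. (g (u + 1) - g u)) = g N - g n"
  using assms
proof (induction N rule: int_ge_induct)
  case base then show ?case by simp
next
  case (step N)
  have "{n..<N + 1} = insert N {n..<N}" using step by auto
  then show ?case using step by simp
qed

text \<open>No slot besides \<open>i\<close> cancels, so no single scale can be isolated. The
  indicator of \<open>J\<close> has no differences at scales from \<open>n\<close> on, and the Haar
  function of the parent has zero averages at all coarser scales: \<open>T\<close> of the test
  functions is 0 and only the term with \<open>b\<close> inside remains. The parent is twice as long
  as \<open>J\<close>, whence \<open>2 powr (1 / p j0)\<close>.\<close>

lemma commutator_test_telescope:
  assumes U: "U_set m \<alpha>" and i: "i \<in> {1..m}" and p: "\<forall>j\<in>{1..m}. 1 < p j" and r: "(\<Sum>j=1..m. 1 / p j) = 1 / r"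
    and b: "dloc b" and j0: "j0 \<in> {1..m}" "j0 \<noteq> i" and \<alpha>: "\<alpha> i = 0" "\<And>j. j \<in> {1..m} \<Longrightarrow> j \<noteq> i \<Longrightarrow> \<alpha> j \<noteq> 0"
  obtains fs A where "\<forall>j\<in>{1..m}. Lp_mem (p j) (fs j)" "0 < A"
    "(\<Prod>j=1..m. Lp_norm (p j) (fs j)) = 2 powr (1 / p j0) * (A * 2 powr (- real_of_int n / r))"
    "\<And>N x. nat \<bar>n\<bar> \<le> N \<Longrightarrow> \<bar>comm_trunc b i (\<lambda>_ _. 1) m \<alpha> N fs x\<bar> = A * \<bar>indicat_real (dint n k) x * (dE b (int N + 1) x - davg b n k)\<bar>"
proof -
  define h where "h = haar (n - 1) (k div 2)"
  define fs where "fs j = (if j = j0 then h else indicat_real (dint n k))" for j :: nat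
  define A where "A = 2 powr (real_of_int (n - 1) / 2)"
  have A: "0 < A" unfolding A_def by simp
  have sub: "x \<in> dint (n - 1) (k div 2)" if "x \<in> dint n k" for x
    using that didx_parent[of "n - 1" x] by (simp add: mem_dint)
  have h_abs: "\<bar>h x\<bar> = A * indicat_real (dint (n - 1) (k div 2)) x" for x
    unfolding h_def A_def by (rule haar_abs)
  have hm: "h \<in> borel_measurable borel" unfolding h_def by simp
  have fs_meas: "fs j \<in> borel_measurable borel" for j unfolding fs_def using hm by simp
  have pp: "0 < p j" if "j \<in> {1..m}" for j using p that by force
  have memh: "Lp_mem (p j0) (fs j0)" and normh: "Lp_norm (p j0) (fs j0) = A * 2 powr (1 / p j0) * 2 powr (- real_of_int n / p j0)"
  proof -
    have e: "2 powr (- real_of_int (n - 1) / p j0) = 2 powr (1 / p j0) * 2 powr (- real_of_int n / p j0)"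
      unfolding powr_add[symmetric] by (simp add: diff_divide_distrib)
    have "fs j0 = h" unfolding fs_def by simp
    then show "Lp_mem (p j0) (fs j0)" "Lp_norm (p j0) (fs j0) = A * 2 powr (1 / p j0) * 2 powr (- real_of_int n / p j0)"
      using Lp_norm_step[OF hm h_abs less_imp_le[OF A] pp[OF j0(1)]] unfolding e by (simp_all only: mult.assoc)
  qed
  have mem1: "Lp_mem (p j) (fs j)" and norm1: "Lp_norm (p j) (fs j) = 2 powr (- real_of_int n / p j)" if "j \<in> {1..m}" "j \<noteq> j0" for j
    using Lp_norm_step[of "indicat_real (dint n k)" 1 n k "p j"] pp[OF that(1)] that(2) unfolding fs_def by simp_all
  have mem: "\<forall>j\<in>{1..m}. Lp_mem (p j) (fs j)" using mem1 memh by metis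
  have "(\<Prod>j=1..m. Lp_norm (p j) (fs j)) = Lp_norm (p j0) (fs j0) * (\<Prod>j\<in>{1..m}-{j0}. Lp_norm (p j) (fs j))"
    using prod.remove[of "{1..m}" j0 "\<lambda>j. Lp_norm (p j) (fs j)"] j0 by simp
  also have "(\<Prod>j\<in>{1..m}-{j0}. Lp_norm (p j) (fs j)) = (\<Prod>j\<in>{1..m}-{j0}. 2 powr (- real_of_int n / p j))"
    by (intro prod.cong) (auto simp: norm1)
  also have "Lp_norm (p j0) (fs j0) * \<dots> = A * 2 powr (1 / p j0) * (\<Prod>j=1..m. 2 powr (- real_of_int n / p j))"
    unfolding normh using prod.remove[of "{1..m}" j0 "\<lambda>j. 2 powr (- real_of_int n / p j)"] j0 by simp
  also have "(\<Prod>j=1..m. 2 powr (- real_of_int n / p j)) = 2 powr (\<Sum>j=1..m. - real_of_int n / p j)"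
    by (simp add: powr_sum)
  also have "(\<Sum>j=1..m. - real_of_int n / p j) = - real_of_int n / r"
    using arg_cong[OF r, of "\<lambda>t. - real_of_int n * t"] by (simp add: sum_distrib_left)
  finally have nrm: "(\<Prod>j=1..m. Lp_norm (p j) (fs j)) = 2 powr (1 / p j0) * (A * 2 powr (- real_of_int n / r))" by simp
  have loc: "\<forall>j\<in>{1..m}. dloc (fs j)"
  proof
    fix j assume j: "j \<in> {1..m}"
    have "1 \<le> p j" using p j by force
    then show "dloc (fs j)" using Lp_mem_dloc mem j by blast
  qed
  have fsi: "fs i = indicat_real (dint n k)" using j0 unfolding fs_def by simp
  have locb: "dloc (\<lambda>x. b x * fs i x)"
    by (rule dloc_mult_bounded[OF b fs_meas, of i 1]) (simp add: fsi indicator_def)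
  let ?fb = "fs(i := \<lambda>x. b x * fs i x)"
  have hz: "dfac (\<alpha> j0) h u x = (if n \<le> u then h x else 0)" for u x
    using \<alpha>(2)[OF j0] unfolding dfac_def h_def dE_haar by auto
  have t1: "dtm (\<lambda>_ _. 1) m \<alpha> fs u x = 0" for u x
  proof (cases "n \<le> u")
    case True
    have "dfac (\<alpha> i) (fs i) u x = 0" unfolding fsi using \<alpha>(1) True by (simp add: dfac_def dE_dint)
    then show ?thesis by (rule dtm_zero[where \<alpha> = \<alpha>, OF i])
  next
    case False
    then have "dfac (\<alpha> j0) (fs j0) u x = 0" unfolding fs_def using hz by simp
    then show ?thesis by (rule dtm_zero[where \<alpha> = \<alpha>, OF j0(1)])
  qed
  \<comment> \<open>From scale \<open>n\<close> on, all slots but \<open>i\<close> are independent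
    of the scale; \<open>Q\<close> is their common product.\<close>
  define Q where "Q x = h x * (\<Prod>j\<in>{1..m}-{i}-{j0}. indicat_real (dint n k) x)" for x
  have t2: "dtm (\<lambda>_ _. 1) m \<alpha> ?fb u x = (if n \<le> u then indicat_real (dint n k) x * Q x * (dE b (u + 1) x - dE b u x) else 0)" for u x
  proof (cases "n \<le> u")
    case True
    have "(\<Prod>j=1..m. dfac (\<alpha> j) (?fb j) u x)
      = dfac (\<alpha> i) (?fb i) u x * (dfac (\<alpha> j0) (?fb j0) u x * (\<Prod>j\<in>{1..m}-{i}-{j0}. dfac (\<alpha> j) (?fb j) u x))"
      using prod.remove[of "{1..m}" i "\<lambda>j. dfac (\<alpha> j) (?fb j) u x"]
        prod.remove[of "{1..m} - {i}" j0 "\<lambda>j. dfac (\<alpha> j) (?fb j) u x"] i j0 by simp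
    also have "dfac (\<alpha> i) (?fb i) u x = indicat_real (dint n k) x * (dE b (u + 1) x - dE b u x)"
      using \<alpha>(1) True dE_dint_mult[of n u b k x] dE_dint_mult[of n "u+1" b k x] by (simp add: fsi dfac_def algebra_simps)
    also have "dfac (\<alpha> j0) (?fb j0) u x = h x" using j0 hz[of u x] True by (simp add: fs_def)
    also have "(\<Prod>j\<in>{1..m}-{i}-{j0}. dfac (\<alpha> j) (?fb j) u x) = (\<Prod>j\<in>{1..m}-{i}-{j0}. indicat_real (dint n k) x)"
    proof (rule prod.cong[OF refl])
      fix j assume j: "j \<in> {1..m}-{i}-{j0}"
      then have "\<alpha> j \<noteq> 0" using \<alpha>(2)[of j] by auto
      then show "dfac (\<alpha> j) (?fb j) u x = indicat_real (dint n k) x"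
        using j True dE_dint[of n u k x] by (simp add: fs_def dfac_def)
    qed
    finally show ?thesis using True unfolding dtm_def Q_def by (simp add: mult_ac)
  next
    case False
    then have "dfac (\<alpha> j0) (?fb j0) u x = 0" using hz j0 by (simp add: fs_def)
    then have "dtm (\<lambda>_ _. 1) m \<alpha> ?fb u x = 0" by (rule dtm_zero[where \<alpha> = \<alpha>, OF j0(1)])
    then show ?thesis using False by simp
  qed
  have Q: "\<bar>Q x\<bar> = A" if "x \<in> dint n k" for x
    unfolding Q_def abs_mult h_abs using sub[OF that] that by simp
  have "\<bar>comm_trunc b i (\<lambda>_ _. 1) m \<alpha> N fs x\<bar> = A * \<bar>indicat_real (dint n k) x * (dE b (int N + 1) x - davg b n k)\<bar>" if N: "nat \<bar>n\<bar> \<le> N" for N x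
  proof -
    have "comm_trunc b i (\<lambda>_ _. 1) m \<alpha> N fs x = (\<Sum>u\<in>{- int N..int N}. if n \<le> u then indicat_real (dint n k) x * Q x * (dE b (u + 1) x - dE b u x) else 0)"
      unfolding comm_trunc_eq[where fs = fs and i = i and b = b, OF U loc locb] t1 t2 by simp
    \<comment> \<open>The difference at scale \<open>N\<close> ends with the average of level
      \<open>N + 1\<close>, hence the upper end of the telescoping sum.\<close>
    also have "\<dots> = (\<Sum>u\<in>{n..<int N + 1}. indicat_real (dint n k) x * Q x * (dE b (u + 1) x - dE b u x))"
      using N by (intro sum.mono_neutral_cong_right) auto
    also have "\<dots> = indicat_real (dint n k) x * Q x * (dE b (int N + 1) x - dE b n x)"
      unfolding sum_distrib_left[symmetric] using N by (subst sum_telescope_int) auto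
    finally show ?thesis using Q[of x] by (cases "x \<in> dint n k") (auto simp: abs_mult dE_eq)
  qed
  then show ?thesis using that[of fs A] mem A nrm by blast
qed

section \<open>Necessity of bounded mean oscillation\<close>

lemma compact_integrable_of_Lp_mem:
  assumes b: "Lp_mem q b" "1 \<le> q" and K: "compact K"
  shows "set_integrable lborel K b"
proof -
  have Km: "K \<in> sets lborel" using K by (simp add: borel_compact)
  have "integrable lborel (\<lambda>x. indicat_real K x *\<^sub>R (1::real))"
    using K Km emeasure_compact_finite[of K] by simp
  moreover have "integrable lborel (\<lambda>x. indicat_real K x *\<^sub>R (\<bar>b x\<bar> powr q))"
    using b Km unfolding Lp_mem_def by (intro integrable_mult_indicator) auto
  ultimately have "set_integrable lborel K (\<lambda>x. 1 + \<bar>b x\<bar> powr q)"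
    unfolding set_integrable_def by (simp add: distrib_left)
  then show ?thesis
  proof (rule set_integrable_bound)
    show "set_borel_measurable lborel K b"
    proof -
      have [measurable]: "b \<in> borel_measurable borel" "K \<in> sets borel" using b Km unfolding Lp_mem_def by simp_all
      show ?thesis unfolding set_borel_measurable_def by measurable
    qed
    have "\<bar>b x\<bar> \<le> 1 + \<bar>b x\<bar> powr q" for x
    proof (cases "\<bar>b x\<bar> \<le> 1")
      case True then show ?thesis by (simp add: add_increasing2)
    next
      case False
      then have "\<bar>b x\<bar> powr 1 \<le> \<bar>b x\<bar> powr q" using b by (intro powr_mono) auto
      then show ?thesis using False by simp
    qed
    then show "AE x in lborel. x \<in> K \<longrightarrow> norm (b x) \<le> norm (1 + \<bar>b x\<bar> powr q)" by simp
  qed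
qed

lemma op_limit_abs:
  assumes "convergent (\<lambda>N. S N fs x)" "strict_mono \<rho>" "(\<lambda>l. \<bar>S (\<rho> l) fs x\<bar>) \<longlonglongrightarrow> c"
  shows "\<bar>op_limit S fs x\<bar> = c"
proof -
  have "(\<lambda>N. S N fs x) \<longlonglongrightarrow> op_limit S fs x" using assms(1) unfolding op_limit_def by (simp add: convergent_LIMSEQ_iff)
  from LIMSEQ_subseq_LIMSEQ[OF tendsto_rabs[OF this] assms(2)]
  have "(\<lambda>l. \<bar>S (\<rho> l) fs x\<bar>) \<longlonglongrightarrow> \<bar>op_limit S fs x\<bar>" by (simp add: o_def)
  then show ?thesis using assms(3) LIMSEQ_unique by blast
qed

lemma BMO_d_of_bounded_multi:
  assumes "m \<ge> 2" and U: "U_set m \<alpha>" and i: "i \<in> {1..m}" and p: "\<forall>j\<in>{1..m}. 1 < p j"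
    and r: "1 < r" "(\<Sum>j=1..m. 1 / p j) = 1 / r" and bq: "1 < q" "Lp_mem q b"
    and bd: "bounded_multi m p r (comm_trunc b i (\<lambda>_ _. 1) m \<alpha>)"
  shows "BMO_d b"
proof -
  let ?S = "comm_trunc b i (\<lambda>_ _. 1) m \<alpha>"
  have b: "dloc b" using Lp_mem_dloc[OF bq(2)] bq(1) by simp
  obtain C where C: "\<And>fs. \<forall>j\<in>{1..m}. Lp_mem (p j) (fs j) \<Longrightarrow> (AE x in lborel. convergent (\<lambda>N. ?S N fs x)) \<and>
      Lp_mem r (op_limit ?S fs) \<and> Lp_norm r (op_limit ?S fs) \<le> C * (\<Prod>j=1..m. Lp_norm (p j) (fs j))"
    using bd unfolding bounded_multi_def by blast
  \<comment> \<open>One constant for both kinds of test: the telescoping one loses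
    \<open>2 powr (1 / p j0)\<close>, which is at most 2.\<close>
  have "davg (\<lambda>x. \<bar>b x - davg b n k\<bar>) n k \<le> 2 * \<bar>C\<bar>" for n k
  proof (cases "\<exists>j0\<in>{1..m}. j0 \<noteq> i \<and> \<alpha> j0 = 0")
    case True
    then obtain j0 where j0: "j0 \<in> {1..m}" "j0 \<noteq> i" "\<alpha> j0 = 0" by blast
    obtain fs A where fs: "\<forall>j\<in>{1..m}. Lp_mem (p j) (fs j)" and A: "0 < A"
      and nrm: "(\<Prod>j=1..m. Lp_norm (p j) (fs j)) = A * 2 powr (- real_of_int n / r)"
      and val: "\<And>N x. nat \<bar>n\<bar> \<le> N \<Longrightarrow> \<bar>?S N fs x\<bar> = A * \<bar>indicat_real (dint n k) x * (b x - davg b n k)\<bar>"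
      using commutator_test_cancel[where n = n and k = k, OF U i p r(2) b j0] by blast
    have "AE x in lborel. \<bar>op_limit ?S fs x\<bar> = A * \<bar>indicat_real (dint n k) x * (b x - davg b n k)\<bar>"
      using C[OF fs, THEN conjunct1]
    proof eventually_elim
      fix x assume c: "convergent (\<lambda>N. ?S N fs x)"
      have "strict_mono (\<lambda>l. l + nat \<bar>n\<bar>)" by (simp add: strict_mono_def)
      then show "\<bar>op_limit ?S fs x\<bar> = A * \<bar>indicat_real (dint n k) x * (b x - davg b n k)\<bar>"
        by (rule op_limit_abs[where S = ?S, OF c]) (simp add: val)
    qed
    then have "davg (\<lambda>x. \<bar>b x - davg b n k\<bar>) n k \<le> C"
      using C[OF fs] A r(1) unfolding nrm by (intro oscillation_bound[OF b]) auto
    then show ?thesis by linarith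
  next
    case False
    have \<alpha>: "\<alpha> j \<noteq> 0" if "j \<in> {1..m}" "j \<noteq> i" for j using False that by metis
    obtain j where "j \<in> {1..m}" "\<alpha> j = 0" using U unfolding U_set_def by blast
    then have \<alpha>i: "\<alpha> i = 0" using \<alpha>[of j] by (cases "j = i") auto
    \<comment> \<open>\<open>m \<ge> 2\<close> leaves a slot besides \<open>i\<close> to carry the
      Haar function.\<close>
    define j0 where "j0 = (if i = 1 then 2 else 1 :: nat)"
    have j0: "j0 \<in> {1..m}" "j0 \<noteq> i" using assms(1) unfolding j0_def by auto
    obtain fs A where fs: "\<forall>j\<in>{1..m}. Lp_mem (p j) (fs j)" and A: "0 < A"
      and nrm: "(\<Prod>j=1..m. Lp_norm (p j) (fs j)) = 2 powr (1 / p j0) * (A * 2 powr (- real_of_int n / r))"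
      and val: "\<And>N x. nat \<bar>n\<bar> \<le> N \<Longrightarrow> \<bar>?S N fs x\<bar> = A * \<bar>indicat_real (dint n k) x * (dE b (int N + 1) x - davg b n k)\<bar>"
      using commutator_test_telescope[where n = n and k = k, OF U i p r(2) b j0 \<alpha>i \<alpha>] by blast
    obtain \<rho> :: "nat \<Rightarrow> nat" where \<rho>: "strict_mono \<rho>" "AE x in lborel. x \<in> dint n k \<longrightarrow> (\<lambda>l. dE b (n + int (\<rho> l)) x) \<longlonglongrightarrow> b x"
      using dE_subseq_AE[OF b] by blast
    \<comment> \<open>Truncation at \<open>N\<close> involves averages of level
      \<open>N + 1\<close>, so the subsequence is shifted by one. Dropping its first
      \<open>s0\<close> terms makes \<open>\<tau> l\<close> at least \<open>\<bar>n\<bar>\<close>,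
      as the test requires, and keeps the argument of \<open>nat\<close> nonnegative.\<close>
    define s0 where "s0 = 2 * nat \<bar>n\<bar> + 1"
    define \<tau> where "\<tau> l = nat (n + int (\<rho> (l + s0)) - 1)" for l
    have \<rho>ge: "l + s0 \<le> \<rho> (l + s0)" for l using strict_mono_imp_increasing[OF \<rho>(1)] by blast
    have \<tau>: "int (\<tau> l) + 1 = n + int (\<rho> (l + s0))" "nat \<bar>n\<bar> \<le> \<tau> l" for l
      unfolding \<tau>_def using \<rho>ge[of l] unfolding s0_def by auto
    have \<tau>mono: "strict_mono \<tau>"
    proof (rule strict_monoI)
      fix a c :: nat assume "a < c"
      then have "\<rho> (a + s0) < \<rho> (c + s0)" using \<rho>(1) by (simp add: strict_mono_less)
      then show "\<tau> a < \<tau> c" using \<tau>(1)[of a] \<tau>(1)[of c] by linarith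
    qed
    have "AE x in lborel. \<bar>op_limit ?S fs x\<bar> = A * \<bar>indicat_real (dint n k) x * (b x - davg b n k)\<bar>"
      using C[OF fs, THEN conjunct1] \<rho>(2)
    proof eventually_elim
      fix x assume c: "convergent (\<lambda>N. ?S N fs x)" and l: "x \<in> dint n k \<longrightarrow> (\<lambda>l. dE b (n + int (\<rho> l)) x) \<longlonglongrightarrow> b x"
      have "(\<lambda>l. \<bar>?S (\<tau> l) fs x\<bar>) \<longlonglongrightarrow> A * \<bar>indicat_real (dint n k) x * (b x - davg b n k)\<bar>"
        unfolding val[OF \<tau>(2)] \<tau>(1)
      proof (cases "x \<in> dint n k")
        case True
        then have "(\<lambda>l. dE b (n + int (\<rho> (l + s0))) x) \<longlonglongrightarrow> b x" using l LIMSEQ_ignore_initial_segment by blast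
        then show "(\<lambda>l. A * \<bar>indicat_real (dint n k) x * (dE b (n + int (\<rho> (l + s0))) x - davg b n k)\<bar>) \<longlonglongrightarrow> A * \<bar>indicat_real (dint n k) x * (b x - davg b n k)\<bar>"
          by (intro tendsto_mult tendsto_rabs tendsto_diff tendsto_const)
      qed simp
      then show "\<bar>op_limit ?S fs x\<bar> = A * \<bar>indicat_real (dint n k) x * (b x - davg b n k)\<bar>"
        by (rule op_limit_abs[where S = ?S, OF c \<tau>mono])
    qed
    then have "davg (\<lambda>x. \<bar>b x - davg b n k\<bar>) n k \<le> C * 2 powr (1 / p j0)"
      using C[OF fs] A r(1) unfolding nrm by (intro oscillation_bound[OF b]) (auto simp: mult_ac)
    also have "\<dots> \<le> \<bar>C\<bar> * 2"
    proof (rule mult_mono)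
      have "1 < p j0" using p j0 by blast
      then have "2 powr (1 / p j0) \<le> 2 powr 1" by (intro powr_mono) auto
      then show "2 powr (1 / p j0) \<le> 2" by simp
    qed auto
    finally show ?thesis by simp
  qed
  then have "2 powr (real_of_int n) * (LINT x:dint n k|lborel. \<bar>b x - davg b n k\<bar>) \<le> 2 * \<bar>C\<bar>" for n k
    unfolding davg_def[of "\<lambda>x. \<bar>b x - davg b n k\<bar>" for n k] .
  moreover have "\<forall>K. compact K \<longrightarrow> set_integrable lborel K b"
    using compact_integrable_of_Lp_mem[OF bq(2)] bq(1) by simp
  moreover have "b \<in> borel_measurable lborel" using bq(2) unfolding Lp_mem_def by simp
  ultimately show ?thesis unfolding BMO_d_def by blast
qed

theorem theorem4p4:
  fixes m i :: nat and \<alpha> :: "nat \<Rightarrow> nat" and p :: "nat \<Rightarrow> real" and r q :: real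
    and b :: "real \<Rightarrow> real"
  assumes "m \<ge> 2" and "U_set m \<alpha>" and "i \<in> {1..m}"
    and "\<forall>j\<in>{1..m}. 1 < p j" and "1 < r"
    and "(\<Sum>j=1..m. 1 / p j) = 1 / r"
    and "1 < q" and "Lp_mem q b"
  shows "(BMO_d b \<longleftrightarrow> (\<forall>\<epsilon>. bounded_seq \<epsilon> \<longrightarrow> bounded_multi m p r (comm_trunc b i \<epsilon> m \<alpha>)))
       \<and> (BMO_d b \<longleftrightarrow> bounded_multi m p r (comm_trunc b i (\<lambda>_ _. 1) m \<alpha>))"
proof -
  \<comment> \<open>The constant sequence 1 links the two equivalences: boundedness for all
    sequences contains the case tested in the converse, which closes the cycle of
    implications.\<close>
  have one: "bounded_seq (\<lambda>_ _. 1)" unfolding bounded_seq_def by (intro exI[of _ 1]) simp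
  have "bounded_multi m p r (comm_trunc b i \<epsilon> m \<alpha>)" if "BMO_d b" "bounded_seq \<epsilon>" for \<epsilon>
    by (rule bounded_multi_of_BMO_d[OF assms(2-8) that])
  moreover have "BMO_d b" if "bounded_multi m p r (comm_trunc b i (\<lambda>_ _. 1) m \<alpha>)"
    by (rule BMO_d_of_bounded_multi[OF assms that])
  ultimately show ?thesis using one by blast
qed

end
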